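(* Let $B$ be the algebra defined in the context, and assume that at least one of the following holds: 1) $s\ge2$ and $k_{2j}\ge2$ for all $1\le j\le m$; 2) $r\ge2$ and $k_{1j}\ge2$ for all $1\le j\le m$. Then $$\mathrm{ML}(B)=\mathbb{K}[y_1,\dots,y_m].$$
   Context: $\mathbb{K}$ is an algebraically closed field of characteristic zero, $m\ge1$, $A:=\mathbb{K}[Z,Y_1,\dots,Y_m,X_1,X_2]$, $$B:=A/(X_1Y_1^{k_{11}}\cdots Y_m^{k_{1m}}-f_1(Z,Y_1,\dots,Y_m),\ X_2Y_1^{k_{21}}\cdots Y_m^{k_{2m}}-f_2(Z,Y_1,\dots,Y_m,X_1)),$$ where $k_{ij}$ are positive integers, $f_1\in\mathbb{K}[Z,Y_1,\dots,Y_m]$ is monic in $Z$ of positive degree $r:=\deg_Zf_1$, and $f_2\in\mathbb{K}[Z,Y_1,\dots,Y_m,X_1]$ is monic in $X_1$ of positive degree $s:=\deg_{X_1}f_2$. The images of $Z,Y_j,X_i$ in $B$ are $z,y_j,x_i$. A locally nilpotent derivation (LND) of a $\mathbb{K}$-algebra $B$ is a $\mathbb{K}$-linear derivation $\delta:B\to B$ such that for every $f\in B$ there is $N$ with $\delta^N(f)=0$. The Makar-Limanov invariant is $\mathrm{ML}(B)=\bigcap_{\delta}\mathrm{Ker}(\delta)$, over all LNDs $\delta$ of $B$. *)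

theory Defs
  imports
    "HOL-Library.Poly_Mapping"
    "HOL-Algebra.Algebra"
    "HOL-Algebra.Algebraic_Closure_Type"
begin

section \<open>Multivariate polynomials\<close>

text \<open>
  A polynomial over \<open>'k\<close> in the variables \<open>'v\<close> is a finitely supported map from monomials to
  coefficients, a monomial being a finitely supported map from variables to exponents.
  \<^theory>\<open>HOL-Library.Poly_Mapping\<close> makes this type a commutative ring (convolution product).
\<close>

type_synonym ('v, 'k) mpoly = "('v \<Rightarrow>\<^sub>0 nat) \<Rightarrow>\<^sub>0 'k"

definition Const :: "'k::comm_ring_1 \<Rightarrow> ('v, 'k) mpoly" where
  "Const c = Poly_Mapping.single 0 c"

definition Var :: "'v \<Rightarrow> ('v, 'k::comm_ring_1) mpoly" where
  "Var v = Poly_Mapping.single (Poly_Mapping.single v 1) 1"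

definition polys_in :: "'v set \<Rightarrow> ('v, 'k::comm_ring_1) mpoly set" where
  "polys_in V = {p. \<forall>m \<in> Poly_Mapping.keys p. Poly_Mapping.keys m \<subseteq> V}"

text \<open>The zero polynomial gets degree \<open>0\<close>.\<close>

definition degree_in :: "'v \<Rightarrow> ('v, 'k::comm_ring_1) mpoly \<Rightarrow> nat" where
  "degree_in v p = Max (insert 0 ((\<lambda>m. Poly_Mapping.lookup m v) ` Poly_Mapping.keys p))"

text \<open>
  The coefficient of \<open>v\<^sup>d\<close> when \<open>p\<close> is read as a polynomial in \<open>v\<close> over the polynomials in the
  other variables; the subtraction removes \<open>v\<^sup>d\<close> from each monomial.
\<close>

definition coeff_in :: "'v \<Rightarrow> nat \<Rightarrow> ('v, 'k::comm_ring_1) mpoly \<Rightarrow> ('v, 'k) mpoly" where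
  "coeff_in v d p =
     (\<Sum>m \<in> {m \<in> Poly_Mapping.keys p. Poly_Mapping.lookup m v = d}.
        Poly_Mapping.single (m - Poly_Mapping.single v d) (Poly_Mapping.lookup p m))"

definition monic_in :: "'v \<Rightarrow> ('v, 'k::comm_ring_1) mpoly \<Rightarrow> bool" where
  "monic_in v p \<longleftrightarrow> coeff_in v (degree_in v p) p = 1"


section \<open>Locally nilpotent derivations and the Makar-Limanov invariant\<close>

text \<open>
  For a \<open>K\<close>-algebra \<open>B\<close> in the sense of the locale \<^locale>\<open>algebra\<close>. Only the values of a
  derivation on \<open>carrier B\<close> matter.
\<close>

definition derivations ::
    "('c, 'x) ring_scheme \<Rightarrow> ('c, 'a, 'y) module_scheme \<Rightarrow> ('a \<Rightarrow> 'a) set" where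
  "derivations K B = {\<delta> \<in> carrier B \<rightarrow> carrier B.
     (\<forall>a \<in> carrier B. \<forall>b \<in> carrier B. \<delta> (a \<oplus>\<^bsub>B\<^esub> b) = \<delta> a \<oplus>\<^bsub>B\<^esub> \<delta> b) \<and>
     (\<forall>c \<in> carrier K. \<forall>a \<in> carrier B. \<delta> (c \<odot>\<^bsub>B\<^esub> a) = c \<odot>\<^bsub>B\<^esub> \<delta> a) \<and>
     (\<forall>a \<in> carrier B. \<forall>b \<in> carrier B.
        \<delta> (a \<otimes>\<^bsub>B\<^esub> b) = (\<delta> a \<otimes>\<^bsub>B\<^esub> b) \<oplus>\<^bsub>B\<^esub> (a \<otimes>\<^bsub>B\<^esub> \<delta> b))}"

definition LNDs ::
    "('c, 'x) ring_scheme \<Rightarrow> ('c, 'a, 'y) module_scheme \<Rightarrow> ('a \<Rightarrow> 'a) set" where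
  "LNDs K B = {\<delta> \<in> derivations K B. \<forall>a \<in> carrier B. \<exists>N. (\<delta> ^^ N) a = \<zero>\<^bsub>B\<^esub>}"

definition Makar_Limanov ::
    "('c, 'x) ring_scheme \<Rightarrow> ('c, 'a, 'y) module_scheme \<Rightarrow> 'a set" where
  "Makar_Limanov K B = (\<Inter>\<delta> \<in> LNDs K B. a_kernel B B \<delta>)"

text \<open>\<open>K[S]\<close> for a subset \<open>S\<close> of a \<open>K\<close>-algebra \<open>B\<close>.\<close>

definition generate_subalgebra ::
    "('c, 'x) ring_scheme \<Rightarrow> ('c, 'a, 'y) module_scheme \<Rightarrow> 'a set \<Rightarrow> 'a set" where
  "generate_subalgebra K B S = generate_ring B ({c \<odot>\<^bsub>B\<^esub> \<one>\<^bsub>B\<^esub> | c. c \<in> carrier K} \<union> S)"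


section \<open>The algebra \<open>B\<close>\<close>

text \<open>
  The variables of \<open>A = K[Z, Y\<^sub>1, \<dots>, Y\<^sub>m, X\<^sub>1, X\<^sub>2]\<close>: the indices \<open>1, \<dots>, m\<close> are the elements of a
  finite (hence nonempty) type \<open>'m\<close> with \<open>m = CARD('m)\<close>.
\<close>

datatype 'm gen = Z | Y 'm | X1 | X2

abbreviation (input) K_ring :: "'k::field ring" where
  "K_ring \<equiv> ring_of_type_algebra"

abbreviation (input) A_ring :: "('m gen, 'k::field) mpoly ring" where
  "A_ring \<equiv> ring_of_type_algebra"

definition rel1 :: "('m::finite \<Rightarrow> nat) \<Rightarrow> ('m gen, 'k::field) mpoly \<Rightarrow> ('m gen, 'k) mpoly" where
  "rel1 k1 f1 = Var X1 * (\<Prod>j\<in>UNIV. Var (Y j) ^ k1 j) - f1"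

definition rel2 :: "('m::finite \<Rightarrow> nat) \<Rightarrow> ('m gen, 'k::field) mpoly \<Rightarrow> ('m gen, 'k) mpoly" where
  "rel2 k2 f2 = Var X2 * (\<Prod>j\<in>UNIV. Var (Y j) ^ k2 j) - f2"

definition rel_ideal ::
    "('m::finite \<Rightarrow> nat) \<Rightarrow> ('m \<Rightarrow> nat) \<Rightarrow> ('m gen, 'k::field) mpoly \<Rightarrow> ('m gen, 'k) mpoly
     \<Rightarrow> ('m gen, 'k) mpoly set" where
  "rel_ideal k1 k2 f1 f2 = genideal A_ring {rel1 k1 f1, rel2 k2 f2}"

definition B_class ::
    "('m::finite \<Rightarrow> nat) \<Rightarrow> ('m \<Rightarrow> nat) \<Rightarrow> ('m gen, 'k::field) mpoly \<Rightarrow> ('m gen, 'k) mpoly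
     \<Rightarrow> ('m gen, 'k) mpoly \<Rightarrow> ('m gen, 'k) mpoly set" where
  "B_class k1 k2 f1 f2 p = rel_ideal k1 k2 f1 f2 +>\<^bsub>A_ring\<^esub> p"

text \<open>The quotient ring, with scalars acting through the images of the constant polynomials.\<close>

definition B_alg ::
    "('m::finite \<Rightarrow> nat) \<Rightarrow> ('m \<Rightarrow> nat) \<Rightarrow> ('m gen, 'k::field) mpoly \<Rightarrow> ('m gen, 'k) mpoly
     \<Rightarrow> ('k, ('m gen, 'k) mpoly set) module" where
  "B_alg k1 k2 f1 f2 =
     (let Q = A_ring Quot rel_ideal k1 k2 f1 f2
      in ring.extend Q
           (module.fields (\<lambda>c b. B_class k1 k2 f1 f2 (Const c) \<otimes>\<^bsub>Q\<^esub> b)))"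

lemma B_alg_simps:
  "carrier (B_alg k1 k2 f1 f2) = carrier (A_ring Quot rel_ideal k1 k2 f1 f2)"
  "monoid.mult (B_alg k1 k2 f1 f2) = monoid.mult (A_ring Quot rel_ideal k1 k2 f1 f2)"
  "one (B_alg k1 k2 f1 f2) = one (A_ring Quot rel_ideal k1 k2 f1 f2)"
  "ring.zero (B_alg k1 k2 f1 f2) = ring.zero (A_ring Quot rel_ideal k1 k2 f1 f2)"
  "add (B_alg k1 k2 f1 f2) = add (A_ring Quot rel_ideal k1 k2 f1 f2)"
  "module.smult (B_alg k1 k2 f1 f2) c b =
     B_class k1 k2 f1 f2 (Const c) \<otimes>\<^bsub>A_ring Quot rel_ideal k1 k2 f1 f2\<^esub> b"
  by (simp_all add: B_alg_def Let_def ring.defs module.defs)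

lemma ideal_rel_ideal: "ideal (rel_ideal k1 k2 f1 f2) A_ring"
proof -
  interpret A: cring "A_ring" by (rule cring_from_type_algebra)
  show ?thesis
    unfolding rel_ideal_def
    by (rule A.genideal_ideal) (simp add: ring_of_type_algebra_def)
qed

lemma algebra_B_alg:
  fixes f1 f2 :: "('m::finite gen, 'k::field) mpoly"
  shows "algebra K_ring (B_alg k1 k2 f1 f2)"
proof -
  let ?A = "A_ring :: ('m gen, 'k) mpoly ring"
  let ?I = "rel_ideal k1 k2 f1 f2"
  let ?B = "B_alg k1 k2 f1 f2"
  let ?p = "B_class k1 k2 f1 f2"
  interpret A: cring ?A by (rule cring_from_type_algebra)
  interpret K: cring "K_ring :: 'k ring" by (rule cring_from_type_algebra)
  interpret I: ideal ?I ?A by (rule ideal_rel_ideal)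
  interpret Q: cring "?A Quot ?I" by (rule I.quotient_is_cring[OF A.cring_axioms])
  have hom: "?p \<in> ring_hom ?A (?A Quot ?I)"
    using I.rcos_ring_hom unfolding B_class_def by (simp add: eta_contract_eq)
  have C: "?p (Const c) \<in> carrier (?A Quot ?I)" for c
    using ring_hom_closed[OF hom] by (simp add: ring_of_type_algebra_def)
  have Cadd: "?p (Const (c + d)) = ?p (Const c) \<oplus>\<^bsub>?A Quot ?I\<^esub> ?p (Const d)" for c d
    using ring_hom_add[OF hom, of "Const c" "Const d"]
    by (simp add: ring_of_type_algebra_def Const_def single_add)
  have Cmult: "?p (Const (c * d)) = ?p (Const c) \<otimes>\<^bsub>?A Quot ?I\<^esub> ?p (Const d)" for c d
    using ring_hom_mult[OF hom, of "Const c" "Const d"]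
    by (simp add: ring_of_type_algebra_def Const_def mult_single)
  have Cone: "?p (Const 1) = \<one>\<^bsub>?A Quot ?I\<^esub>"
    using ring_hom_one[OF hom] by (simp add: ring_of_type_algebra_def Const_def)
  have cB: "cring ?B"
    by (intro cringI abelian_groupI comm_monoidI)
       (simp_all add: B_alg_simps Q.a_assoc Q.m_assoc Q.l_distr,
        (metis Q.a_comm Q.m_comm Q.l_neg Q.a_inv_closed)+)
  have K: "a \<oplus>\<^bsub>K_ring\<^esub> b = a + b" "a \<otimes>\<^bsub>K_ring\<^esub> b = a * b" "\<one>\<^bsub>K_ring\<^esub> = 1" for a b :: 'k
    by (simp_all add: ring_of_type_algebra_def)
  show ?thesis
    by (rule algebraI)
       (use K.cring_axioms cB C in
         \<open>simp_all add: B_alg_simps K Cadd Cmult Cone Q.l_distr Q.r_distr Q.m_assoc\<close>)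
qed

end

theory Submission
  imports Defs "HOL-Computational_Algebra.Polynomial"
begin

text \<open>
  The algebra \<open>B\<close> is studied inside the Laurent polynomials \<open>K[Y, Y^-1, Z]\<close>: it is the subring \<open>S\<close>
  generated by the \<open>Y i\<close>, by \<open>Z\<close>, by \<open>x1 = f1 / Y^k1\<close> and by \<open>x2 = f2 / Y^k2\<close>. That no relations
  other than the two given ones hold between these generators (\<open>kernel_phi\<close>) is due to \<open>f1\<close> and \<open>f2\<close>
  being monic: modulo \<open>Y i\<close> the two relations become \<open>f1\<close> and \<open>f2\<close>, a regular sequence, so \<open>Y i\<close> is
  a nonzerodivisor in the quotient and one may invert all \<open>Y i\<close> without losing information.
  
  The invariant is not larger than \<open>K[Y]\<close>: the derivation \<open>D = Y^(k1 + k2) * d/dZ\<close> maps \<open>S\<close> into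
  itself and lowers degrees in \<open>Z\<close>, hence is locally nilpotent. An element that it kills is free of
  \<open>Z\<close>, and the elements of \<open>S\<close> free of \<open>Z\<close> are the polynomials in the \<open>Y i\<close> (\<open>Z_free_in_image\<close>).
  
  For the converse, fix an index \<open>j\<close> and a locally nilpotent derivation \<open>d\<close> of \<open>S\<close>; it has to be
  shown that \<open>d\<close> kills \<open>Y j\<close>. Give \<open>Z\<close> the weight \<open>1\<close>, \<open>Y j\<close> the weight \<open>- M\<close> with a large \<open>M\<close>, and
  the other \<open>Y i\<close> the weight \<open>0\<close>. Then the parts of \<open>x1\<close> and \<open>x2\<close> of highest weight are the monomials
  \<open>Z^r / Y^k1\<close> and \<open>Z^(r s) / (Y^(s k1) * Y^k2)\<close>. After breaking ties between exponents of equal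
  weight by a linear order, every nonzero element of \<open>S\<close> has a leading exponent, these exponents form
  the monoid \<open>P\<close> generated by the exponents of the four kinds of generators, and every element of \<open>S\<close>
  is a combination of monomials in the generators that do not exceed its leading exponent
  (\<open>representation\<close>). The passage to leading terms therefore turns \<open>d\<close> into a derivation of the form
  \<open>\<chi> u \<mapsto> lin u * \<chi> (u + e)\<close> with an additive function \<open>lin\<close> on exponents and a fixed shift
  \<open>e\<close>. As \<open>d\<close> is locally nilpotent, \<open>lin\<close> is, up to a scalar factor, a function \<open>ell\<close> that takes
  natural numbers as values on \<open>P\<close>, with \<open>ell e = - 1\<close>, and all the points \<open>u + t * e\<close> with
  \<open>0 \<le> t \<le> ell u\<close> must lie in \<open>P\<close> (\<open>line_terminates\<close>).
  
  So \<open>ell\<close> is the distance to a facet of the cone spanned by \<open>P\<close>. If this were a facet opposite to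
  some \<open>Y i\<close>, then the points \<open>Y i + e\<close> and \<open>Z + e\<close>, or \<open>Y i + e\<close> and \<open>X1 + e\<close>, would have to lie in
  \<open>P\<close>, and comparing their coordinates modulo \<open>r\<close> or modulo \<open>s\<close> contradicts the hypothesis on the
  exponents (\<open>no_facet_opposite_Y\<close>). Hence \<open>ell\<close> vanishes on all \<open>Y i\<close> and is the degree in \<open>Z\<close>, and
  the shift \<open>e\<close> lowers the degree in \<open>Z\<close> by one. Since \<open>X1 + r * e\<close> lies in \<open>P\<close>, the shift must also
  raise the degree in \<open>Y j\<close>, so that it lowers the weight, and already \<open>d Z\<close> has negative
  weight. The last nonzero element \<open>f\<close> of the sequence \<open>d Z, d (d Z), ...\<close> lies in the kernel of \<open>d\<close>
  and has negative weight too. Among the generators only \<open>Y j\<close> has negative weight, so by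
  \<open>representation\<close> the element \<open>f\<close> is divisible by \<open>Y j\<close> in \<open>S\<close>. Kernels of locally nilpotent
  derivations are factorially closed, so \<open>d\<close> kills \<open>Y j\<close>.
\<close>

instance gen :: (finite) finite
proof
  have "(UNIV :: 'a gen set) \<subseteq> {Z, X1, X2} \<union> range Y"
  proof
    fix v :: "'a gen"
    show "v \<in> {Z, X1, X2} \<union> range Y" by (cases v) auto
  qed
  then show "finite (UNIV :: 'a gen set)"
    by (rule finite_subset) simp
qed

section \<open>Evaluating multivariate polynomials\<close>

lemma sum_of_monomials:
  "p = (\<Sum>m\<in>Poly_Mapping.keys p. Poly_Mapping.single m (Poly_Mapping.lookup p m))"
proof (rule poly_mapping_eqI)
  fix k
  have "Poly_Mapping.lookup (\<Sum>m\<in>Poly_Mapping.keys p. Poly_Mapping.single m (Poly_Mapping.lookup p m)) k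
      = (\<Sum>m\<in>Poly_Mapping.keys p. if m = k then Poly_Mapping.lookup p m else 0)"
    by (simp only: lookup_sum lookup_single when_def)
  also have "\<dots> = Poly_Mapping.lookup p k"
    by (simp only: sum.delta finite_keys in_keys_iff if_True split: if_split) simp
  finally show "Poly_Mapping.lookup p k = Poly_Mapping.lookup
      (\<Sum>m\<in>Poly_Mapping.keys p. Poly_Mapping.single m (Poly_Mapping.lookup p m)) k" by (rule sym)
qed

lemma single_eq_Const_mult: "Poly_Mapping.single m c = Const c * Poly_Mapping.single m (1::'k::comm_ring_1)"
  by (simp add: Const_def mult_single)

lemma monomial_induct [case_names zero step]:
  fixes m :: "'v \<Rightarrow>\<^sub>0 nat"
  assumes "P 0" and "\<And>m v. P m \<Longrightarrow> P (m + Poly_Mapping.single v 1)"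
  shows "P m"
proof (induction "\<Sum>v\<in>Poly_Mapping.keys m. Poly_Mapping.lookup m v" arbitrary: m rule: less_induct)
  case less
  show ?case
  proof (cases "m = 0")
    case True
    then show ?thesis using assms by simp
  next
    case False
    then obtain v where v: "v \<in> Poly_Mapping.keys m" by fastforce
    define n where "n = m - Poly_Mapping.single v 1"
    have m: "m = n + Poly_Mapping.single v 1"
      using v by (intro poly_mapping_eqI)
        (auto simp: n_def lookup_add lookup_minus lookup_single when_def in_keys_iff)
    have sub: "Poly_Mapping.keys n \<subseteq> Poly_Mapping.keys m"
      by (auto simp: n_def lookup_minus in_keys_iff)
    have "(\<Sum>v\<in>Poly_Mapping.keys n. Poly_Mapping.lookup n v)
        = (\<Sum>v\<in>Poly_Mapping.keys m. Poly_Mapping.lookup n v)"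
      using sub by (intro sum.mono_neutral_left) (auto simp: in_keys_iff)
    also have "\<dots> < (\<Sum>v\<in>Poly_Mapping.keys m. Poly_Mapping.lookup m v)"
      using v by (intro sum_strict_mono_ex1 bexI[of _ v])
        (auto simp: n_def lookup_minus lookup_single in_keys_iff)
    finally have "P n" by (rule less)
    then show ?thesis using assms(2) m by simp
  qed
qed

definition monomial_value :: "('v::finite \<Rightarrow> 'a::comm_ring_1) \<Rightarrow> ('v \<Rightarrow>\<^sub>0 nat) \<Rightarrow> 'a" where
  "monomial_value x m = (\<Prod>v\<in>UNIV. x v ^ Poly_Mapping.lookup m v)"

lemma monomial_value_0 [simp]: "monomial_value x 0 = 1"
  by (simp add: monomial_value_def)

lemma monomial_value_add: "monomial_value x (m + n) = monomial_value x m * monomial_value x n"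
  by (simp add: monomial_value_def lookup_add power_add prod.distrib)

lemma monomial_value_single [simp]: "monomial_value x (Poly_Mapping.single v n) = x v ^ n"
proof -
  have "monomial_value x (Poly_Mapping.single v n) = (\<Prod>u\<in>UNIV. if u = v then x u ^ n else 1)"
    unfolding monomial_value_def by (rule prod.cong) (auto simp: lookup_single when_def)
  then show ?thesis by simp
qed

text \<open>
  Substitution of elements of a ring for the variables, along a ring homomorphism \<open>c\<close> of the
  coefficients. It is used for reading a polynomial as a univariate one and for the map from the
  polynomial ring \<open>A\<close> to Laurent polynomials.
\<close>

locale evaluation =
  fixes c :: "'k::comm_ring_1 \<Rightarrow> 'a::comm_ring_1" and x :: "'v::finite \<Rightarrow> 'a"
  assumes c0 [simp]: "c 0 = 0" and c1 [simp]: "c 1 = 1"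
    and c_add: "c (a + b) = c a + c b" and c_mult: "c (a * b) = c a * c b"
begin

definition eval :: "('v, 'k) mpoly \<Rightarrow> 'a" where
  "eval p = (\<Sum>m\<in>Poly_Mapping.keys p. c (Poly_Mapping.lookup p m) * monomial_value x m)"

lemma eval_superset:
  assumes "finite S" "Poly_Mapping.keys p \<subseteq> S"
  shows "eval p = (\<Sum>m\<in>S. c (Poly_Mapping.lookup p m) * monomial_value x m)"
  unfolding eval_def using assms by (intro sum.mono_neutral_left) (auto simp: in_keys_iff)

lemma eval_single [simp]: "eval (Poly_Mapping.single m a) = c a * monomial_value x m"
  by (cases "a = 0") (simp_all add: eval_def)

lemma eval_0 [simp]: "eval 0 = 0" and eval_1 [simp]: "eval 1 = 1"
  by (simp_all add: eval_def)

lemma eval_Const [simp]: "eval (Const a) = c a"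
  by (simp add: Const_def)

lemma eval_Var [simp]: "eval (Var v) = x v"
  by (simp add: Var_def)

lemma eval_add: "eval (p + q) = eval p + eval q"
proof -
  let ?S = "Poly_Mapping.keys p \<union> Poly_Mapping.keys q"
  have "eval (p + q) = (\<Sum>m\<in>?S. c (Poly_Mapping.lookup (p + q) m) * monomial_value x m)"
    by (rule eval_superset) (use Poly_Mapping.keys_add[of p q] in auto)
  also have "\<dots> = (\<Sum>m\<in>?S. c (Poly_Mapping.lookup p m) * monomial_value x m)
               + (\<Sum>m\<in>?S. c (Poly_Mapping.lookup q m) * monomial_value x m)"
    by (simp add: lookup_add c_add distrib_right sum.distrib)
  finally show ?thesis by (simp add: eval_superset[of ?S])
qed

lemma eval_sum: "eval (\<Sum>i\<in>I. p i) = (\<Sum>i\<in>I. eval (p i))"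
  by (induction I rule: infinite_finite_induct) (simp_all add: eval_add)

lemma eval_mult: "eval (p * q) = eval p * eval q"
proof -
  have "eval (p * q) = eval ((\<Sum>m\<in>Poly_Mapping.keys p. Poly_Mapping.single m (Poly_Mapping.lookup p m)) *
      (\<Sum>m\<in>Poly_Mapping.keys q. Poly_Mapping.single m (Poly_Mapping.lookup q m)))"
    using sum_of_monomials[of p] sum_of_monomials[of q] by simp
  also have "\<dots> = eval p * eval q"
    by (simp add: sum_product eval_sum mult_single c_mult monomial_value_add)
       (simp add: eval_def sum_product ac_simps)
  finally show ?thesis .
qed

lemma eval_uminus: "eval (- p) = - eval p"
  using eval_add[of p "- p"] by (simp add: eq_neg_iff_add_eq_0 add.commute)

lemma eval_diff: "eval (p - q) = eval p - eval q"
  using eval_add[of p "- q"] by (simp add: eval_uminus)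

lemma eval_power: "eval (p ^ n) = eval p ^ n"
  by (induction n) (simp_all add: eval_mult)

lemma eval_prod: "eval (\<Prod>i\<in>I. p i) = (\<Prod>i\<in>I. eval (p i))"
  by (induction I rule: infinite_finite_induct) (simp_all add: eval_mult)

lemmas eval_hom = eval_add eval_diff eval_uminus eval_mult eval_power eval_prod eval_sum

end

lemma eval_cong:
  assumes "evaluation c" and "p \<in> polys_in V" and "\<And>v. v \<in> V \<Longrightarrow> x v = x' v"
  shows "evaluation.eval c x p = evaluation.eval c x' p"
proof -
  interpret evaluation c x by fact
  interpret e': evaluation c x' by fact
  have "monomial_value x m = monomial_value x' m" if "m \<in> Poly_Mapping.keys p" for m
    unfolding monomial_value_def
  proof (rule prod.cong)
    fix v
    show "x v ^ Poly_Mapping.lookup m v = x' v ^ Poly_Mapping.lookup m v"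
    proof (cases "v \<in> Poly_Mapping.keys m")
      case True
      then have "v \<in> V" using that assms(2) by (auto simp: polys_in_def)
      then show ?thesis using assms(3) by simp
    qed (simp add: in_keys_iff)
  qed simp
  then show ?thesis by (simp add: eval_def e'.eval_def)
qed

lemma polys_in_add: "p \<in> polys_in V \<Longrightarrow> q \<in> polys_in V \<Longrightarrow> p + q \<in> polys_in V"
  using Poly_Mapping.keys_add[of p q] by (fastforce simp: polys_in_def)

lemma polys_in_Const [simp]: "Const a \<in> polys_in V"
  by (simp add: polys_in_def Const_def)

lemma polys_in_Var: "v \<in> V \<Longrightarrow> Var v \<in> polys_in V"
  by (simp add: polys_in_def Var_def)

lemma polys_in_mult:
  assumes "p \<in> polys_in V" "q \<in> polys_in V" shows "p * q \<in> polys_in V"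
  unfolding polys_in_def
proof safe
  fix m v assume "m \<in> Poly_Mapping.keys (p * q)" and v: "v \<in> Poly_Mapping.keys m"
  then obtain a b where "a \<in> Poly_Mapping.keys p" "b \<in> Poly_Mapping.keys q" "m = a + b"
    using Poly_Mapping.keys_mult[of p q] by blast
  with v Poly_Mapping.keys_add[of a b] assms show "v \<in> V" by (fastforce simp: polys_in_def)
qed

lemma polys_in_1 [simp]: "1 \<in> polys_in V"
  by (simp add: polys_in_def)

lemma polys_in_power: "p \<in> polys_in V \<Longrightarrow> p ^ n \<in> polys_in V"
  by (induction n) (simp_all add: polys_in_mult)

lemma polys_in_prod: "(\<And>i. i \<in> S \<Longrightarrow> p i \<in> polys_in V) \<Longrightarrow> (\<Prod>i\<in>S. p i) \<in> polys_in V"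
  by (induction S rule: infinite_finite_induct) (simp_all add: polys_in_mult)

lemmas polys_in_intros = polys_in_add polys_in_mult polys_in_Var polys_in_power polys_in_prod

lemma polys_in_mono: "p \<in> polys_in V \<Longrightarrow> V \<subseteq> W \<Longrightarrow> p \<in> polys_in W"
  by (auto simp: polys_in_def)

lemma polys_in_UNIV [simp]: "p \<in> polys_in UNIV"
  by (simp add: polys_in_def)

lemma mpoly_induct [consumes 1, case_names Const Var add mult]:
  fixes p :: "('v, 'k::comm_ring_1) mpoly"
  assumes p: "p \<in> polys_in V"
    and Const: "\<And>a. P (Const a)" and Var: "\<And>v. v \<in> V \<Longrightarrow> P (Var v)"
    and add: "\<And>p q. p \<in> polys_in V \<Longrightarrow> q \<in> polys_in V \<Longrightarrow> P p \<Longrightarrow> P q \<Longrightarrow> P (p + q)"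
    and mult: "\<And>p q. p \<in> polys_in V \<Longrightarrow> q \<in> polys_in V \<Longrightarrow> P p \<Longrightarrow> P q \<Longrightarrow> P (p * q)"
  shows "P p"
proof -
  have mon: "Poly_Mapping.keys m \<subseteq> V \<Longrightarrow>
      P (Poly_Mapping.single m 1) \<and> Poly_Mapping.single m (1::'k) \<in> polys_in V" for m
  proof (induction m rule: monomial_induct)
    case zero
    then show ?case using Const[of 1] by (simp add: Const_def polys_in_def)
  next
    case (step m v)
    have "Poly_Mapping.keys m \<subseteq> V" "v \<in> V"
      using step(2) by (auto simp: in_keys_iff lookup_add lookup_single subset_iff)
    with step.IH have "P (Poly_Mapping.single m 1 * Var v) \<and> Poly_Mapping.single m 1 * Var v \<in> (polys_in V :: ('v, 'k) mpoly set)"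
      by (auto intro!: mult Var polys_in_mult polys_in_Var)
    then show ?case by (simp add: Var_def mult_single)
  qed
  have "S \<subseteq> Poly_Mapping.keys p \<Longrightarrow>
      (\<Sum>m\<in>S. Poly_Mapping.single m (Poly_Mapping.lookup p m)) \<in> polys_in V \<and>
      P (\<Sum>m\<in>S. Poly_Mapping.single m (Poly_Mapping.lookup p m))" if "finite S" for S
    using that
  proof (induction S)
    case empty
    show ?case using Const[of 0] polys_in_Const[of 0 V] by (simp add: Const_def)
  next
    case (insert m S)
    have "Poly_Mapping.keys m \<subseteq> V" using insert.prems p by (auto simp: polys_in_def)
    then have "Const (Poly_Mapping.lookup p m) * Poly_Mapping.single m 1 \<in> polys_in V"
        "P (Const (Poly_Mapping.lookup p m) * Poly_Mapping.single m 1)"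
      using mon[of m] Const by (auto intro!: mult polys_in_mult)
    then have "Poly_Mapping.single m (Poly_Mapping.lookup p m) \<in> polys_in V"
        "P (Poly_Mapping.single m (Poly_Mapping.lookup p m))"
      by (simp_all flip: single_eq_Const_mult)
    then show ?case using insert by (auto intro!: add polys_in_add)
  qed
  from this[of "Poly_Mapping.keys p"] show ?thesis
    using sum_of_monomials[of p] by simp
qed

text \<open>
  All uses of monicity go through this decomposition: it exhibits the leading power and bounds the
  degree of the remaining terms monomial by monomial.
\<close>

lemma monic_in_decompose:
  fixes p :: "('v, 'k::comm_ring_1) mpoly"
  assumes "monic_in v p" "p \<in> polys_in V"
  obtains q where "p = Var v ^ degree_in v p + q" "q \<in> polys_in V"
    "\<And>m. m \<in> Poly_Mapping.keys q \<Longrightarrow> Poly_Mapping.lookup m v < degree_in v p"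
proof -
  define d where "d = degree_in v p"
  define T where "T = {m \<in> Poly_Mapping.keys p. Poly_Mapping.lookup m v = d}"
  define q where "q = (\<Sum>m\<in>Poly_Mapping.keys p - T. Poly_Mapping.single m (Poly_Mapping.lookup p m))"
  have Vpow: "Var v ^ n = Poly_Mapping.single (Poly_Mapping.single v n) (1::'k)" for n
    by (induction n) (simp_all add: Var_def mult_single single_add[symmetric])
  have "(\<Sum>m\<in>T. Poly_Mapping.single m (Poly_Mapping.lookup p m)) =
     (\<Sum>m\<in>T. Poly_Mapping.single (m - Poly_Mapping.single v d) (Poly_Mapping.lookup p m) * Var v ^ d)"
  proof (rule sum.cong)
    fix m assume "m \<in> T"
    then have "m - Poly_Mapping.single v d + Poly_Mapping.single v d = m"
      by (intro poly_mapping_eqI) (auto simp: T_def lookup_add lookup_minus lookup_single when_def)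
    then show "Poly_Mapping.single m (Poly_Mapping.lookup p m) =
       Poly_Mapping.single (m - Poly_Mapping.single v d) (Poly_Mapping.lookup p m) * Var v ^ d"
      by (simp add: Vpow mult_single)
  qed simp
  also have "\<dots> = coeff_in v d p * Var v ^ d"
    by (simp add: coeff_in_def T_def sum_distrib_right)
  also have "\<dots> = Var v ^ d" using assms(1) by (simp add: monic_in_def d_def)
  finally have T: "(\<Sum>m\<in>T. Poly_Mapping.single m (Poly_Mapping.lookup p m)) = Var v ^ d" .
  have "p = (\<Sum>m\<in>T. Poly_Mapping.single m (Poly_Mapping.lookup p m)) + q"
    unfolding q_def using sum_of_monomials[of p]
      sum.subset_diff[of T "Poly_Mapping.keys p" "\<lambda>m. Poly_Mapping.single m (Poly_Mapping.lookup p m)"]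
    by (simp add: T_def add.commute)
  with T have pq: "p = Var v ^ d + q" by simp
  have keys: "Poly_Mapping.keys q \<subseteq> Poly_Mapping.keys p - T"
  proof
    fix m assume "m \<in> Poly_Mapping.keys q"
    then have "Poly_Mapping.lookup q m \<noteq> 0" by (simp add: in_keys_iff)
    then show "m \<in> Poly_Mapping.keys p - T"
      by (rule contrapos_np) (auto simp: q_def lookup_sum lookup_single when_def intro!: sum.neutral)
  qed
  have le: "Poly_Mapping.lookup m v \<le> d" if "m \<in> Poly_Mapping.keys p" for m
    unfolding d_def degree_in_def using that by (intro Max_ge) auto
  show ?thesis
  proof (rule that[of q])
    show "p = Var v ^ degree_in v p + q" using pq by (simp add: d_def)
    show "q \<in> polys_in V" using keys assms(2) by (auto simp: polys_in_def)
    fix m assume "m \<in> Poly_Mapping.keys q"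
    with keys have m: "m \<in> Poly_Mapping.keys p" "m \<notin> T" by auto
    then show "Poly_Mapping.lookup m v < degree_in v p"
      using le[of m] by (auto simp: T_def d_def)
  qed
qed

section \<open>Monic polynomials modulo an ideal\<close>

text \<open>
  The leading coefficient of \<open>Q\<close> is that of \<open>P * Q\<close> and hence lies in the ideal \<open>J\<close>; subtracting the
  leading term of \<open>Q\<close> leaves a polynomial of smaller degree with the same property.
\<close>

lemma monic_coeffs_in_ideal:
  fixes P Q :: "'a::comm_ring_1 Polynomial.poly"
  assumes J: "0 \<in> J" "\<And>a b. a \<in> J \<Longrightarrow> b \<in> J \<Longrightarrow> a - b \<in> J" "\<And>a b. a \<in> J \<Longrightarrow> b * a \<in> J"
    and P: "Polynomial.lead_coeff P = 1"
    and PQ: "\<And>i. Polynomial.coeff (P * Q) i \<in> J"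
  shows "Polynomial.coeff Q i \<in> J"
  using PQ
proof (induction "Polynomial.degree Q" arbitrary: Q i rule: less_induct)
  case less
  let ?n = "Polynomial.degree Q" and ?q = "Polynomial.lead_coeff Q"
  have q: "?q \<in> J"
    using less.prems[of "Polynomial.degree P + ?n"] P by (simp add: coeff_mult_degree_sum)
  define R where "R = Q - Polynomial.monom ?q ?n"
  show ?case
  proof (cases "?n = 0")
    case True
    then show ?thesis using q J(1) by (cases i) (auto simp: coeff_eq_0)
  next
    case False
    have PR: "Polynomial.coeff (P * R) k \<in> J" for k
    proof -
      have "Polynomial.coeff (P * R) k = Polynomial.coeff (P * Q) k - Polynomial.coeff (P * Polynomial.monom ?q ?n) k"
        by (simp add: R_def algebra_simps)
      moreover have "Polynomial.coeff (P * Polynomial.monom ?q ?n) k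
          = (if ?n \<le> k then Polynomial.coeff P (k - ?n) * ?q else 0)"
        by (subst mult.commute) (simp add: coeff_monom_mult)
      then have "Polynomial.coeff (P * Polynomial.monom ?q ?n) k \<in> J"
        using J(1) J(3)[OF q] by simp
      ultimately show ?thesis using J(2) less.prems by simp
    qed
    have "Polynomial.degree R < ?n"
    proof -
      have "Polynomial.degree R \<le> ?n"
        unfolding R_def by (intro degree_diff_le) (simp_all add: degree_monom_le)
      moreover have "Polynomial.coeff R ?n = 0" by (simp add: R_def)
      ultimately show ?thesis using False
        using eq_zero_or_degree_less[of R ?n] by auto
    qed
    then have R: "Polynomial.coeff R i \<in> J" by (rule less.hyps) (rule PR)
    have "0 - Polynomial.coeff (Polynomial.monom ?q ?n) i \<in> J"
      by (rule J(2)[OF J(1)]) (use J(1) q in \<open>simp only: coeff_monom split: if_split, blast\<close>)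
    from J(2)[OF R this] have "Polynomial.coeff R i - (0 - Polynomial.coeff (Polynomial.monom ?q ?n) i) \<in> J" .
    moreover have "Q = R + Polynomial.monom ?q ?n" unfolding R_def by (rule diff_add_cancel[symmetric])
    then have "Polynomial.coeff Q i = Polynomial.coeff R i + Polynomial.coeff (Polynomial.monom ?q ?n) i"
      by (metis Polynomial.coeff_add)
    ultimately show ?thesis by simp
  qed
qed

text \<open>
  The coefficients stay in the full polynomial ring, so that the value of the univariate polynomial
  at \<open>Var v\<close> is the polynomial that one started with.
\<close>

definition as_univariate :: "'v::finite \<Rightarrow> ('v, 'k::comm_ring_1) mpoly \<Rightarrow> ('v, 'k) mpoly Polynomial.poly" where
  "as_univariate v = evaluation.eval (\<lambda>a. [:Const a:]) (\<lambda>u. if u = v then [:0, 1:] else [:Var u:])"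

lemma Const_hom [simp]: "Const 0 = 0" "Const 1 = 1" "Const (a + b) = Const a + Const b"
   "Const (a * b) = Const a * Const b"
  by (simp_all add: Const_def single_add mult_single)

interpretation as_univariate: evaluation "\<lambda>a. [:Const a :: ('v::finite, 'k::comm_ring_1) mpoly:]"
    "\<lambda>u. if u = v then [:0, 1:] else [:Var u:]"
  rewrites "evaluation.eval (\<lambda>a. [:Const a :: ('v::finite, 'k::comm_ring_1) mpoly:]) (\<lambda>u. if u = v then [:0, 1:] else [:Var u:]) = as_univariate v"
  for v
  by unfold_locales (simp_all add: one_pCons as_univariate_def)

lemma poly_as_univariate [simp]: "Polynomial.poly (as_univariate v p) (Var v) = p"
  using polys_in_UNIV[of p]
  by (induction p rule: mpoly_induct)
     (simp_all add: as_univariate.eval_hom)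

lemma as_univariate_const:
  assumes "p \<in> polys_in V" "v \<notin> V"
  shows "as_univariate v p = [:p:]"
  using assms(1)
  by (induction p rule: mpoly_induct)
     (use assms(2) in \<open>auto simp: as_univariate.eval_hom\<close>)

lemma lead_coeff_as_univariate:
  fixes p :: "('v::finite, 'k::comm_ring_1) mpoly"
  assumes p: "p = Var v ^ d + q" and d: "d > 0"
    and q: "\<And>m. m \<in> Poly_Mapping.keys q \<Longrightarrow> Poly_Mapping.lookup m v < d"
  shows "Polynomial.lead_coeff (as_univariate v p) = 1"
proof -
  have mon: "Polynomial.degree (monomial_value (\<lambda>u. if u = v then [:0, 1:] else [:Var u:]) m
      :: ('v, 'k) mpoly Polynomial.poly) \<le> Poly_Mapping.lookup m v" for m
  proof -
    have "Polynomial.degree (monomial_value (\<lambda>u. if u = v then [:0, 1:] else [:Var u:]) m :: ('v, 'k) mpoly Polynomial.poly)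
       \<le> (\<Sum>u\<in>UNIV. Polynomial.degree ((if u = v then [:0, 1:] else [:Var u:]) ^ Poly_Mapping.lookup m u :: ('v, 'k) mpoly Polynomial.poly))"
      unfolding monomial_value_def by (rule order.trans[OF degree_prod_sum_le]) (simp_all add: o_def)
    also have "\<dots> \<le> (\<Sum>u\<in>UNIV. if u = v then Poly_Mapping.lookup m v else 0)"
      by (intro sum_mono order.trans[OF degree_power_le]) auto
    finally show ?thesis by simp
  qed
  have "Polynomial.degree (as_univariate v q) \<le> d - 1"
    unfolding as_univariate.eval_def
  proof (rule degree_sum_le)
    fix m assume "m \<in> Poly_Mapping.keys q"
    then have "Poly_Mapping.lookup m v \<le> d - 1" using q by fastforce
    then show "Polynomial.degree ([:Const (Poly_Mapping.lookup q m):] * monomial_value (\<lambda>u. if u = v then [:0, 1:] else [:Var u:]) m) \<le> d - 1"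
      using mon[of m] by (intro order.trans[OF degree_mult_le]) simp
  qed simp
  then have deg: "Polynomial.degree (as_univariate v q) < d" using d by simp
  have e: "as_univariate v p = Polynomial.monom 1 d + as_univariate v q"
    by (simp add: p as_univariate.eval_hom monom_altdef)
  have "Polynomial.degree (Polynomial.monom (1::('v,'k) mpoly) d) = d" by (simp add: degree_monom_eq)
  with deg show ?thesis unfolding e
    by (simp add: degree_add_eq_left coeff_eq_0)
qed

lemma lookup_single_mult:
  fixes p :: "('v, 'k::comm_ring_1) mpoly"
  shows "Poly_Mapping.lookup (Poly_Mapping.single a 1 * p) (a + m) = Poly_Mapping.lookup p m"
proof -
  have "Poly_Mapping.single a 1 * p = (\<Sum>n\<in>Poly_Mapping.keys p. Poly_Mapping.single (a + n) (Poly_Mapping.lookup p n))"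
    by (subst sum_of_monomials[of p]) (simp add: sum_distrib_left mult_single)
  also have "Poly_Mapping.lookup \<dots> (a + m) = (\<Sum>n\<in>Poly_Mapping.keys p. if n = m then Poly_Mapping.lookup p n else 0)"
    by (simp add: lookup_sum lookup_single when_def)
  also have "\<dots> = Poly_Mapping.lookup p m"
    by (simp add: in_keys_iff)
  finally show ?thesis .
qed

lemma Var_mult_cancel:
  assumes "Var v * p = Var v * q" shows "p = q"
proof (rule poly_mapping_eqI)
  fix m show "Poly_Mapping.lookup p m = Poly_Mapping.lookup q m"
    using arg_cong[OF assms, of "\<lambda>t. Poly_Mapping.lookup t (Poly_Mapping.single v 1 + m)"]
    unfolding Var_def lookup_single_mult .
qed

text \<open>
  Membership in an ideal whose generators do not involve \<open>v\<close> can be tested on the coefficients with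
  respect to \<open>v\<close>. By \<open>monic_coeffs_in_ideal\<close> a polynomial that is monic in \<open>v\<close> is therefore a
  nonzerodivisor modulo such an ideal.
\<close>

lemma monic_nonzerodivisor_mod:
  assumes lead: "Polynomial.lead_coeff (as_univariate v f) = 1"
    and xy: "x \<in> polys_in V" "y \<in> polys_in V" "v \<notin> V"
    and eq: "f * c = x * u + y * w"
  shows "\<exists>u' w'. c = x * u' + y * w'"
proof -
  define J where "J = {t. \<exists>u w. t = x * u + y * w}"
  have J: "0 \<in> J" "\<And>a b. a \<in> J \<Longrightarrow> b \<in> J \<Longrightarrow> a - b \<in> J" "\<And>a b. a \<in> J \<Longrightarrow> b * a \<in> J"
      "\<And>a b. a \<in> J \<Longrightarrow> b \<in> J \<Longrightarrow> a + b \<in> J"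
  proof -
    show "0 \<in> J" unfolding J_def by (auto intro!: exI[of _ 0])
    fix a b assume "a \<in> J"
    then obtain u w where a: "a = x * u + y * w" by (auto simp: J_def)
    have "b * a = x * (b * u) + y * (b * w)" by (simp add: a algebra_simps)
    then show "b * a \<in> J" unfolding J_def by blast
    assume "b \<in> J"
    then obtain u' w' where b: "b = x * u' + y * w'" by (auto simp: J_def)
    have "a - b = x * (u - u') + y * (w - w')" "a + b = x * (u + u') + y * (w + w')"
      by (simp_all add: a b algebra_simps)
    then show "a - b \<in> J" "a + b \<in> J" unfolding J_def by blast+
  qed
  have "as_univariate v f * as_univariate v c = [:x:] * as_univariate v u + [:y:] * as_univariate v w"
    using arg_cong[OF eq, of "as_univariate v"] as_univariate_const[OF xy(1,3)] as_univariate_const[OF xy(2,3)]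
    by (simp only: as_univariate.eval_hom)
  then have "Polynomial.coeff (as_univariate v f * as_univariate v c) i \<in> J" for i
    by (auto simp: J_def)
  from monic_coeffs_in_ideal[OF J(1-3) lead this]
  have coeffs: "Polynomial.coeff (as_univariate v c) i \<in> J" for i .
  have "(\<Sum>i\<in>S. Polynomial.coeff (as_univariate v c) i * Var v ^ i) \<in> J" for S
    by (induction S rule: infinite_finite_induct)
       (use J coeffs in \<open>auto simp: mult.commute[of _ "Var v ^ _"]\<close>)
  from this[of "{..Polynomial.degree (as_univariate v c)}"]
  have "Polynomial.poly (as_univariate v c) (Var v) \<in> J"
    by (simp only: poly_altdef)
  then show ?thesis by (simp add: J_def)
qed

section \<open>The ideal of relations\<close>

text \<open>
  The polynomials \<open>g1\<close> and \<open>g2\<close> collect the terms of \<open>f1\<close> and \<open>f2\<close> below the leading powers of \<open>Z\<close>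
  and of \<open>X1\<close>.
\<close>

locale double_danielewski =
  fixes k1 k2 :: "'m::finite \<Rightarrow> nat"
    and f1 f2 g1 g2 :: "('m gen, 'k::field_char_0) mpoly"
    and r s :: nat
  assumes k1_pos: "\<And>i. k1 i > 0" and k2_pos: "\<And>i. k2 i > 0"
    and r_pos: "r > 0" and s_pos: "s > 0"
    and f1: "f1 = Var Z ^ r + g1" and g1_vars: "g1 \<in> polys_in ({Z} \<union> range Y)"
    and g1_deg: "\<And>m. m \<in> Poly_Mapping.keys g1 \<Longrightarrow> Poly_Mapping.lookup m Z < r"
    and f2: "f2 = Var X1 ^ s + g2" and g2_vars: "g2 \<in> polys_in ({Z} \<union> range Y \<union> {X1})"
    and g2_deg: "\<And>m. m \<in> Poly_Mapping.keys g2 \<Longrightarrow> Poly_Mapping.lookup m X1 < s"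
begin

abbreviation "R1 \<equiv> rel1 k1 f1"
abbreviation "R2 \<equiv> rel2 k2 f2"

definition I :: "('m gen, 'k) mpoly set" where
  "I = {a * R1 + b * R2 | a b. True}"

lemma I_0: "0 \<in> I"
  unfolding I_def by (auto intro!: exI[of _ 0])

lemma I_add: "p \<in> I \<Longrightarrow> q \<in> I \<Longrightarrow> p + q \<in> I"
proof -
  assume "p \<in> I" "q \<in> I"
  then obtain a b c d where "p = a * R1 + b * R2" "q = c * R1 + d * R2" unfolding I_def by blast
  then have "p + q = (a + c) * R1 + (b + d) * R2" by (simp add: algebra_simps)
  then show ?thesis unfolding I_def by blast
qed

lemma I_mult: "p \<in> I \<Longrightarrow> q * p \<in> I"
proof -
  assume "p \<in> I"
  then obtain a b where "p = a * R1 + b * R2" unfolding I_def by blast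
  then have "q * p = (q * a) * R1 + (q * b) * R2" by (simp add: algebra_simps)
  then show ?thesis unfolding I_def by blast
qed

lemma I_diff: "p \<in> I \<Longrightarrow> q \<in> I \<Longrightarrow> p - q \<in> I"
  using I_add[of p "- 1 * q"] I_mult[of q "- 1"] by simp

lemma R1_in_I: "R1 \<in> I" and R2_in_I: "R2 \<in> I"
proof -
  have "R1 = 1 * R1 + 0 * R2" "R2 = 0 * R1 + 1 * R2" by simp_all
  then show "R1 \<in> I" "R2 \<in> I" unfolding I_def by blast+
qed

lemma f1_vars: "f1 \<in> polys_in ({Z} \<union> range Y)"
  unfolding f1 by (intro polys_in_intros g1_vars) simp

lemma f2_vars: "f2 \<in> polys_in ({Z} \<union> range Y \<union> {X1})"
  unfolding f2 by (intro polys_in_intros g2_vars) simp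

lemma Y_dvd_monomial:
  fixes k :: "'m \<Rightarrow> nat"
  assumes "k i > 0"
  shows "(Var (Y i) :: ('m gen, 'k) mpoly) dvd (\<Prod>j\<in>UNIV. Var (Y j) ^ k j)"
proof -
  have "(Var (Y i) :: ('m gen, 'k) mpoly) dvd Var (Y i) ^ k i" using assms by simp
  also have "\<dots> dvd (\<Prod>j\<in>UNIV. Var (Y j) ^ k j)" by (rule dvd_prodI) simp_all
  finally show ?thesis .
qed

text \<open>
  Modulo \<open>Y i\<close> the generators of \<open>I\<close> become \<open>- f1\<close> and \<open>- f2\<close>. These form a regular sequence, because
  \<open>f1\<close> is monic in \<open>Z\<close>, and because \<open>f2\<close> is monic in \<open>X1\<close> while \<open>f1\<close> does not involve \<open>X1\<close>. A relation
  \<open>Y i * p = a * R1 + b * R2\<close> thus forces the pair \<open>a\<close>, \<open>b\<close> to be a trivial syzygy modulo \<open>Y i\<close>.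
\<close>

lemma Y_cancel_I:
  assumes "Var (Y i) * p \<in> I" shows "p \<in> I"
proof -
  let ?y = "Var (Y i) :: ('m gen, 'k) mpoly"
  obtain u1 u2 where u1: "(\<Prod>j\<in>UNIV. Var (Y j) ^ k1 j) = ?y * u1"
      and u2: "(\<Prod>j\<in>UNIV. Var (Y j) ^ k2 j) = ?y * u2"
    using Y_dvd_monomial[of k1 i, OF k1_pos] Y_dvd_monomial[of k2 i, OF k2_pos] by (auto elim!: dvdE)
  have R1: "R1 = Var X1 * (?y * u1) - f1" and R2: "R2 = Var X2 * (?y * u2) - f2"
    by (simp_all add: rel1_def rel2_def u1 u2)
  obtain a b where ab: "?y * p = a * R1 + b * R2" using assms by (auto simp: I_def)
  have lead1: "Polynomial.lead_coeff (as_univariate Z f1) = 1"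
    using f1 r_pos g1_deg by (rule lead_coeff_as_univariate)
  have lead2: "Polynomial.lead_coeff (as_univariate X1 f2) = 1"
    using f2 s_pos g2_deg by (rule lead_coeff_as_univariate)
  \<comment> \<open>Modulo \<open>Y i\<close> and \<open>f1\<close> the relation says that \<open>f2 * b\<close> vanishes.\<close>
  have "f2 * b = ?y * (Var X1 * u1 * a + Var X2 * u2 * b - p) + f1 * (- a)"
    using ab unfolding R1 R2 by (simp add: algebra_simps)
  moreover have "?y \<in> polys_in ({Z} \<union> range Y)" by (rule polys_in_Var) simp
  ultimately obtain u v where b: "b = ?y * u + f1 * v"
    using monic_nonzerodivisor_mod[OF lead2 _ f1_vars, of ?y b _ "- a"] by blast
  \<comment> \<open>After the trivial syzygy \<open>v * (R1 * R2 - R2 * R1)\<close> has been removed, the coefficient \<open>c\<close> of \<open>R1\<close>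
    is still to be divided by \<open>Y i\<close>.\<close>
  define c where "c = a - v * R2"
  define d where "d = u + Var X1 * u1 * v"
  have f1': "f1 = Var X1 * (?y * u1) - R1" unfolding R1 by simp
  have "a * R1 + b * R2 = a * R1 + (?y * u + (Var X1 * (?y * u1) - R1) * v) * R2"
    unfolding b using f1' by simp
  also have "\<dots> = c * R1 + ?y * (d * R2)"
    by (simp add: c_def d_def algebra_simps)
  finally have yp: "?y * p = c * R1 + ?y * (d * R2)" using ab by simp
  have "f1 * c = c * (Var X1 * (?y * u1) - R1)" using f1' by (simp add: mult.commute)
  also have "\<dots> = Var X1 * ?y * u1 * c - c * R1" by (simp add: algebra_simps)
  also have "\<dots> = ?y * (Var X1 * u1 * c - p + d * R2) + ?y * 0"
    using yp by (simp add: algebra_simps)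
  finally obtain u' w' where "c = ?y * u' + ?y * w'"
    using monic_nonzerodivisor_mod[OF lead1, of ?y "range Y" ?y c _ 0] polys_in_Var[of "Y i" "range Y"] by blast
  then have c: "c = ?y * (u' + w')" by (simp add: algebra_simps)
  have "?y * p = ?y * ((u' + w') * R1 + d * R2)" using yp c by (simp add: algebra_simps)
  then have "p = (u' + w') * R1 + d * R2" by (rule Var_mult_cancel)
  then show ?thesis unfolding I_def by blast
qed

abbreviation "W \<equiv> \<Prod>i\<in>UNIV. (Var (Y i) :: ('m gen, 'k) mpoly)"

lemma W_cancel_I: "W ^ n * p \<in> I \<Longrightarrow> p \<in> I"
proof (induction n)
  case (Suc n)
  have *: "(\<Prod>i\<in>S. Var (Y i)) * q \<in> I \<Longrightarrow> q \<in> I" if "finite S" for S and q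
    using that
  proof (induction S)
    case (insert i S)
    then have "Var (Y i) * ((\<Prod>i\<in>S. Var (Y i)) * q) \<in> I" by (simp add: mult.assoc)
    then show ?case using insert Y_cancel_I by blast
  qed simp
  have "W * (W ^ n * p) \<in> I" using Suc.prems by (simp add: mult.assoc)
  then have "W ^ n * p \<in> I" by (rule *[rotated]) simp
  then show ?case by (rule Suc.IH)
qed simp

lemma W_power_split:
  fixes k :: "'m \<Rightarrow> nat"
  shows "\<exists>n h. h \<in> polys_in (range Y) \<and> W ^ n = h * (\<Prod>i\<in>UNIV. Var (Y i) ^ k i)"
proof -
  define n where "n = (\<Sum>i\<in>UNIV. k i)"
  have le: "k i \<le> n" for i unfolding n_def by (rule member_le_sum) simp_all
  define h :: "('m gen, 'k) mpoly" where "h = (\<Prod>i\<in>UNIV. Var (Y i) ^ (n - k i))"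
  have "h \<in> polys_in (range Y)"
    unfolding h_def by (intro polys_in_intros) simp
  moreover have "W ^ n = h * (\<Prod>i\<in>UNIV. Var (Y i) ^ k i)"
    unfolding h_def prod_power_distrib prod.distrib[symmetric]
    by (intro prod.cong) (simp_all add: power_add[symmetric] le)
  ultimately show ?thesis by blast
qed

text \<open>
  Modulo \<open>I\<close>, a large power of the product of the \<open>Y i\<close> times \<open>X1\<close> is a polynomial in \<open>Z\<close> and the
  \<open>Y i\<close>, and then the same holds for \<open>X2\<close>. The property is stable under sums and products.
\<close>

lemma clear_denominators:
  "\<exists>n g. g \<in> polys_in ({Z} \<union> range Y) \<and> W ^ n * p - g \<in> I"
proof -
  define C where "C p \<longleftrightarrow> (\<exists>n g. g \<in> polys_in ({Z} \<union> range Y) \<and> W ^ n * p - g \<in> I)" for p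
  have C0: "C g" if "g \<in> polys_in ({Z} \<union> range Y)" for g
    unfolding C_def using that I_0 by (intro exI[of _ 0] exI[of _ g]) simp
  have Cadd: "C (p + q)" if pq: "C p" "C q" for p q
  proof -
    obtain n g m h where g: "g \<in> polys_in ({Z} \<union> range Y)" "W ^ n * p - g \<in> I"
       and h: "h \<in> polys_in ({Z} \<union> range Y)" "W ^ m * q - h \<in> I"
      using pq unfolding C_def by blast
    have "W ^ (n + m) * (p + q) - (W ^ m * g + W ^ n * h) = W ^ m * (W ^ n * p - g) + W ^ n * (W ^ m * q - h)"
      by (simp add: algebra_simps power_add)
    then have "W ^ (n + m) * (p + q) - (W ^ m * g + W ^ n * h) \<in> I"
      using g h by (auto intro!: I_add I_mult)
    moreover have "W ^ m * g + W ^ n * h \<in> polys_in ({Z} \<union> range Y)"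
      using g h by (intro polys_in_intros) auto
    ultimately show ?thesis unfolding C_def by blast
  qed
  have Cmult: "C (p * q)" if pq: "C p" "C q" for p q
  proof -
    obtain n g m h where g: "g \<in> polys_in ({Z} \<union> range Y)" "W ^ n * p - g \<in> I"
       and h: "h \<in> polys_in ({Z} \<union> range Y)" "W ^ m * q - h \<in> I"
      using pq unfolding C_def by blast
    have "W ^ (n + m) * (p * q) - g * h = (W ^ m * q) * (W ^ n * p - g) + g * (W ^ m * q - h)"
      by (simp add: algebra_simps power_add)
    then have "W ^ (n + m) * (p * q) - g * h \<in> I"
      using g h by (auto intro!: I_add I_mult)
    moreover have "g * h \<in> polys_in ({Z} \<union> range Y)" using g h by (intro polys_in_mult)
    ultimately show ?thesis unfolding C_def by blast
  qed
  have Cdiv: "C v" if R: "v * (\<Prod>i\<in>UNIV. Var (Y i) ^ k i) - f \<in> I" and f: "C f" for v f and k :: "'m \<Rightarrow> nat"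
  proof -
    obtain n g where g: "g \<in> polys_in ({Z} \<union> range Y)" "W ^ n * f - g \<in> I" using f unfolding C_def by blast
    obtain m h where h: "h \<in> polys_in (range Y)" "W ^ m = h * (\<Prod>i\<in>UNIV. Var (Y i) ^ k i)"
      using W_power_split by blast
    have "W ^ (n + m) * v - h * g = (W ^ n * h) * (v * (\<Prod>i\<in>UNIV. Var (Y i) ^ k i) - f) + h * (W ^ n * f - g)"
      by (simp add: algebra_simps power_add h(2))
    then have "W ^ (n + m) * v - h * g \<in> I" using g R by (auto intro!: I_add I_mult)
    moreover have "h * g \<in> polys_in ({Z} \<union> range Y)"
      using g(1) polys_in_mono[OF h(1), of "{Z} \<union> range Y"] by (intro polys_in_mult) auto
    ultimately show ?thesis unfolding C_def by blast
  qed
  have X1: "C (Var X1)"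
    by (rule Cdiv[of _ k1 f1]) (use R1_in_I C0[OF f1_vars] in \<open>simp_all add: rel1_def\<close>)
  have "C f2" using f2_vars
  proof (induction f2 rule: mpoly_induct)
    case (Var v)
    then show ?case using X1 C0[OF polys_in_Var[of v "{Z} \<union> range Y"]] by auto
  next
    case (Const a)
    show ?case by (rule C0) simp
  qed (simp_all add: Cadd Cmult)
  then have X2: "C (Var X2)"
    by (rule Cdiv[of _ k2 f2, rotated]) (use R2_in_I in \<open>simp add: rel2_def\<close>)
  have "C p" using polys_in_UNIV
  proof (induction p rule: mpoly_induct)
    case (Var v)
    show ?case using X1 X2 C0[OF polys_in_Var[of v "{Z} \<union> range Y"]] by (cases v) auto
  next
    case (Const a)
    show ?case by (rule C0) simp
  qed (simp_all add: Cadd Cmult)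
  then show ?thesis by (simp add: C_def)
qed

end

section \<open>Laurent polynomials with a weight\<close>

text \<open>
  Exponents are integer sequences with finite support in the lexicographic order. Position \<open>0\<close> holds
  the weight, so that weights are compared first and the other positions only break ties.
\<close>

type_synonym 'k laurent = "(nat \<Rightarrow>\<^sub>0 int) \<Rightarrow>\<^sub>0 'k"

lemma lex_less_first:
  fixes u v :: "nat \<Rightarrow>\<^sub>0 int"
  assumes "Poly_Mapping.lookup u 0 < Poly_Mapping.lookup v 0" shows "u < v"
  using assms by transfer (auto simp: less_fun_def)

lemma lex_le_first:
  fixes u v :: "nat \<Rightarrow>\<^sub>0 int"
  assumes "u \<le> v" shows "Poly_Mapping.lookup u 0 \<le> Poly_Mapping.lookup v 0"
  using lex_less_first[of v u] assms by (meson leD leI)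

definition weight_le :: "int \<Rightarrow> 'k::field laurent set" where
  "weight_le w = {x. \<forall>u\<in>Poly_Mapping.keys x. Poly_Mapping.lookup u 0 \<le> w}"

lemma weight_le_0: "0 \<in> weight_le w"
  by (simp add: weight_le_def)

lemma weight_le_add: "x \<in> weight_le w \<Longrightarrow> y \<in> weight_le w \<Longrightarrow> x + y \<in> weight_le w"
  using Poly_Mapping.keys_add[of x y] by (auto simp: weight_le_def)

lemma weight_le_sum: "(\<And>i. i \<in> S \<Longrightarrow> x i \<in> weight_le w) \<Longrightarrow> sum x S \<in> weight_le w"
  by (induction S rule: infinite_finite_induct) (auto simp: weight_le_0 weight_le_add)

lemma weight_le_mult:
  assumes "x \<in> weight_le v" "y \<in> weight_le w" shows "x * y \<in> weight_le (v + w)"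
  unfolding weight_le_def
proof safe
  fix u assume "u \<in> Poly_Mapping.keys (x * y)"
  then obtain a b where "a \<in> Poly_Mapping.keys x" "b \<in> Poly_Mapping.keys y" "u = a + b"
    using Poly_Mapping.keys_mult[of x y] by blast
  then show "Poly_Mapping.lookup u 0 \<le> v + w"
    using assms by (auto simp: weight_le_def lookup_add intro!: add_mono)
qed

lemma weight_le_mono: "x \<in> weight_le v \<Longrightarrow> v \<le> w \<Longrightarrow> x \<in> weight_le w"
  by (force simp: weight_le_def)

lemma weight_le_single: "Poly_Mapping.lookup u 0 \<le> w \<Longrightarrow> Poly_Mapping.single u c \<in> weight_le w"
  by (simp add: weight_le_def)

lemma lookup_above_weight_le: "x \<in> weight_le w \<Longrightarrow> Poly_Mapping.lookup u 0 > w \<Longrightarrow> Poly_Mapping.lookup x u = 0"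
  by (force simp: weight_le_def in_keys_iff)

abbreviation \<chi> :: "(nat \<Rightarrow>\<^sub>0 int) \<Rightarrow> 'k::field laurent" where
  "\<chi> u \<equiv> Poly_Mapping.single u 1"

text \<open>
  The terms of \<open>x\<close> other than \<open>\<chi> u\<close> must have strictly smaller weight; a smaller exponent of the
  same weight is not allowed.
\<close>

definition leads :: "'k::field laurent \<Rightarrow> (nat \<Rightarrow>\<^sub>0 int) \<Rightarrow> bool" where
  "leads x u \<longleftrightarrow> x - \<chi> u \<in> weight_le (Poly_Mapping.lookup u 0 - 1)"

lemma leads_chi: "leads (\<chi> u) u"
  by (simp add: leads_def weight_le_0)

lemma leads_weight_le: "leads x u \<Longrightarrow> x \<in> weight_le (Poly_Mapping.lookup u 0)"
proof -
  assume "leads x u"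
  then have "(x - \<chi> u) + \<chi> u \<in> weight_le (Poly_Mapping.lookup u 0)"
    unfolding leads_def by (intro weight_le_add weight_le_single) (auto elim: weight_le_mono)
  then show ?thesis by simp
qed

lemma leads_mult:
  assumes "leads x u" "leads y v" shows "leads (x * y) (u + v)"
proof -
  have "(x - \<chi> u) * y \<in> weight_le ((Poly_Mapping.lookup u 0 - 1) + Poly_Mapping.lookup v 0)"
    using assms leads_weight_le by (intro weight_le_mult) (auto simp: leads_def)
  moreover have "\<chi> u * (y - \<chi> v) \<in> weight_le (Poly_Mapping.lookup u 0 + (Poly_Mapping.lookup v 0 - 1))"
    using assms by (intro weight_le_mult weight_le_single) (auto simp: leads_def)
  ultimately have "(x - \<chi> u) * y + \<chi> u * (y - \<chi> v) \<in> weight_le (Poly_Mapping.lookup (u + v) 0 - 1)"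
    by (intro weight_le_add) (auto simp: lookup_add algebra_simps)
  also have "(x - \<chi> u) * y + \<chi> u * (y - \<chi> v) = x * y - \<chi> (u + v)"
    by (simp add: algebra_simps mult_single)
  finally show ?thesis by (simp add: leads_def)
qed

lemma leads_add: "leads x u \<Longrightarrow> y \<in> weight_le (Poly_Mapping.lookup u 0 - 1) \<Longrightarrow> leads (x + y) u"
  unfolding leads_def by (metis add_diff_eq add.commute weight_le_add)

lemma lookup_sum_chi:
  assumes "finite K" "inj_on w K" "n \<in> K"
  shows "Poly_Mapping.lookup (\<Sum>m\<in>K. Poly_Mapping.single (w m) (c m)) (w n) = c n"
proof -
  have "Poly_Mapping.lookup (\<Sum>m\<in>K. Poly_Mapping.single (w m) (c m)) (w n) = (\<Sum>m\<in>K. if m = n then c m else 0)"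
    unfolding lookup_sum using assms by (intro sum.cong) (auto simp: lookup_single when_def inj_on_eq_iff)
  then show ?thesis using assms by simp
qed

text \<open>Position \<open>0\<close> is reserved for the weight.\<close>

definition coord :: "'m::finite \<Rightarrow> nat" where "coord i = Suc (to_nat i)"

lemma coord_eq [simp]: "coord i = coord j \<longleftrightarrow> i = j" and coord_pos [simp]: "coord i \<noteq> 0" "0 \<noteq> coord i"
  by (simp_all add: coord_def)

text \<open>
  The index \<open>j\<close> selects the variable of negative weight. The maps to Laurent polynomials for
  different \<open>j\<close> differ by a linear change of the exponents.
\<close>

locale weighted_danielewski = double_danielewski k1 k2 f1 f2 g1 g2 r s
  for k1 k2 :: "'m::finite \<Rightarrow> nat" and f1 f2 g1 g2 :: "('m gen, 'k::field_char_0) mpoly" and r s :: nat +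
  fixes j :: 'm
begin

text \<open>
  The weight of \<open>Y j\<close> is \<open>- M\<close>. As \<open>M\<close> exceeds the degree in \<open>Z\<close> of \<open>g2\<close>, the power \<open>X1 ^ s\<close> outweighs
  all other terms of \<open>f2\<close>, although these may contain higher powers of \<open>Z\<close>.
\<close>

definition M :: int where "M = int (degree_in Z g2) + 1"

lemma M_pos: "M \<ge> 1" by (simp add: M_def)

lemma g2_Z_less_M: "m \<in> Poly_Mapping.keys g2 \<Longrightarrow> int (Poly_Mapping.lookup m Z) < M"
  unfolding M_def degree_in_def
  by (simp add: zless_add1_eq)

text \<open>
  The exponent of \<open>Y^a * Z^b\<close>. Position \<open>0\<close> holds its weight \<open>b - M * a j\<close> instead of \<open>b\<close>; the latter
  is recovered by \<open>ZC\<close>.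
\<close>

definition vec :: "('m \<Rightarrow> int) \<Rightarrow> int \<Rightarrow> (nat \<Rightarrow>\<^sub>0 int)" where
  "vec a b = Poly_Mapping.single 0 (b - M * a j) + (\<Sum>i\<in>UNIV. Poly_Mapping.single (coord i) (a i))"

definition YC :: "'m \<Rightarrow> (nat \<Rightarrow>\<^sub>0 int) \<Rightarrow> int" where "YC i u = Poly_Mapping.lookup u (coord i)"
definition ZC :: "(nat \<Rightarrow>\<^sub>0 int) \<Rightarrow> int" where "ZC u = Poly_Mapping.lookup u 0 + M * YC j u"

lemma lookup_vec_0 [simp]: "Poly_Mapping.lookup (vec a b) 0 = b - M * a j"
  by (simp add: vec_def lookup_add lookup_sum lookup_single when_def)

lemma YC_vec [simp]: "YC i (vec a b) = a i"
  by (simp add: YC_def vec_def lookup_add lookup_sum lookup_single when_def)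

lemma ZC_vec [simp]: "ZC (vec a b) = b"
  by (simp add: ZC_def)

lemma YC_add [simp]: "YC i (u + v) = YC i u + YC i v"
  and ZC_add [simp]: "ZC (u + v) = ZC u + ZC v"
  by (simp_all add: YC_def ZC_def lookup_add algebra_simps)

lemma vec_add: "vec a b + vec a' b' = vec (\<lambda>i. a i + a' i) (b + b')"
proof -
  have "Poly_Mapping.single (0::nat) (b + b' - M * (a j + a' j)) =
      Poly_Mapping.single 0 (b - M * a j) + Poly_Mapping.single 0 (b' - M * a' j)"
    by (simp add: single_add[symmetric] algebra_simps)
  then show ?thesis
    by (simp add: vec_def single_add sum.distrib add.assoc add.left_commute)
qed

lemma vec_0: "vec (\<lambda>_. 0) 0 = 0"
  by (simp add: vec_def)

text \<open>
  The exponents of \<open>Y i\<close> and of \<open>Z\<close> in the monomial obtained from \<open>m\<close> by the substitutions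
  \<open>X1 \<mapsto> Z^r / Y^k1\<close> and \<open>X2 \<mapsto> Z^(r s) / (Y^(s k1) * Y^k2)\<close>. These monomials will turn out to be
  the leading parts of the images of \<open>X1\<close> and \<open>X2\<close>.
\<close>

definition ycoord :: "'m \<Rightarrow> ('m gen \<Rightarrow>\<^sub>0 nat) \<Rightarrow> int" where
  "ycoord i m = int (Poly_Mapping.lookup m (Y i)) - int (k1 i) * int (Poly_Mapping.lookup m X1)
     - (int s * int (k1 i) + int (k2 i)) * int (Poly_Mapping.lookup m X2)"

definition zcoord :: "('m gen \<Rightarrow>\<^sub>0 nat) \<Rightarrow> int" where
  "zcoord m = int (Poly_Mapping.lookup m Z) + int r * int (Poly_Mapping.lookup m X1)
     + int r * int s * int (Poly_Mapping.lookup m X2)"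

definition expo :: "('m gen \<Rightarrow>\<^sub>0 nat) \<Rightarrow> (nat \<Rightarrow>\<^sub>0 int)" where
  "expo m = vec (\<lambda>i. ycoord i m) (zcoord m)"

abbreviation weight :: "('m gen \<Rightarrow>\<^sub>0 nat) \<Rightarrow> int" where "weight m \<equiv> Poly_Mapping.lookup (expo m) 0"

lemma YC_expo [simp]: "YC i (expo m) = ycoord i m" and ZC_expo [simp]: "ZC (expo m) = zcoord m"
  by (simp_all add: expo_def)

lemma weight_eq: "weight m = zcoord m - M * ycoord j m"
  by (simp add: expo_def)

lemma ycoord_add: "ycoord i (m + n) = ycoord i m + ycoord i n"
  and zcoord_add: "zcoord (m + n) = zcoord m + zcoord n"
  by (simp_all add: ycoord_def zcoord_def lookup_add algebra_simps)

lemma expo_add: "expo (m + n) = expo m + expo n"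
  by (simp add: expo_def vec_add ycoord_add zcoord_add)

lemma expo_0: "expo 0 = 0"
  by (simp add: expo_def ycoord_def zcoord_def vec_0)

lemma expo_inject: "expo m = expo n \<longleftrightarrow> (\<forall>i. ycoord i m = ycoord i n) \<and> zcoord m = zcoord n"
proof
  assume "expo m = expo n"
  then have "YC i (expo m) = YC i (expo n)" "ZC (expo m) = ZC (expo n)" for i by simp_all
  then show "(\<forall>i. ycoord i m = ycoord i n) \<and> zcoord m = zcoord n" by simp
qed (simp add: expo_def)

lemma gen_eqI:
  assumes "Poly_Mapping.lookup m Z = Poly_Mapping.lookup n Z" "\<And>i. Poly_Mapping.lookup m (Y i) = Poly_Mapping.lookup n (Y i)"
    "Poly_Mapping.lookup m X1 = Poly_Mapping.lookup n X1" "Poly_Mapping.lookup m X2 = Poly_Mapping.lookup n X2"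
  shows "m = (n :: 'm gen \<Rightarrow>\<^sub>0 nat)"
proof (rule poly_mapping_eqI)
  fix v show "Poly_Mapping.lookup m v = Poly_Mapping.lookup n v" using assms by (cases v) auto
qed

text \<open>
  Normal forms for monomials with respect to the rules \<open>Z^r \<mapsto> X1 * Y^k1\<close> and
  \<open>X1^s \<mapsto> X2 * Y^k2\<close>, which preserve \<open>expo\<close>.
\<close>

definition normal :: "('m gen \<Rightarrow>\<^sub>0 nat) set" where
  "normal = {m. Poly_Mapping.lookup m Z < r \<and> Poly_Mapping.lookup m X1 < s}"

text \<open>
  The exponent of \<open>Z\<close> is \<open>a + r * (b + s * c)\<close> where \<open>a\<close>, \<open>b\<close> and \<open>c\<close> are the exponents of \<open>Z\<close>, \<open>X1\<close>
  and \<open>X2\<close> in the normal monomial; as \<open>a < r\<close> and \<open>b < s\<close>, it determines all three.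
\<close>

lemma inj_on_expo_normal: "inj_on expo normal"
proof (rule inj_onI)
  fix m n assume m: "m \<in> normal" and n: "n \<in> normal" and "expo m = expo n"
  then have y: "\<And>i. ycoord i m = ycoord i n" and z: "zcoord m = zcoord n" by (auto simp: expo_inject)
  let ?q = "\<lambda>m. Poly_Mapping.lookup m X1 + s * Poly_Mapping.lookup m X2"
  have "int (Poly_Mapping.lookup m Z + r * ?q m) = int (Poly_Mapping.lookup n Z + r * ?q n)"
    using z by (simp add: zcoord_def algebra_simps)
  then have e: "Poly_Mapping.lookup m Z + r * ?q m = Poly_Mapping.lookup n Z + r * ?q n"
    by (simp only: of_nat_eq_iff)
  have Z: "Poly_Mapping.lookup m Z = Poly_Mapping.lookup n Z"
    using arg_cong[OF e, of "\<lambda>t. t mod r"] m n by (simp add: normal_def)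
  with e r_pos have q: "?q m = ?q n" by simp
  have X1: "Poly_Mapping.lookup m X1 = Poly_Mapping.lookup n X1"
    using arg_cong[OF q, of "\<lambda>t. t mod s"] m n by (simp add: normal_def)
  with q s_pos have X2: "Poly_Mapping.lookup m X2 = Poly_Mapping.lookup n X2" by simp
  show "m = n"
  proof (rule gen_eqI[OF Z _ X1 X2])
    fix i show "Poly_Mapping.lookup m (Y i) = Poly_Mapping.lookup n (Y i)"
      using y[of i] X1 X2 by (simp add: ycoord_def)
  qed
qed

lemma inj_on_expo_ZY: "inj_on expo {m. Poly_Mapping.keys m \<subseteq> {Z} \<union> range Y}"
proof (rule inj_onI)
  fix m n assume m: "m \<in> {m. Poly_Mapping.keys m \<subseteq> {Z} \<union> range Y}" and n: "n \<in> {m. Poly_Mapping.keys m \<subseteq> {Z} \<union> range Y}"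
    and "expo m = expo n"
  then have y: "\<And>i. ycoord i m = ycoord i n" and z: "zcoord m = zcoord n" by (auto simp: expo_inject)
  have "X1 \<notin> Poly_Mapping.keys m" "X2 \<notin> Poly_Mapping.keys m" "X1 \<notin> Poly_Mapping.keys n" "X2 \<notin> Poly_Mapping.keys n"
    using m n by auto
  then have "Poly_Mapping.lookup m X1 = 0" "Poly_Mapping.lookup m X2 = 0" "Poly_Mapping.lookup n X1 = 0" "Poly_Mapping.lookup n X2 = 0"
    by (auto simp: in_keys_iff)
  then show "m = n" using y z by (intro gen_eqI) (auto simp: ycoord_def zcoord_def)
qed

definition ymon :: "('m \<Rightarrow> nat) \<Rightarrow> ('m gen \<Rightarrow>\<^sub>0 nat)" where
  "ymon k = (\<Sum>i\<in>UNIV. Poly_Mapping.single (Y i) (k i))"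

lemma lookup_ymon [simp]: "Poly_Mapping.lookup (ymon k) (Y i) = k i" "Poly_Mapping.lookup (ymon k) Z = 0"
  "Poly_Mapping.lookup (ymon k) X1 = 0" "Poly_Mapping.lookup (ymon k) X2 = 0"
  by (simp_all add: ymon_def lookup_sum lookup_single when_def)

section \<open>The embedding into Laurent polynomials\<close>

text \<open>
  The value \<open>0\<close> at \<open>X1\<close> and \<open>X2\<close> is a placeholder: \<open>f1\<close> contains neither variable, and \<open>f2\<close> is
  evaluated only after \<open>X1\<close> has received its value.
\<close>

definition base :: "'m gen \<Rightarrow> 'k laurent" where
  "base v = (case v of Z \<Rightarrow> \<chi> (vec (\<lambda>_. 0) 1) | Y i \<Rightarrow> \<chi> (vec (\<lambda>k. if k = i then 1 else 0) 0) | _ \<Rightarrow> 0)"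

lemma scalar_evaluation: "evaluation (\<lambda>a. Poly_Mapping.single (0::nat \<Rightarrow>\<^sub>0 int) (a::'k))"
  by unfold_locales (simp_all add: single_add mult_single)

definition x1 :: "'k laurent" where
  "x1 = \<chi> (vec (\<lambda>i. - int (k1 i)) 0) * evaluation.eval (Poly_Mapping.single 0) base f1"

definition x2 :: "'k laurent" where
  "x2 = \<chi> (vec (\<lambda>i. - int (k2 i)) 0) * evaluation.eval (Poly_Mapping.single 0) (base(X1 := x1)) f2"

definition img :: "'m gen \<Rightarrow> 'k laurent" where
  "img = base(X1 := x1, X2 := x2)"

sublocale phi: evaluation "Poly_Mapping.single (0::nat \<Rightarrow>\<^sub>0 int) :: 'k \<Rightarrow> _" img
  by (rule scalar_evaluation)

abbreviation \<phi> :: "('m gen, 'k) mpoly \<Rightarrow> 'k laurent" where "\<phi> \<equiv> phi.eval"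
abbreviation mv :: "('m gen \<Rightarrow>\<^sub>0 nat) \<Rightarrow> 'k laurent" where "mv \<equiv> monomial_value img"

lemma img_simps: "img Z = \<chi> (vec (\<lambda>_. 0) 1)" "img (Y i) = \<chi> (vec (\<lambda>k. if k = i then 1 else 0) 0)"
    "img X1 = x1" "img X2 = x2"
  by (simp_all add: img_def base_def)

lemma img_ZY:
  assumes "v \<in> {Z} \<union> range Y" shows "img v = \<chi> (expo (Poly_Mapping.single v 1))"
proof (cases v)
  case (Y i)
  have "ycoord k (Poly_Mapping.single v 1) = (if k = i then 1 else 0)" for k
    by (simp add: Y ycoord_def lookup_single when_def)
  moreover have "zcoord (Poly_Mapping.single v 1) = 0" by (simp add: Y zcoord_def lookup_single)
  ultimately show ?thesis by (simp add: Y img_simps expo_def)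
qed (use assms in \<open>auto simp: img_simps expo_def ycoord_def zcoord_def lookup_single\<close>)

lemma mv_ZY: "Poly_Mapping.keys m \<subseteq> {Z} \<union> range Y \<Longrightarrow> mv m = \<chi> (expo m)"
proof (induction m rule: monomial_induct)
  case (step m v)
  have "Poly_Mapping.keys m \<subseteq> {Z} \<union> range Y" "v \<in> {Z} \<union> range Y"
    using step(2) by (auto simp: in_keys_iff lookup_add lookup_single subset_iff)
  then have "mv m = \<chi> (expo m)" "img v = \<chi> (expo (Poly_Mapping.single v 1))" using step.IH img_ZY by auto
  then show ?case by (simp add: monomial_value_add expo_add mult_single)
qed (simp add: expo_0)

lemma mv_leads:
  assumes "\<And>v. v \<in> V \<Longrightarrow> leads (img v) (expo (Poly_Mapping.single v 1))" "Poly_Mapping.keys m \<subseteq> V"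
  shows "leads (mv m) (expo m)"
  using assms(2)
proof (induction m rule: monomial_induct)
  case zero
  show ?case using leads_chi[of 0] by (simp add: expo_0)
next
  case (step m v)
  have "Poly_Mapping.keys m \<subseteq> V" "v \<in> V"
    using step(2) by (auto simp: in_keys_iff lookup_add lookup_single subset_iff)
  then have "leads (mv m) (expo m)" "leads (img v) (expo (Poly_Mapping.single v 1))" using step.IH assms(1) by auto
  then show ?case by (simp add: monomial_value_add expo_add leads_mult)
qed

lemma mv_ymon: "mv (ymon k) = \<chi> (vec (\<lambda>i. int (k i)) 0)"
proof -
  have "Poly_Mapping.keys (ymon k) \<subseteq> {Z} \<union> range Y"
  proof
    fix v assume "v \<in> Poly_Mapping.keys (ymon k)"
    then show "v \<in> {Z} \<union> range Y" by (cases v) (auto simp: in_keys_iff)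
  qed
  then show ?thesis by (simp add: mv_ZY expo_def ycoord_def zcoord_def)
qed

lemma phi_prod_Y: "\<phi> (\<Prod>i\<in>UNIV. Var (Y i) ^ k i) = \<chi> (vec (\<lambda>i. int (k i)) 0)"
proof -
  have "mv (\<Sum>i\<in>S. Poly_Mapping.single (Y i) (k i)) = (\<Prod>i\<in>S. img (Y i) ^ k i)" for S
    by (induction S rule: infinite_finite_induct) (simp_all add: monomial_value_add)
  from this[of UNIV] show ?thesis by (simp add: phi.eval_hom flip: mv_ymon ymon_def)
qed

lemma vec_cancel: "\<chi> (vec a b) * \<chi> (vec (\<lambda>i. - a i) (- b)) = (1 :: 'k laurent)"
  by (simp add: mult_single vec_add vec_0)

lemma phi_f1: "\<phi> f1 = \<chi> (vec (\<lambda>i. int (k1 i)) 0) * x1"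
proof -
  have "evaluation.eval (Poly_Mapping.single 0) base f1 = \<phi> f1"
    by (rule eval_cong[OF scalar_evaluation f1_vars]) (auto simp: img_def)
  then show ?thesis unfolding x1_def
    using vec_cancel[of "\<lambda>i. int (k1 i)" 0] by (simp flip: mult.assoc)
qed

lemma phi_f2: "\<phi> f2 = \<chi> (vec (\<lambda>i. int (k2 i)) 0) * x2"
proof -
  have "evaluation.eval (Poly_Mapping.single 0) (base(X1 := x1)) f2 = \<phi> f2"
    by (rule eval_cong[OF scalar_evaluation f2_vars]) (auto simp: img_def)
  then show ?thesis unfolding x2_def
    using vec_cancel[of "\<lambda>i. int (k2 i)" 0] by (simp flip: mult.assoc)
qed

lemma phi_R1: "\<phi> R1 = 0" and phi_R2: "\<phi> R2 = 0"
  by (simp_all add: rel1_def rel2_def phi.eval_diff phi.eval_mult phi_prod_Y phi_f1 phi_f2 img_simps mult.commute)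

lemma phi_inj_ZY:
  assumes "g \<in> polys_in ({Z} \<union> range Y)" "\<phi> g = 0" shows "g = 0"
proof -
  have "\<phi> g = (\<Sum>m\<in>Poly_Mapping.keys g. Poly_Mapping.single (expo m) (Poly_Mapping.lookup g m))"
    unfolding phi.eval_def using assms(1)
    by (intro sum.cong) (auto simp: polys_in_def mv_ZY mult_single)
  moreover have "inj_on expo (Poly_Mapping.keys g)"
    by (rule inj_on_subset[OF inj_on_expo_ZY]) (use assms(1) in \<open>auto simp: polys_in_def\<close>)
  ultimately have "Poly_Mapping.lookup g m = 0" if "m \<in> Poly_Mapping.keys g" for m
    using that assms(2) lookup_sum_chi[of "Poly_Mapping.keys g" expo m "Poly_Mapping.lookup g"] by simp
  then show ?thesis using in_keys_iff by (metis poly_mapping_eqI lookup_zero)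
qed

abbreviation "S \<equiv> range \<phi>"

lemma S_add: "x \<in> S \<Longrightarrow> y \<in> S \<Longrightarrow> x + y \<in> S"
  and S_mult: "x \<in> S \<Longrightarrow> y \<in> S \<Longrightarrow> x * y \<in> S"
  and S_diff: "x \<in> S \<Longrightarrow> y \<in> S \<Longrightarrow> x - y \<in> S"
  by (auto simp flip: phi.eval_add phi.eval_mult phi.eval_diff)

lemma S_0: "0 \<in> S" and S_1: "1 \<in> S" and S_scalar: "Poly_Mapping.single 0 c \<in> S" and S_img: "img v \<in> S"
  using rangeI[of \<phi> 0] rangeI[of \<phi> 1] rangeI[of \<phi> "Const c"] rangeI[of \<phi> "Var v"] by simp_all

lemma S_mv: "mv m \<in> S"
  using rangeI[of \<phi> "Poly_Mapping.single m 1"] by simp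

lemma phi_I: "p \<in> I \<Longrightarrow> \<phi> p = 0"
  by (auto simp: I_def phi.eval_hom phi_R1 phi_R2)

text \<open>
  If \<open>\<phi> p = 0\<close>, clear denominators: a power of the product of the \<open>Y i\<close> times \<open>p\<close> is congruent to a
  polynomial \<open>g\<close> in \<open>Z\<close> and the \<open>Y i\<close> alone. On such polynomials \<open>\<phi>\<close> is injective, so \<open>g = 0\<close>, and the
  power can be cancelled modulo \<open>I\<close>.
\<close>

lemma kernel_phi: "\<phi> p = 0 \<longleftrightarrow> p \<in> I"
proof (rule iffI)
  assume p: "\<phi> p = 0"
  obtain n g where g: "g \<in> polys_in ({Z} \<union> range Y)" and I: "W ^ n * p - g \<in> I"
    using clear_denominators by blast
  have "\<phi> g = \<phi> W ^ n * \<phi> p - \<phi> (W ^ n * p - g)" by (simp only: phi.eval_diff phi.eval_mult phi.eval_power) simp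
  then have "\<phi> g = 0" using p phi_I[OF I] by simp
  then have "g = 0" using phi_inj_ZY g by blast
  then show "p \<in> I" using I W_cancel_I by simp
qed (rule phi_I)

section \<open>Leading exponents of the image\<close>

lemma weight_expand:
  "weight m = int (Poly_Mapping.lookup m Z) - M * int (Poly_Mapping.lookup m (Y j))
     + (int r + M * int (k1 j)) * int (Poly_Mapping.lookup m X1)
     + (int s * (int r + M * int (k1 j)) + M * int (k2 j)) * int (Poly_Mapping.lookup m X2)"
  by (simp add: weight_eq zcoord_def ycoord_def algebra_simps)

lemma phi_weight_le:
  assumes "\<And>v. v \<in> V \<Longrightarrow> leads (img v) (expo (Poly_Mapping.single v 1))" "p \<in> polys_in V"
    "\<And>m. m \<in> Poly_Mapping.keys p \<Longrightarrow> weight m \<le> w"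
  shows "\<phi> p \<in> weight_le w"
  unfolding phi.eval_def
proof (rule weight_le_sum)
  fix m assume m: "m \<in> Poly_Mapping.keys p"
  then have "leads (mv m) (expo m)" using assms(1,2) by (intro mv_leads[of V]) (auto simp: polys_in_def)
  then have "mv m \<in> weight_le w" using leads_weight_le weight_le_mono assms(3)[OF m] by blast
  then show "Poly_Mapping.single 0 (Poly_Mapping.lookup p m) * mv m \<in> weight_le w"
    using weight_le_mult[OF weight_le_single[of 0 0]] by fastforce
qed

lemma leads_ZY: "v \<in> {Z} \<union> range Y \<Longrightarrow> leads (img v) (expo (Poly_Mapping.single v 1))"
  by (simp only: img_ZY leads_chi)

lemma expo_Z_power: "expo (Poly_Mapping.single Z n) = vec (\<lambda>_. 0) (int n)"
  by (simp add: expo_def ycoord_def zcoord_def lookup_single)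

lemma img_Z_power: "img Z ^ n = \<chi> (expo (Poly_Mapping.single Z n))"
proof -
  have "mv (Poly_Mapping.single Z n) = \<chi> (expo (Poly_Mapping.single Z n))"
    by (rule mv_ZY) auto
  then show ?thesis by simp
qed

lemma phi_f1_split: "\<phi> f1 = img Z ^ r + \<phi> g1"
  using arg_cong[OF f1, of \<phi>] by (simp only: phi.eval_add phi.eval_power phi.eval_Var)

lemma phi_f2_split: "\<phi> f2 = img X1 ^ s + \<phi> g2"
  using arg_cong[OF f2, of \<phi>] by (simp only: phi.eval_add phi.eval_power phi.eval_Var)

lemma weight_g1: assumes m: "m \<in> Poly_Mapping.keys g1" shows "weight m \<le> weight (Poly_Mapping.single Z r) - 1"
proof -
  have "Poly_Mapping.keys m \<subseteq> {Z} \<union> range Y" using m g1_vars by (auto simp: polys_in_def)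
  then have "X1 \<notin> Poly_Mapping.keys m" "X2 \<notin> Poly_Mapping.keys m" by auto
  then have "weight m = int (Poly_Mapping.lookup m Z) - M * int (Poly_Mapping.lookup m (Y j))"
    by (simp add: weight_expand in_keys_iff)
  moreover have "0 \<le> M * int (Poly_Mapping.lookup m (Y j))" using M_pos by simp
  moreover have "weight (Poly_Mapping.single Z r) = int r" by (simp add: expo_Z_power)
  ultimately show ?thesis using g1_deg[OF m] by linarith
qed

lemma leads_f1: "leads (\<phi> f1) (expo (Poly_Mapping.single Z r))"
proof -
  have "\<phi> g1 \<in> weight_le (weight (Poly_Mapping.single Z r) - 1)"
    by (rule phi_weight_le[OF _ g1_vars weight_g1]) (rule leads_ZY)
  then have "leads (img Z ^ r + \<phi> g1) (expo (Poly_Mapping.single Z r))"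
    by (intro leads_add) (simp_all only: img_Z_power leads_chi)
  then show ?thesis by (simp only: phi_f1_split)
qed

lemma x1_eq: "x1 = \<chi> (vec (\<lambda>i. - int (k1 i)) 0) * \<phi> f1"
  and x2_eq: "x2 = \<chi> (vec (\<lambda>i. - int (k2 i)) 0) * \<phi> f2"
proof -
  have "\<chi> (vec (\<lambda>i. - a i) 0) * (\<chi> (vec a 0) * t) = (t :: 'k laurent)" for a t
    using vec_cancel[of a 0] by (simp add: mult.commute[of "\<chi> (vec (\<lambda>i. - a i) 0)" "\<chi> (vec a 0)"] flip: mult.assoc)
  then show "x1 = \<chi> (vec (\<lambda>i. - int (k1 i)) 0) * \<phi> f1" "x2 = \<chi> (vec (\<lambda>i. - int (k2 i)) 0) * \<phi> f2"
    by (simp_all only: phi_f1 phi_f2)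
qed

lemma leads_x1: "leads (img X1) (expo (Poly_Mapping.single X1 1))"
proof -
  have "leads (img X1) (vec (\<lambda>i. - int (k1 i)) 0 + expo (Poly_Mapping.single Z r))"
    unfolding img_simps x1_eq by (rule leads_mult[OF leads_chi leads_f1])
  moreover have "vec (\<lambda>i. - int (k1 i)) 0 + expo (Poly_Mapping.single Z r) = expo (Poly_Mapping.single X1 1)"
    by (simp add: expo_def vec_add ycoord_def zcoord_def lookup_single)
  ultimately show ?thesis by simp
qed

lemma leads_ZYX1: "v \<in> {Z} \<union> range Y \<union> {X1} \<Longrightarrow> leads (img v) (expo (Poly_Mapping.single v 1))"
  using leads_ZY[of v] leads_x1 by blast

text \<open>
  Compared with \<open>X1 ^ s\<close>, a monomial of \<open>g2\<close> lacks at least one factor \<open>X1\<close>, which costs the weight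
  \<open>r + M * k1 j\<close>. Its power of \<open>Z\<close> gains less than \<open>M\<close>.
\<close>

lemma weight_g2: assumes m: "m \<in> Poly_Mapping.keys g2" shows "weight m \<le> weight (Poly_Mapping.single X1 s) - 1"
proof -
  define c where "c = int r + M * int (k1 j)"
  have "M * 1 \<le> M * int (k1 j)" using M_pos k1_pos[of j] by (intro mult_left_mono) auto
  then have c: "M + 1 \<le> c" using r_pos by (simp add: c_def)
  have "Poly_Mapping.keys m \<subseteq> {Z} \<union> range Y \<union> {X1}" using m g2_vars by (auto simp: polys_in_def)
  then have "X2 \<notin> Poly_Mapping.keys m" by auto
  then have "weight m = int (Poly_Mapping.lookup m Z) - M * int (Poly_Mapping.lookup m (Y j)) + c * int (Poly_Mapping.lookup m X1)"
    by (simp add: weight_expand in_keys_iff c_def)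
  moreover have "0 \<le> M * int (Poly_Mapping.lookup m (Y j))" using M_pos by simp
  moreover have "c * int (Poly_Mapping.lookup m X1) \<le> c * (int s - 1)"
    using g2_deg[OF m] c M_pos by (intro mult_left_mono) auto
  moreover have "weight (Poly_Mapping.single X1 s) = c * int s"
    by (simp add: weight_expand lookup_single c_def)
  moreover have "c * (int s - 1) = c * int s - c" by (simp add: algebra_simps)
  ultimately show ?thesis using g2_Z_less_M[OF m] c by linarith
qed

lemma leads_f2: "leads (\<phi> f2) (expo (Poly_Mapping.single X1 s))"
proof -
  have "\<phi> g2 \<in> weight_le (weight (Poly_Mapping.single X1 s) - 1)"
    by (rule phi_weight_le[OF _ g2_vars weight_g2]) (rule leads_ZYX1)
  moreover have "leads (mv (Poly_Mapping.single X1 s)) (expo (Poly_Mapping.single X1 s))"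
    by (rule mv_leads[of "{Z} \<union> range Y \<union> {X1}"]) (erule leads_ZYX1, auto)
  ultimately have "leads (img X1 ^ s + \<phi> g2) (expo (Poly_Mapping.single X1 s))"
    by (intro leads_add) simp_all
  then show ?thesis by (simp only: phi_f2_split)
qed

lemma leads_x2: "leads (img X2) (expo (Poly_Mapping.single X2 1))"
proof -
  have "leads (img X2) (vec (\<lambda>i. - int (k2 i)) 0 + expo (Poly_Mapping.single X1 s))"
    unfolding img_simps x2_eq by (rule leads_mult[OF leads_chi leads_f2])
  moreover have "vec (\<lambda>i. - int (k2 i)) 0 + expo (Poly_Mapping.single X1 s) = expo (Poly_Mapping.single X2 1)"
    by (simp add: expo_def vec_add ycoord_def zcoord_def lookup_single algebra_simps)
  ultimately show ?thesis by simp
qed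

lemma leads_img: "leads (img v) (expo (Poly_Mapping.single v 1))"
  using leads_ZYX1[of v] leads_x2 by (cases v) auto

lemma leads_mv: "leads (mv m) (expo m)"
  by (rule mv_leads[of UNIV]) (rule leads_img, simp)

text \<open>
  The weight bounds the monomials of a representing polynomial. A priori this is stronger than a
  bound on the terms of the Laurent polynomial itself, where high weights may have cancelled.
\<close>

definition F :: "int \<Rightarrow> 'k laurent set" where
  "F w = {\<phi> p | p. \<forall>m\<in>Poly_Mapping.keys p. weight m \<le> w}"

lemma F_weight_le: "x \<in> F w \<Longrightarrow> x \<in> weight_le w"
  unfolding F_def using phi_weight_le[of UNIV, OF leads_img] by auto

lemma F_0: "0 \<in> F w"
  unfolding F_def by (auto intro!: exI[of _ 0])

lemma F_add: assumes "x \<in> F w" "y \<in> F w" shows "x + y \<in> F w"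
proof -
  obtain p q where "x = \<phi> p" "y = \<phi> q" and pq: "\<forall>m\<in>Poly_Mapping.keys p. weight m \<le> w" "\<forall>m\<in>Poly_Mapping.keys q. weight m \<le> w"
    using assms unfolding F_def by blast
  moreover have "\<forall>m\<in>Poly_Mapping.keys (p + q). weight m \<le> w"
    using pq Poly_Mapping.keys_add[of p q] by blast
  ultimately show ?thesis unfolding F_def by (auto intro!: exI[of _ "p + q"] simp: phi.eval_add)
qed

lemma F_mult: assumes "x \<in> F v" "y \<in> F w" shows "x * y \<in> F (v + w)"
proof -
  obtain p q where "x = \<phi> p" "y = \<phi> q" and pq: "\<forall>m\<in>Poly_Mapping.keys p. weight m \<le> v" "\<forall>m\<in>Poly_Mapping.keys q. weight m \<le> w"
    using assms unfolding F_def by blast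
  moreover have "weight m \<le> v + w" if m: "m \<in> Poly_Mapping.keys (p * q)" for m
  proof -
    obtain a b where "a \<in> Poly_Mapping.keys p" "b \<in> Poly_Mapping.keys q" "m = a + b"
      using subsetD[OF Poly_Mapping.keys_mult m] by blast
    then show ?thesis using pq by (simp add: expo_add lookup_add add_mono)
  qed
  ultimately show ?thesis unfolding F_def by (auto intro!: exI[of _ "p * q"] simp: phi.eval_mult)
qed

lemma F_mono: "x \<in> F v \<Longrightarrow> v \<le> w \<Longrightarrow> x \<in> F w"
  unfolding F_def by (blast intro: order.trans)

lemma mv_F: "mv m \<in> F (weight m)"
  unfolding F_def by (auto intro!: exI[of _ "Poly_Mapping.single m 1"])

lemma scalar_F: "Poly_Mapping.single 0 c \<in> F 0"
  unfolding F_def by (auto intro!: exI[of _ "Poly_Mapping.single 0 c"] simp: expo_0 split: if_splits)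

lemma F_uminus: assumes "x \<in> F w" shows "- x \<in> F w"
  using F_mult[OF scalar_F[of "-1"] assms] by (simp add: single_uminus)

lemma F_sum: "(\<And>i. i \<in> T \<Longrightarrow> x i \<in> F w) \<Longrightarrow> sum x T \<in> F w"
  by (induction T rule: infinite_finite_induct) (simp_all add: F_0 F_add)

lemma phi_F: "(\<And>m. m \<in> Poly_Mapping.keys p \<Longrightarrow> weight m \<le> w) \<Longrightarrow> \<phi> p \<in> F w"
  unfolding F_def by blast

lemma split_off_power:
  assumes "Poly_Mapping.lookup m v \<ge> n"
  obtains m' where "m = m' + Poly_Mapping.single v (n::nat)"
proof
  show "m = (m - Poly_Mapping.single v n) + Poly_Mapping.single v n"
    using assms by (intro poly_mapping_eqI) (auto simp: lookup_add lookup_minus lookup_single when_def)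
qed

text \<open>
  The relations allow \<open>Z^r\<close> to be traded for \<open>X1 * Y^k1\<close> and \<open>X1^s\<close> for \<open>X2 * Y^k2\<close>. This preserves the
  exponent and costs only terms of smaller weight. The measure decreases since \<open>Z^r\<close> is replaced by a
  single \<open>X1\<close>.
\<close>

lemma reduce_to_normal:
  "\<exists>n. n \<in> normal \<and> expo n = expo m \<and> mv m - mv n \<in> F (weight m - 1)"
proof (induction "2 * Poly_Mapping.lookup m Z + Poly_Mapping.lookup m X1" arbitrary: m rule: less_induct)
  case less
  have step: ?case
    if m: "m = m' + a" and b: "2 * Poly_Mapping.lookup b Z + Poly_Mapping.lookup b X1 < 2 * Poly_Mapping.lookup a Z + Poly_Mapping.lookup a X1"
      and expo: "expo b = expo a" and F: "mv a - mv b \<in> F (weight a - 1)" for m' a b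
  proof -
    have "2 * Poly_Mapping.lookup (m' + b) Z + Poly_Mapping.lookup (m' + b) X1
        < 2 * Poly_Mapping.lookup m Z + Poly_Mapping.lookup m X1"
      using b by (simp add: m lookup_add)
    from less[OF this] obtain n where n: "n \<in> normal" "expo n = expo (m' + b)" "mv (m' + b) - mv n \<in> F (weight (m' + b) - 1)"
      by blast
    have w: "expo (m' + b) = expo m" by (simp add: m expo_add expo)
    have "mv m' * (mv a - mv b) \<in> F (weight m' + (weight a - 1))" by (intro F_mult mv_F F)
    then have "mv m' * (mv a - mv b) + (mv (m' + b) - mv n) \<in> F (weight m - 1)"
      using n w by (intro F_add) (auto simp: m expo_add lookup_add algebra_simps)
    also have "mv m' * (mv a - mv b) + (mv (m' + b) - mv n) = mv m - mv n"
      by (simp add: m monomial_value_add algebra_simps)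
    finally show ?thesis using n w by auto
  qed
  consider "Poly_Mapping.lookup m Z \<ge> r" | "Poly_Mapping.lookup m X1 \<ge> s" | "m \<in> normal"
    by (force simp: normal_def)
  then show ?case
  proof cases
    case 1
    then obtain m' where m: "m = m' + Poly_Mapping.single Z r" by (rule split_off_power)
    let ?b = "Poly_Mapping.single X1 1 + ymon k1"
    have expo: "expo ?b = expo (Poly_Mapping.single Z r)"
      by (simp add: expo_inject ycoord_def zcoord_def lookup_add lookup_single)
    have "mv ?b = \<phi> f1" by (simp add: monomial_value_add mv_ymon phi_f1 img_simps mult.commute)
    then have "mv (Poly_Mapping.single Z r) - mv ?b = - \<phi> g1" by (simp add: phi_f1_split)
    moreover have "\<phi> g1 \<in> F (weight (Poly_Mapping.single Z r) - 1)"
      by (rule phi_F[OF weight_g1])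
    ultimately show ?thesis using r_pos expo F_uminus
      by (intro step[OF m, of ?b]) (simp_all add: lookup_add lookup_single)
  next
    case 2
    then obtain m' where m: "m = m' + Poly_Mapping.single X1 s" by (rule split_off_power)
    let ?b = "Poly_Mapping.single X2 1 + ymon k2"
    have expo: "expo ?b = expo (Poly_Mapping.single X1 s)"
      by (simp add: expo_inject ycoord_def zcoord_def lookup_add lookup_single)
    have "mv ?b = \<phi> f2" by (simp add: monomial_value_add mv_ymon phi_f2 img_simps mult.commute)
    then have "mv (Poly_Mapping.single X1 s) - mv ?b = - \<phi> g2" by (simp add: phi_f2_split)
    moreover have "\<phi> g2 \<in> F (weight (Poly_Mapping.single X1 s) - 1)"
      by (rule phi_F[OF weight_g2])
    ultimately show ?thesis using s_pos expo F_uminus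
      by (intro step[OF m, of ?b]) (simp_all add: lookup_add lookup_single)
  next
    case 3
    then show ?thesis using F_0 by (intro exI[of _ m]) simp
  qed
qed

definition lead_expo :: "'k laurent \<Rightarrow> (nat \<Rightarrow>\<^sub>0 int)" where "lead_expo x = Max (Poly_Mapping.keys x)"

lemma lead_expo_in: "x \<noteq> 0 \<Longrightarrow> lead_expo x \<in> Poly_Mapping.keys x"
  unfolding lead_expo_def by (rule Max_in) auto

lemma lead_expo_ge: "u \<in> Poly_Mapping.keys x \<Longrightarrow> u \<le> lead_expo x"
  unfolding lead_expo_def by (rule Max_ge) auto

text \<open>
  Start with any representation of \<open>b\<close> and make its monomials of top weight \<open>w\<close> normal. Normal
  monomials have different exponents, so their leading parts cannot cancel. If any of them are left,
  then \<open>w\<close> is the weight of \<open>b\<close>, and their exponents occur in \<open>b\<close>. Otherwise \<open>b\<close> has a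
  representation of smaller weight; this can happen only finitely often, as \<open>w\<close> never drops below the
  weight of the leading exponent of \<open>b\<close>.
\<close>

lemma represent_below_lead_expo:
  assumes "b \<in> F w" "b \<noteq> 0"
  shows "\<exists>p. b = \<phi> p \<and> (\<forall>m\<in>Poly_Mapping.keys p. expo m \<le> lead_expo b) \<and> (\<exists>m\<in>Poly_Mapping.keys p. expo m = lead_expo b)"
  using assms
proof (induction "nat (w - Poly_Mapping.lookup (lead_expo b) 0)" arbitrary: w rule: less_induct)
  case less
  obtain p where p: "b = \<phi> p" "\<And>m. m \<in> Poly_Mapping.keys p \<Longrightarrow> weight m \<le> w"
    using less.prems(1) unfolding F_def by blast
  obtain nf where nf: "\<And>m. nf m \<in> normal \<and> expo (nf m) = expo m \<and> mv m - mv (nf m) \<in> F (weight m - 1)"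
    using reduce_to_normal by metis
  define T where "T = {m \<in> Poly_Mapping.keys p. weight m = w}"
  define q where "q = (\<Sum>m\<in>T. Poly_Mapping.single (nf m) (Poly_Mapping.lookup p m))"
  have keys_q: "n \<in> normal \<and> weight n = w" if "n \<in> Poly_Mapping.keys q" for n
  proof -
    have "n \<in> (\<Union>m\<in>T. Poly_Mapping.keys (Poly_Mapping.single (nf m) (Poly_Mapping.lookup p m)))"
      using that unfolding q_def by (rule subsetD[OF keys_sum])
    then show ?thesis using nf by (auto simp: T_def split: if_splits)
  qed
  have "b - \<phi> q \<in> F (w - 1)"
  proof -
    let ?c = "\<lambda>m. Poly_Mapping.single 0 (Poly_Mapping.lookup p m) :: 'k laurent"
    have "b = (\<Sum>m\<in>T. ?c m * mv m) + (\<Sum>m\<in>Poly_Mapping.keys p - T. ?c m * mv m)"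
      unfolding p(1) phi.eval_def by (subst sum.subset_diff[of T]) (auto simp: T_def)
    moreover have "\<phi> q = (\<Sum>m\<in>T. ?c m * mv (nf m))"
      by (simp add: q_def phi.eval_sum)
    ultimately have "b - \<phi> q = (\<Sum>m\<in>T. ?c m * (mv m - mv (nf m))) + (\<Sum>m\<in>Poly_Mapping.keys p - T. ?c m * mv m)"
      by (simp add: sum_subtractf right_diff_distrib)
    also have "\<dots> \<in> F (w - 1)"
    proof (intro F_add F_sum)
      fix m assume "m \<in> T"
      then have "mv m - mv (nf m) \<in> F (w - 1)" using nf[of m] by (simp add: T_def)
      from F_mult[OF scalar_F this] show "?c m * (mv m - mv (nf m)) \<in> F (w - 1)" by simp
    next
      fix m assume "m \<in> Poly_Mapping.keys p - T"
      then have "weight m \<le> w - 1" using p(2)[of m] by (auto simp: T_def)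
      then have "mv m \<in> F (w - 1)" using mv_F F_mono by blast
      from F_mult[OF scalar_F this] show "?c m * mv m \<in> F (w - 1)" by simp
    qed
    finally show ?thesis .
  qed
  then obtain p1 where p1: "b - \<phi> q = \<phi> p1" "\<And>m. m \<in> Poly_Mapping.keys p1 \<Longrightarrow> weight m \<le> w - 1"
    unfolding F_def by blast
  have b: "b = \<phi> (q + p1)" using p1(1) by (simp add: phi.eval_add algebra_simps)
  have b_weight_le: "Poly_Mapping.lookup (lead_expo b) 0 \<le> w"
    using F_weight_le[OF less.prems(1)] lead_expo_in[OF less.prems(2)] by (auto simp: weight_le_def)
  show ?case
  proof (cases "q = 0")
    case True
    then have F: "b \<in> F (w - 1)" using b p1(2) by (auto intro!: phi_F)
    then have "Poly_Mapping.lookup (lead_expo b) 0 \<le> w - 1"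
      using F_weight_le[OF F] lead_expo_in[OF less.prems(2)] by (auto simp: weight_le_def)
    then show ?thesis using less.prems(2) F by (intro less.hyps[of "w - 1"]) auto
  next
    case False
    let ?t = "\<Sum>n\<in>Poly_Mapping.keys q. Poly_Mapping.single (expo n) (Poly_Mapping.lookup q n)"
    have inj: "inj_on expo (Poly_Mapping.keys q)"
      by (rule inj_on_subset[OF inj_on_expo_normal]) (use keys_q in auto)
    have "\<phi> q - ?t = (\<Sum>n\<in>Poly_Mapping.keys q. Poly_Mapping.single 0 (Poly_Mapping.lookup q n) * (mv n - \<chi> (expo n)))"
      unfolding phi.eval_def by (simp add: sum_subtractf right_diff_distrib mult_single)
    also have "\<dots> \<in> weight_le (w - 1)"
    proof (rule weight_le_sum)
      fix n assume n: "n \<in> Poly_Mapping.keys q"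
      have "mv n - \<chi> (expo n) \<in> weight_le (w - 1)" using leads_mv[of n] keys_q[OF n] by (simp add: leads_def)
      then show "Poly_Mapping.single 0 (Poly_Mapping.lookup q n) * (mv n - \<chi> (expo n)) \<in> weight_le (w - 1)"
        using weight_le_mult[OF weight_le_single[of 0 0]] by fastforce
    qed
    finally have "(\<phi> q - ?t) + \<phi> p1 \<in> weight_le (w - 1)"
      using phi_F[OF p1(2)] F_weight_le by (intro weight_le_add) auto
    then have bt: "b - ?t \<in> weight_le (w - 1)" by (simp add: b phi.eval_add algebra_simps)
    have look: "Poly_Mapping.lookup b u = Poly_Mapping.lookup ?t u" if "Poly_Mapping.lookup u 0 = w" for u
      using lookup_above_weight_le[OF bt, of u] that by (simp add: lookup_minus)
    obtain n0 where n0: "n0 \<in> Poly_Mapping.keys q" using False by fastforce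
    have "Poly_Mapping.lookup b (expo n0) = Poly_Mapping.lookup q n0"
      using look[of "expo n0"] keys_q[OF n0] lookup_sum_chi[OF _ inj n0] by simp
    then have "expo n0 \<in> Poly_Mapping.keys b" using n0 by (simp add: in_keys_iff)
    then have "w \<le> Poly_Mapping.lookup (lead_expo b) 0"
      using lead_expo_ge lex_le_first keys_q[OF n0] by fastforce
    then have LTw: "Poly_Mapping.lookup (lead_expo b) 0 = w" using b_weight_le by simp
    have all: "expo m \<le> lead_expo b" if "m \<in> Poly_Mapping.keys (q + p1)" for m
    proof -
      consider "m \<in> Poly_Mapping.keys q" | "m \<in> Poly_Mapping.keys p1"
        using \<open>m \<in> Poly_Mapping.keys (q + p1)\<close> Poly_Mapping.keys_add[of q p1] by blast
      then show ?thesis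
      proof cases
        case 1
        then have "Poly_Mapping.lookup b (expo m) = Poly_Mapping.lookup q m"
          using look[of "expo m"] keys_q[of m] lookup_sum_chi[OF _ inj, of m] by simp
        then show ?thesis using 1 by (intro lead_expo_ge) (simp add: in_keys_iff)
      next
        case 2
        then show ?thesis using p1(2)[of m] LTw by (intro less_imp_le lex_less_first) simp
      qed
    qed
    have "Poly_Mapping.lookup ?t (lead_expo b) \<noteq> 0"
      using look[OF LTw] lead_expo_in[OF less.prems(2)] by (simp add: in_keys_iff)
    then have "lead_expo b \<in> Poly_Mapping.keys ?t" by (simp only: in_keys_iff not_False_eq_True)
    then have "lead_expo b \<in> (\<Union>n\<in>Poly_Mapping.keys q. Poly_Mapping.keys (Poly_Mapping.single (expo n) (Poly_Mapping.lookup q n)))"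
      by (rule subsetD[OF keys_sum])
    then obtain n where n: "n \<in> Poly_Mapping.keys q" "expo n = lead_expo b" by (auto split: if_splits)
    have "Poly_Mapping.lookup p1 n = 0"
      using p1(2)[of n] keys_q[OF n(1)] by (auto simp: in_keys_iff)
    then have "n \<in> Poly_Mapping.keys (q + p1)" using n(1) by (simp add: in_keys_iff lookup_add)
    then show ?thesis using b all n by blast
  qed
qed

lemma phi_in_F: "\<exists>w. \<phi> p \<in> F w"
proof -
  have "weight m \<le> Max (weight ` Poly_Mapping.keys p)" if "m \<in> Poly_Mapping.keys p" for m
    using that by (intro Max_ge) auto
  then show ?thesis using phi_F by blast
qed

lemma representation:
  assumes "b \<in> S" "b \<noteq> 0"
  obtains p where "b = \<phi> p" "\<And>m. m \<in> Poly_Mapping.keys p \<Longrightarrow> expo m \<le> lead_expo b" "\<exists>m\<in>Poly_Mapping.keys p. expo m = lead_expo b"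
proof -
  obtain p where "b = \<phi> p" using assms(1) by blast
  then obtain w where "b \<in> F w" using phi_in_F[of p] by blast
  with represent_below_lead_expo[OF this assms(2)] that show ?thesis by blast
qed

section \<open>A combinatorial obstruction\<close>

text \<open>
  The linear form \<open>ell\<close> has value \<open>- 1\<close> at a shift \<open>e\<close> with coordinates \<open>ey\<close>, \<open>ez\<close>, it is nonnegative on
  the monoid \<open>P\<close> of exponents, and from a point of \<open>P\<close> one can walk \<open>ell\<close> steps in direction \<open>e\<close> inside
  \<open>P\<close>, ending where \<open>ell\<close> vanishes. If \<open>L i > 0\<close>, these end points are sums of exponents of \<open>X2\<close> and of
  \<open>Y k\<close> with \<open>k \<noteq> i\<close>, since \<open>ell\<close> is positive at \<open>Y i\<close>, \<open>Z\<close> and \<open>X1\<close>. The linear form \<open>R\<close>, which vanishes on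
  these exponents, is then proportional to \<open>ell\<close>; so it decreases along \<open>e\<close>. This bounds the
  multiplicities of \<open>Z\<close> and \<open>X1\<close> in the points \<open>Y i + e\<close>, \<open>Z + e\<close> and \<open>X1 + e\<close> of \<open>P\<close>, whereas congruences
  modulo \<open>r\<close> and modulo \<open>s\<close> make the multiplicities in \<open>Y i + e\<close> large.
\<close>

lemma no_facet_opposite_Y:
  fixes ey L :: "'m \<Rightarrow> int" and ez Lz :: int
  defines "ell m \<equiv> (\<Sum>k\<in>UNIV. ycoord k m * L k) + zcoord m * Lz"
  assumes L: "\<And>k. L k \<ge> 0"
    and e: "(\<Sum>k\<in>UNIV. ey k * L k) + ez * Lz = -1"
    and nonneg: "\<And>m. ell m \<ge> 0"
    and shift: "\<And>m t. int t \<le> ell m \<Longrightarrow> \<exists>m'. (\<forall>k. ycoord k m' = ycoord k m + int t * ey k) \<and> zcoord m' = zcoord m + int t * ez"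
    and cases: "(s \<ge> 2 \<and> (\<forall>k. k2 k \<ge> 2)) \<or> (r \<ge> 2 \<and> (\<forall>k. k1 k \<ge> 2))"
  shows "L i = 0"
proof (rule ccontr)
  assume "L i \<noteq> 0"
  with L[of i] have Li: "L i > 0" by simp
  let ?a = "\<lambda>v m. int (Poly_Mapping.lookup m v)"
  have single_Y: "ell (Poly_Mapping.single (Y k) 1) = L k" for k
  proof -
    have "(\<Sum>l\<in>UNIV. ycoord l (Poly_Mapping.single (Y k) 1) * L l) = (\<Sum>l\<in>UNIV. if l = k then L l else 0)"
      by (intro sum.cong) (auto simp: ycoord_def lookup_single when_def)
    then show ?thesis by (simp add: ell_def zcoord_def lookup_single)
  qed
  have single_Z: "ell (Poly_Mapping.single Z 1) = Lz"
    by (simp add: ell_def zcoord_def ycoord_def lookup_single)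
  define x where "x = ell (Poly_Mapping.single X1 1)"
  define x' where "x' = ell (Poly_Mapping.single X2 1)"
  have x: "x = int r * Lz - (\<Sum>k\<in>UNIV. int (k1 k) * L k)"
    by (simp add: x_def ell_def zcoord_def ycoord_def lookup_single sum_negf)
  have x': "x' = int s * x - (\<Sum>k\<in>UNIV. int (k2 k) * L k)"
    by (simp add: x'_def x ell_def zcoord_def ycoord_def lookup_single sum_negf sum.distrib sum_subtractf sum_distrib_left algebra_simps)
  have term_le: "int (k i) * L i \<le> (\<Sum>l\<in>UNIV. int (k l) * L l)" for k :: "'m \<Rightarrow> nat"
    using L by (intro member_le_sum) auto
  have pos: "0 < int (k i) * L i" if "k i > 0" for k :: "'m \<Rightarrow> nat"
    using that Li by simp
  have "0 < int s * x"
    using nonneg[of "Poly_Mapping.single X2 1"] x' term_le[of k2] pos[of k2, OF k2_pos] unfolding x'_def by linarith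
  then have x_pos: "x > 0" by (simp add: zero_less_mult_iff)
  have "0 < int r * Lz" using x x_pos term_le[of k1] pos[of k1, OF k1_pos] by linarith
  then have Lz_pos: "Lz > 0" by (simp add: zero_less_mult_iff)
  have x'_nonneg: "x' \<ge> 0" using nonneg by (simp add: x'_def)
  have ell_expand: "ell m = (\<Sum>k\<in>UNIV. ?a (Y k) m * L k) + ?a Z m * Lz + ?a X1 m * x + ?a X2 m * x'" for m
    by (simp add: ell_def x' x ycoord_def zcoord_def sum_subtractf sum.distrib sum_distrib_left sum_distrib_right algebra_simps)
  define c where "c = int s * int (k1 i) + int (k2 i)"
  \<comment> \<open>\<open>R\<close> takes the values \<open>r * s\<close> at \<open>Y i\<close>, \<open>c\<close> at \<open>Z\<close>, \<open>r * k2 i\<close> at \<open>X1\<close>, and vanishes at \<open>X2\<close> and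
    at the other \<open>Y k\<close>.\<close>
  define R where "R m = int r * int s * ycoord i m + c * zcoord m" for m
  have R_expand: "R m = int r * int s * ?a (Y i) m + c * ?a Z m + int r * int (k2 i) * ?a X1 m" for m
    by (simp add: R_def c_def ycoord_def zcoord_def algebra_simps)
  define Re where "Re = int r * int s * ey i + c * ez"
  have R_line: "R m + ell m * Re = 0" for m
  proof -
    obtain m' where m': "\<And>k. ycoord k m' = ycoord k m + ell m * ey k" "zcoord m' = zcoord m + ell m * ez"
      using shift[of "nat (ell m)" m] nonneg[of m] by auto
    have "ell m' = ell m + ell m * ((\<Sum>k\<in>UNIV. ey k * L k) + ez * Lz)"
      by (simp add: ell_def[of m'] m' sum.distrib sum_distrib_left algebra_simps) (simp add: ell_def algebra_simps)
    then have 0: "ell m' = 0" by (simp add: e)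
    have "?a (Y i) m' * L i \<le> (\<Sum>k\<in>UNIV. ?a (Y k) m' * L k)"
      using L by (intro member_le_sum) auto
    moreover have "0 \<le> ?a (Y i) m' * L i" "0 \<le> ?a Z m' * Lz" "0 \<le> ?a X1 m' * x" "0 \<le> ?a X2 m' * x'"
      using Li Lz_pos x_pos x'_nonneg by auto
    ultimately have "?a (Y i) m' * L i = 0" "?a Z m' * Lz = 0" "?a X1 m' * x = 0"
      using 0 unfolding ell_expand by linarith+
    then have "R m' = 0" using Li Lz_pos x_pos by (simp add: R_expand)
    then show ?thesis by (simp add: R_def Re_def m' algebra_simps)
  qed
  have rs: "int r > 0" "int s > 0" using r_pos s_pos by auto
  have k: "int (k1 i) \<ge> 1" "int (k2 i) \<ge> 1" using k1_pos[of i] k2_pos[of i] by linarith+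
  have c_ge: "c \<ge> int s * int (k1 i) + 1" "c > int (k2 i)" "c > int s"
  proof -
    have "int s * 1 \<le> int s * int (k1 i)" using k rs by (intro mult_left_mono) auto
    then show "c \<ge> int s * int (k1 i) + 1" "c > int (k2 i)" "c > int s" using k rs unfolding c_def by linarith+
  qed
  have c_pos: "c > 0" using c_ge rs by linarith
  have Re_neg: "Re < 0"
  proof -
    have "int r * int s + L i * Re = 0"
      using R_line[of "Poly_Mapping.single (Y i) 1"] unfolding single_Y by (simp add: R_expand lookup_single)
    moreover have "0 < int r * int s" using rs by simp
    ultimately have "L i * Re < 0" by linarith
    then show ?thesis using Li by (simp add: mult_less_0_iff)
  qed
  have shift1: "\<exists>m'. R m' = R m + Re \<and> zcoord m' = zcoord m + ez" if m: "ell m > 0" for m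
  proof -
    obtain m' where "\<And>k. ycoord k m' = ycoord k m + ey k" "zcoord m' = zcoord m + ez"
      using shift[of 1 m] m by auto
    then show ?thesis by (intro exI[of _ m']) (simp add: R_def Re_def algebra_simps)
  qed
  have nonneg_terms: "0 \<le> int r * int s * ?a (Y i) m" "0 \<le> c * ?a Z m" "0 \<le> int r * int (k2 i) * ?a X1 m" for m
    using c_pos by simp_all
  obtain m1 where m1: "R m1 = int r * int s + Re" "zcoord m1 = ez"
    using shift1[of "Poly_Mapping.single (Y i) 1"] Li unfolding single_Y by (auto simp: R_expand lookup_single zcoord_def)
  have m1_bound: "c * ?a Z m1 < int r * int s" "int r * int (k2 i) * ?a X1 m1 < int r * int s"
    using nonneg_terms[of m1] m1(1) Re_neg unfolding R_expand by linarith+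
  from cases show False
  proof
    \<comment> \<open>The point \<open>Z + e\<close> contains no \<open>Z\<close>, as its value under \<open>R\<close> is below \<open>c\<close>. So the degree in \<open>Z\<close> of \<open>e\<close>
      is \<open>- 1\<close> modulo \<open>r\<close>, and \<open>Y i + e\<close> contains at least \<open>r - 1\<close> factors \<open>Z\<close>.\<close>
    assume "r \<ge> 2 \<and> (\<forall>k. k1 k \<ge> 2)"
    then have r2: "int r \<ge> 2" and k12: "int (k1 i) \<ge> 2" using of_nat_mono[of 2] by fastforce+
    obtain m2 where m2: "R m2 = c + Re" "zcoord m2 = 1 + ez"
      using shift1[of "Poly_Mapping.single Z 1"] Lz_pos unfolding single_Z by (auto simp: R_expand lookup_single zcoord_def)
    have "c * ?a Z m2 < c * 1" using nonneg_terms[of m2] m2(1) Re_neg unfolding R_expand by linarith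
    then have Z2: "?a Z m2 = 0" using c_pos by (simp only: mult_less_cancel_left_pos)
    have "?a Z m1 + 1 = int r * (?a X1 m2 + int s * ?a X2 m2 - ?a X1 m1 - int s * ?a X2 m1)"
      using m1(2) m2(2) Z2 by (simp add: zcoord_def algebra_simps)
    then have "int r dvd ?a Z m1 + 1" by simp
    then have "int r - 1 \<le> ?a Z m1" using zdvd_imp_le[of "int r" "?a Z m1 + 1"] by linarith
    then have "c * (int r - 1) \<le> c * ?a Z m1" using c_pos by (intro mult_left_mono) auto
    moreover have "(int s * 2) * (int r - 1) \<le> c * (int r - 1)"
    proof (rule mult_right_mono)
      have "int s * 2 \<le> int s * int (k1 i)" using k12 rs by (intro mult_left_mono) auto
      then show "int s * 2 \<le> c" using c_ge by linarith
    qed (use r2 in simp)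
    ultimately have "(int s * 2) * (int r - 1) < int r * int s" using m1_bound by linarith
    then have "int s * (2 * (int r - 1)) < int s * int r" by (simp add: algebra_simps)
    then have "2 * (int r - 1) < int r" using rs by (simp only: mult_less_cancel_left_pos)
    then show False using r2 by (simp add: right_diff_distrib)
  next
    \<comment> \<open>The point \<open>X1 + e\<close> contains no \<open>X1\<close>, as its value under \<open>R\<close> is below \<open>r * k2 i\<close>. It contains as many
      factors \<open>Z\<close> as \<open>Y i + e\<close>, so that comparing degrees in \<open>Z\<close> gives at least \<open>s - 1\<close> factors \<open>X1\<close> in \<open>Y i + e\<close>.\<close>
    assume "s \<ge> 2 \<and> (\<forall>k. k2 k \<ge> 2)"
    then have s2: "int s \<ge> 2" and k22: "int (k2 i) \<ge> 2" using of_nat_mono[of 2] by fastforce+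
    obtain m3 where m3: "R m3 = int r * int (k2 i) + Re" "zcoord m3 = int r + ez"
      using shift1[of "Poly_Mapping.single X1 1"] x_pos unfolding x_def[symmetric] by (auto simp: R_expand lookup_single zcoord_def)
    have 3: "c * ?a Z m3 < int r * int (k2 i)" "int r * int (k2 i) * ?a X1 m3 < int r * int (k2 i) * 1"
      using nonneg_terms[of m3] m3(1) Re_neg unfolding R_expand by linarith+
    have "0 < int r * int (k2 i)" using rs k by simp
    with 3(2) have X3: "?a X1 m3 = 0" by (simp only: mult_less_cancel_left_pos)
    have "int r * int (k2 i) \<le> c * int r" "int r * int s \<le> c * int r"
      using mult_left_mono[of "int (k2 i)" c "int r"] mult_left_mono[of "int s" c "int r"] c_ge rs
      by (simp_all add: mult.commute[of c])
    then have "c * ?a Z m3 < c * int r" "c * ?a Z m1 < c * int r"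
      using 3(1) m1_bound(1) by linarith+
    then have Zr: "?a Z m3 < int r" "?a Z m1 < int r" using c_pos by (simp_all only: mult_less_cancel_left_pos)
    have eq: "?a Z m3 + int r * (int s * ?a X2 m3) = ?a Z m1 + int r * (1 + ?a X1 m1 + int s * ?a X2 m1)"
      using m1(2) m3(2) X3 by (simp add: zcoord_def algebra_simps)
    have Z13: "?a Z m3 = ?a Z m1"
      using arg_cong[OF eq, of "\<lambda>t. t mod int r"] Zr by simp
    with eq have "int r * (int s * ?a X2 m3) = int r * (1 + ?a X1 m1 + int s * ?a X2 m1)" by linarith
    then have "int s * ?a X2 m3 = 1 + ?a X1 m1 + int s * ?a X2 m1" using rs by simp
    then have "?a X1 m1 + 1 = int s * (?a X2 m3 - ?a X2 m1)" by (simp add: algebra_simps)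
    then have "int s dvd ?a X1 m1 + 1" by simp
    then have ge: "int s - 1 \<le> ?a X1 m1" using zdvd_imp_le[of "int s" "?a X1 m1 + 1"] by linarith
    have "int r * (int (k2 i) * ?a X1 m1) < int r * int s" using m1_bound(2) by (simp add: mult.assoc)
    then have "int (k2 i) * ?a X1 m1 < int s" using rs by (simp only: mult_less_cancel_left_pos)
    moreover have "2 * ?a X1 m1 \<le> int (k2 i) * ?a X1 m1" using k22 by (intro mult_right_mono) auto
    ultimately show False using ge s2 by linarith
  qed
qed

end

section \<open>Locally nilpotent derivations of the image\<close>

definition below :: "(nat \<Rightarrow>\<^sub>0 int) \<Rightarrow> 'k::field laurent set" where
  "below u = {x. \<forall>v\<in>Poly_Mapping.keys x. v \<le> u}"

lemma below_0: "0 \<in> below u"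
  by (simp add: below_def)

lemma below_add: "x \<in> below u \<Longrightarrow> y \<in> below u \<Longrightarrow> x + y \<in> below u"
  using Poly_Mapping.keys_add[of x y] by (auto simp: below_def)

lemma below_sum: "(\<And>i. i \<in> S \<Longrightarrow> x i \<in> below u) \<Longrightarrow> sum x S \<in> below u"
  by (induction S rule: infinite_finite_induct) (auto simp: below_0 below_add)

lemma below_mult:
  assumes "x \<in> below u" "y \<in> below v" shows "x * y \<in> below (u + v)"
  unfolding below_def
proof safe
  fix w assume "w \<in> Poly_Mapping.keys (x * y)"
  then obtain a b where "a \<in> Poly_Mapping.keys x" "b \<in> Poly_Mapping.keys y" "w = a + b"
    using Poly_Mapping.keys_mult[of x y] by blast
  then show "w \<le> u + v" using assms by (auto simp: below_def intro!: add_mono)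
qed

lemma below_mono: "x \<in> below u \<Longrightarrow> u \<le> v \<Longrightarrow> x \<in> below v"
  by (auto simp: below_def)

lemma below_scalar: "x \<in> below u \<Longrightarrow> Poly_Mapping.single 0 c * x \<in> below u"
  using below_mult[of "Poly_Mapping.single 0 c" 0 x u] by (simp add: below_def)

lemma lookup_beyond: "x \<in> below u \<Longrightarrow> u < v \<Longrightarrow> Poly_Mapping.lookup x v = 0"
  by (force simp: below_def in_keys_iff)

text \<open>
  As the order is compatible with addition, \<open>u + v\<close> is a sum of exponents of \<open>x\<close> and \<open>y\<close> in only one
  way.
\<close>

lemma lookup_mult_top:
  assumes "x \<in> below u" "y \<in> below v"
  shows "Poly_Mapping.lookup (x * y) (u + v) = Poly_Mapping.lookup x u * Poly_Mapping.lookup y v"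
proof -
  let ?A = "Poly_Mapping.keys x" and ?B = "Poly_Mapping.keys y"
  let ?x = "Poly_Mapping.lookup x" and ?y = "Poly_Mapping.lookup y"
  have "x * y = (\<Sum>a\<in>?A. \<Sum>b\<in>?B. Poly_Mapping.single (a + b) (?x a * ?y b))"
    by (subst sum_of_monomials[of x], subst sum_of_monomials[of y]) (simp add: sum_product mult_single)
  then have "Poly_Mapping.lookup (x * y) (u + v) = (\<Sum>a\<in>?A. \<Sum>b\<in>?B. if a + b = u + v then ?x a * ?y b else 0)"
    by (simp only: lookup_sum lookup_single when_def)
  also have "\<dots> = (\<Sum>a\<in>?A. \<Sum>b\<in>?B. if b = v then if a = u then ?x a * ?y b else 0 else 0)"
  proof (intro sum.cong refl)
    fix a b assume "a \<in> ?A" "b \<in> ?B"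
    then have "a \<le> u" "b \<le> v" using assms by (auto simp: below_def)
    then have "a + b = u + v \<longleftrightarrow> a = u \<and> b = v"
      using add_less_le_mono[of a u b v] add_le_less_mono[of a u b v] by (auto simp: order.order_iff_strict)
    then show "(if a + b = u + v then ?x a * ?y b else 0) = (if b = v then if a = u then ?x a * ?y b else 0 else 0)" by auto
  qed
  also have "\<dots> = (\<Sum>a\<in>?A. if a = u then ?x a * ?y v else 0)"
    by (intro sum.cong refl) (auto simp: in_keys_iff)
  also have "\<dots> = ?x u * ?y v" by (auto simp: in_keys_iff)
  finally show ?thesis .
qed

lemma leads_below:
  assumes "leads x u" shows "x \<in> below u" and "Poly_Mapping.lookup x u = 1"
proof -
  let ?y = "x - \<chi> u"
  have y: "v < u" if "v \<in> Poly_Mapping.keys ?y" for v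
    using that assms by (intro lex_less_first) (auto simp: leads_def weight_le_def)
  then have "?y \<in> below u" by (auto simp: below_def intro: less_imp_le)
  then have "?y + \<chi> u \<in> below u" by (rule below_add) (simp add: below_def)
  then show "x \<in> below u" by simp
  have "Poly_Mapping.lookup ?y u = 0" using y[of u] by (auto simp: in_keys_iff)
  then show "Poly_Mapping.lookup x u = 1" by (simp add: lookup_minus)
qed

text \<open>
  Nothing is assumed about the values of \<open>d\<close> outside of \<open>S\<close>.
\<close>

locale image_LND = weighted_danielewski k1 k2 f1 f2 g1 g2 r s j
  for k1 k2 :: "'m::finite \<Rightarrow> nat" and f1 f2 g1 g2 :: "('m gen, 'k::field_char_0) mpoly" and r s :: nat and j :: 'm +
  fixes d :: "'k laurent \<Rightarrow> 'k laurent"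
  assumes d_closed: "x \<in> S \<Longrightarrow> d x \<in> S"
    and d_add: "x \<in> S \<Longrightarrow> y \<in> S \<Longrightarrow> d (x + y) = d x + d y"
    and d_mult: "x \<in> S \<Longrightarrow> y \<in> S \<Longrightarrow> d (x * y) = d x * y + x * d y"
    and d_scalar: "x \<in> S \<Longrightarrow> d (Poly_Mapping.single 0 c * x) = Poly_Mapping.single 0 c * d x"
    and d_nilpotent: "x \<in> S \<Longrightarrow> \<exists>N. (d ^^ N) x = 0"
begin

lemma S_funpow: "x \<in> S \<Longrightarrow> (d ^^ n) x \<in> S"
  by (induction n) (auto intro: d_closed)

lemma d_0: "d 0 = 0"
  using d_add[OF S_0 S_0] by simp

lemma d_1: "d 1 = 0"
  using d_mult[OF S_1 S_1] by simp

lemma d_sum: "(\<And>i. i \<in> T \<Longrightarrow> x i \<in> S) \<Longrightarrow> sum x T \<in> S \<and> d (sum x T) = (\<Sum>i\<in>T. d (x i))"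
  by (induction T rule: infinite_finite_induct) (auto simp: S_0 d_0 d_add S_add)

lemma d_phi: "d (\<phi> p) = (\<Sum>m\<in>Poly_Mapping.keys p. Poly_Mapping.single 0 (Poly_Mapping.lookup p m) * d (mv m))"
proof -
  have "d (\<phi> p) = (\<Sum>m\<in>Poly_Mapping.keys p. d (Poly_Mapping.single 0 (Poly_Mapping.lookup p m) * mv m))"
    unfolding phi.eval_def by (rule d_sum[THEN conjunct2]) (intro S_mult S_scalar S_mv)
  then show ?thesis by (simp only: d_scalar[OF S_mv])
qed

lemma funpow_add: "x \<in> S \<Longrightarrow> y \<in> S \<Longrightarrow> (d ^^ n) (x + y) = (d ^^ n) x + (d ^^ n) y"
  by (induction n) (simp_all add: d_add S_funpow)

lemma funpow_0: "(d ^^ n) 0 = 0"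
  by (induction n) (simp_all add: d_0)

text \<open>
  In the Leibniz formula for the power \<open>p + q\<close> of \<open>d\<close> only the term with \<open>p\<close> derivatives on \<open>a\<close> and \<open>q\<close>
  on \<open>b\<close> survives. All that matters about its binomial coefficient is that it is positive.
\<close>

lemma funpow_top_mult:
  assumes "a \<in> S" "b \<in> S" "(d ^^ Suc p) a = 0" "(d ^^ Suc q) b = 0"
  shows "\<exists>C>0. (d ^^ (p + q)) (a * b) = of_nat C * ((d ^^ p) a * (d ^^ q) b)"
  using assms
proof (induction "p + q" arbitrary: a b p q)
  case 0
  then show ?case by (intro exI[of _ 1]) simp
next
  case (Suc n)
  have split: "(d ^^ Suc n) (a * b) = (d ^^ n) (d a * b) + (d ^^ n) (a * d b)"
    using Suc.prems by (simp only: funpow_Suc_right o_def d_mult funpow_add S_mult d_closed)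
  have shift: "(d ^^ n) (d x) = (d ^^ Suc n) x" for n x
    by (simp only: funpow_Suc_right o_def)
  have left: "\<exists>C>0. (d ^^ n) (d a * b) = of_nat C * ((d ^^ p) a * (d ^^ q) b)" if p: "p > 0"
  proof -
    obtain p' where p': "p = Suc p'" using p by (cases p) auto
    have n: "n = p' + q" using Suc(2) p' by simp
    have "(d ^^ Suc p') (d a) = 0" using Suc.prems(3) by (simp only: shift p')
    from Suc(1)[OF n d_closed[OF Suc.prems(1)] Suc.prems(2) this Suc.prems(4)]
    show ?thesis by (simp only: shift p' n)
  qed
  have right: "\<exists>C>0. (d ^^ n) (a * d b) = of_nat C * ((d ^^ p) a * (d ^^ q) b)" if q: "q > 0"
  proof -
    obtain q' where q': "q = Suc q'" using q by (cases q) auto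
    have n: "n = p + q'" using Suc(2) q' by simp
    have "(d ^^ Suc q') (d b) = 0" using Suc.prems(4) by (simp only: shift q')
    from Suc(1)[OF n Suc.prems(1) d_closed[OF Suc.prems(2)] Suc.prems(3) this]
    show ?thesis by (simp only: shift q' n)
  qed
  consider "p = 0" "q > 0" | "p > 0" "q = 0" | "p > 0" "q > 0" using Suc(2) by fastforce
  then show ?case
  proof cases
    case 1
    then have "d a = 0" using Suc.prems(3) by simp
    then show ?thesis using right[OF 1(2)] split Suc(2) by (simp add: funpow_0)
  next
    case 2
    then have "d b = 0" using Suc.prems(4) by simp
    then show ?thesis using left[OF 2(1)] split Suc(2) by (simp add: funpow_0)
  next
    case 3
    then obtain C D where C: "C > 0" "(d ^^ n) (d a * b) = of_nat C * ((d ^^ p) a * (d ^^ q) b)"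
       and D: "D > 0" "(d ^^ n) (a * d b) = of_nat D * ((d ^^ p) a * (d ^^ q) b)"
      using left right by blast
    have "(d ^^ (p + q)) (a * b) = of_nat (C + D) * ((d ^^ p) a * (d ^^ q) b)"
      using split Suc(2) C D by (simp add: distrib_right)
    then show ?thesis using C(1) by (intro exI[of _ "C + D"]) simp
  qed
qed

lemma last_nonzero:
  assumes "x \<in> S" "x \<noteq> 0"
  obtains p where "(d ^^ p) x \<noteq> 0" "(d ^^ Suc p) x = 0"
proof -
  obtain N where N: "(d ^^ N) x = 0" using d_nilpotent[OF assms(1)] by blast
  define L where "L = (LEAST n. (d ^^ n) x = 0)"
  have L: "(d ^^ L) x = 0" unfolding L_def using N by (rule LeastI)
  then have "L > 0" using assms(2) by (cases L) auto
  moreover have "(d ^^ (L - 1)) x \<noteq> 0"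
    using \<open>L > 0\<close> unfolding L_def by (intro not_less_Least) simp
  ultimately show ?thesis using that[of "L - 1"] L by simp
qed

text \<open>
  The highest powers of \<open>d\<close> that do not kill \<open>a\<close> and \<open>b\<close> add up to one that does not kill the product,
  because \<open>S\<close> has no zero divisors and the characteristic is zero.
\<close>

lemma factorially_closed:
  assumes "a \<in> S" "b \<in> S" "d (a * b) = 0" "a * b \<noteq> 0"
  shows "d a = 0"
proof -
  obtain p where p: "(d ^^ p) a \<noteq> 0" "(d ^^ Suc p) a = 0" using assms by (auto intro: last_nonzero[of a])
  obtain q where q: "(d ^^ q) b \<noteq> 0" "(d ^^ Suc q) b = 0" using assms by (auto intro: last_nonzero[of b])
  obtain C where C: "C > 0" "(d ^^ (p + q)) (a * b) = of_nat C * ((d ^^ p) a * (d ^^ q) b)"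
    using funpow_top_mult[OF assms(1,2) p(2) q(2)] by blast
  have "(d ^^ (p + q)) (a * b) \<noteq> 0" using C p q by simp
  then have "p + q = 0" using assms(3) by (cases "p + q") (auto simp: funpow_Suc_right funpow_0 simp del: funpow.simps)
  then show ?thesis using p(2) by simp
qed

section \<open>Leading parts of derivations\<close>

lemma mv_below: "mv m \<in> below (expo m)" and lookup_mv: "Poly_Mapping.lookup (mv m) (expo m) = 1"
  using leads_below[OF leads_mv] by auto

lemma lead_expo_mv: "lead_expo (mv m) = expo m"
proof -
  have "expo m \<in> Poly_Mapping.keys (mv m)" by (simp add: in_keys_iff lookup_mv)
  then show ?thesis using mv_below[of m] unfolding lead_expo_def below_def by (intro Max_eqI) auto
qed

lemma mv_nonzero: "mv m \<noteq> 0"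
  using lookup_mv[of m] by auto

lemma scalar_below: "Poly_Mapping.single 0 c \<in> below 0"
  by (simp add: below_def)

lemma below_lead_expo: "x \<in> below (lead_expo x)"
  by (simp add: below_def lead_expo_ge)

text \<open>
  The shift \<open>e\<close> bounds how far \<open>d\<close> can raise exponents. By \<open>representation\<close> a bound on the
  generators is a bound on all of \<open>S\<close>.
\<close>

context
  fixes e :: "nat \<Rightarrow>\<^sub>0 int"
  assumes e_gen: "\<And>v. d (img v) \<in> below (expo (Poly_Mapping.single v 1) + e)"
begin

lemma d_mv_below: "d (mv m) \<in> below (expo m + e)"
proof (induction m rule: monomial_induct)
  case zero
  show ?case by (simp add: d_1 below_0)
next
  case (step m v)
  let ?v = "Poly_Mapping.single v (1::nat)"
  have "d (mv (m + ?v)) = d (mv m) * img v + mv m * d (img v)"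
    by (simp add: monomial_value_add d_mult S_mv S_img)
  moreover have "d (mv m) * img v \<in> below ((expo m + e) + expo ?v)"
    using below_mult[OF step mv_below[of ?v]] by simp
  moreover have "mv m * d (img v) \<in> below (expo m + (expo ?v + e))"
    by (rule below_mult[OF mv_below e_gen])
  ultimately show ?case by (auto simp: expo_add ac_simps intro: below_add)
qed

lemma d_below: assumes "b \<in> S" "b \<in> below u" shows "d b \<in> below (u + e)"
proof (cases "b = 0")
  case False
  obtain p where p: "b = \<phi> p" "\<And>m. m \<in> Poly_Mapping.keys p \<Longrightarrow> expo m \<le> lead_expo b"
    using representation[OF assms(1) False] by blast
  have "lead_expo b \<le> u" using lead_expo_in[OF False] assms(2) by (simp add: below_def)
  then have "expo m + e \<le> u + e" if "m \<in> Poly_Mapping.keys p" for m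
    using p(2)[OF that] by (intro add_right_mono) simp
  then show ?thesis unfolding p(1) d_phi
    by (intro below_sum below_scalar below_mono[OF d_mv_below]) simp
qed (simp add: d_0 below_0)

text \<open>
  The coefficient with which the leading part of \<open>d\<close> acts on the leading monomial of \<open>mv m\<close>.
\<close>

definition top_coeff :: "('m gen \<Rightarrow>\<^sub>0 nat) \<Rightarrow> 'k" where
  "top_coeff m = Poly_Mapping.lookup (d (mv m)) (expo m + e)"

lemma top_coeff_add: "top_coeff (m + n) = top_coeff m + top_coeff n"
proof -
  have d: "d (mv (m + n)) = d (mv m) * mv n + mv m * d (mv n)"
    by (simp add: monomial_value_add d_mult S_mv)
  have e1: "expo (m + n) + e = (expo m + e) + expo n" and e2: "expo (m + n) + e = expo m + (expo n + e)"
    by (simp_all add: expo_add ac_simps)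
  have "Poly_Mapping.lookup (d (mv m) * mv n) (expo (m + n) + e) = top_coeff m"
    unfolding e1 lookup_mult_top[OF d_mv_below mv_below] by (simp add: top_coeff_def lookup_mv)
  moreover have "Poly_Mapping.lookup (mv m * d (mv n)) (expo (m + n) + e) = top_coeff n"
    unfolding e2 lookup_mult_top[OF mv_below d_mv_below] by (simp add: top_coeff_def lookup_mv)
  ultimately show ?thesis by (simp only: top_coeff_def d lookup_add)
qed

text \<open>
  Only the leading term of \<open>b\<close> contributes, since the rest of \<open>b\<close> lies in \<open>S\<close> after subtraction of a
  multiple of \<open>mv m\<close> and is raised by at most \<open>e\<close>.
\<close>

lemma lookup_d_top:
  assumes b: "b \<in> S" "lead_expo b = expo m" "b \<noteq> 0"
  shows "Poly_Mapping.lookup (d b) (expo m + e) = Poly_Mapping.lookup b (expo m) * top_coeff m"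
proof -
  let ?c = "Poly_Mapping.single 0 (Poly_Mapping.lookup b (expo m))"
  define b' where "b' = b - ?c * mv m"
  have S: "?c * mv m \<in> S" by (intro S_mult S_scalar S_mv)
  then have b'S: "b' \<in> S" unfolding b'_def by (intro S_diff b)
  have "b = b' + ?c * mv m" by (simp add: b'_def)
  then have "d b = d (b' + ?c * mv m)" by simp
  also have "\<dots> = d b' + ?c * d (mv m)"
    by (simp only: d_add[OF b'S S] d_scalar[OF S_mv])
  finally have db: "d b = d b' + ?c * d (mv m)" .
  have "Poly_Mapping.lookup (?c * d (mv m)) (0 + (expo m + e)) = Poly_Mapping.lookup b (expo m) * top_coeff m"
    using lookup_mult_top[OF scalar_below d_mv_below, of _ m] by (simp add: top_coeff_def)
  moreover have "Poly_Mapping.lookup (d b') (expo m + e) = 0"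
  proof (cases "b' = 0")
    case False
    have "b' \<in> below (expo m)"
    proof -
      have "(- ?c) * mv m \<in> below (expo m)"
        using below_scalar[OF mv_below[of m], of "- Poly_Mapping.lookup b (expo m)"] by (simp add: single_uminus)
      then have "b + (- ?c) * mv m \<in> below (expo m)" using below_lead_expo[of b] b(2) by (intro below_add) auto
      then show ?thesis by (simp add: b'_def)
    qed
    moreover have "Poly_Mapping.lookup b' (expo m) = 0"
    proof -
      have "Poly_Mapping.lookup (?c * mv m) (0 + expo m) = Poly_Mapping.lookup b (expo m)"
        using lookup_mult_top[OF scalar_below mv_below, of _ m] by (simp add: lookup_mv)
      then show ?thesis by (simp add: b'_def lookup_minus)
    qed
    ultimately have "lead_expo b' \<le> expo m" "lead_expo b' \<noteq> expo m"
      using lead_expo_in[OF False] by (auto simp: below_def in_keys_iff)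
    then have "lead_expo b' < expo m" by (simp only: order.strict_iff_order simp_thms)
    then have "lead_expo b' + e < expo m + e" by simp
    then show ?thesis using lookup_beyond[OF d_below[OF b'S below_lead_expo]] by blast
  qed (simp add: d_0)
  ultimately show ?thesis by (simp add: db lookup_add)
qed

lemma top_coeff_cong: assumes "expo m = expo n" shows "top_coeff m = top_coeff n"
proof -
  have lead_expo: "lead_expo (mv m) = expo n" using lead_expo_mv[of m] assms by simp
  have "Poly_Mapping.lookup (mv m) (expo n) = 1" using lookup_mv[of m] assms by simp
  then have "Poly_Mapping.lookup (d (mv m)) (expo n + e) = top_coeff n"
    using lookup_d_top[OF S_mv lead_expo mv_nonzero] by simp
  then show ?thesis using assms by (simp add: top_coeff_def)
qed

lemma leading_step:
  assumes b: "b \<in> S" "b \<noteq> 0" "lead_expo b = expo m" and "top_coeff m \<noteq> 0"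
  shows "d b \<noteq> 0" "lead_expo (d b) = expo m + e" "\<exists>m'. expo m' = expo m + e"
proof -
  have "Poly_Mapping.lookup b (expo m) \<noteq> 0" using lead_expo_in[OF b(2)] b(3) by (simp add: in_keys_iff)
  then have "Poly_Mapping.lookup (d b) (expo m + e) \<noteq> 0"
    using lookup_d_top[OF b(1,3,2)] assms(4) by simp
  then have k: "expo m + e \<in> Poly_Mapping.keys (d b)" by (simp add: in_keys_iff)
  then show nz: "d b \<noteq> 0" by auto
  have "d b \<in> below (expo m + e)" using d_below[OF b(1) below_lead_expo] b(3) by simp
  then show lead_expo: "lead_expo (d b) = expo m + e"
    using k unfolding lead_expo_def below_def by (intro Max_eqI) auto
  show "\<exists>m'. expo m' = expo m + e"
    using representation[OF d_closed[OF b(1)] nz] lead_expo by metis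
qed

text \<open>
  The additive extension of \<open>top_coeff\<close> from monomials to all exponents, determined by its values at
  the \<open>Y i\<close> and at \<open>Z\<close>.
\<close>

definition lin :: "(nat \<Rightarrow>\<^sub>0 int) \<Rightarrow> 'k" where
  "lin u = (\<Sum>i\<in>UNIV. of_int (YC i u) * top_coeff (Poly_Mapping.single (Y i) 1))
     + of_int (ZC u) * top_coeff (Poly_Mapping.single Z 1)"

lemma lin_add: "lin (u + v) = lin u + lin v"
  by (simp add: lin_def sum.distrib algebra_simps)

lemma top_coeff_0: "top_coeff 0 = 0"
  by (simp add: top_coeff_def d_1)

lemma lin_expo_0: "lin (expo 0) = 0"
  by (simp add: lin_def ycoord_def zcoord_def)

text \<open>
  Both sides are additive in \<open>m\<close>, so generators suffice. The values at \<open>X1\<close> and \<open>X2\<close> follow because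
  \<open>X1 * Y^k1\<close> and \<open>Z^r\<close> have the same exponent, and so do \<open>X2 * Y^k2\<close> and \<open>X1^s\<close>.
\<close>

lemma top_coeff_eq_lin: "top_coeff m = lin (expo m)"
proof -
  have ZY: "top_coeff (Poly_Mapping.single v 1) = lin (expo (Poly_Mapping.single v 1))" if "v \<in> {Z} \<union> range Y" for v
  proof (cases v)
    case (Y i)
    have "(\<Sum>k\<in>UNIV. of_int (ycoord k (Poly_Mapping.single (Y i) 1)) * top_coeff (Poly_Mapping.single (Y k) 1))
       = (\<Sum>k\<in>UNIV. if k = i then top_coeff (Poly_Mapping.single (Y i) 1) else 0)"
      by (intro sum.cong refl) (auto simp: ycoord_def lookup_single when_def)
    then show ?thesis by (simp add: Y lin_def zcoord_def lookup_single)
  qed (use that in \<open>auto simp: lin_def zcoord_def ycoord_def lookup_single\<close>)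
  have on_ZY: "top_coeff m = lin (expo m)" if "Poly_Mapping.keys m \<subseteq> {Z} \<union> range Y" for m
    using that
  proof (induction m rule: monomial_induct)
    case (step m v)
    have "Poly_Mapping.keys m \<subseteq> {Z} \<union> range Y" "v \<in> {Z} \<union> range Y"
      using step(2) by (auto simp: in_keys_iff lookup_add lookup_single subset_iff)
    then show ?case using step.IH ZY by (simp add: top_coeff_add expo_add lin_add)
  qed (simp add: top_coeff_0 lin_expo_0)
  have ymon: "top_coeff (ymon k) = lin (expo (ymon k))" for k
  proof (rule on_ZY, rule subsetI)
    fix v assume "v \<in> Poly_Mapping.keys (ymon k)"
    then show "v \<in> {Z} \<union> range Y" by (cases v) (auto simp: in_keys_iff)
  qed
  have Zr: "top_coeff (Poly_Mapping.single Z r) = lin (expo (Poly_Mapping.single Z r))"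
    by (rule on_ZY) auto
  have trade: "top_coeff v = lin (expo v)"
    if expo: "expo (v + ymon k) = expo u" and u: "top_coeff u = lin (expo u)" for v u k
  proof -
    have "top_coeff v + top_coeff (ymon k) = top_coeff u"
      using top_coeff_cong[OF expo] by (simp only: top_coeff_add)
    moreover have "lin (expo v) + lin (expo (ymon k)) = lin (expo u)"
      using arg_cong[OF expo, of lin] by (simp only: expo_add lin_add)
    ultimately have "top_coeff v + lin (expo (ymon k)) = lin (expo v) + lin (expo (ymon k))"
      using ymon[of k] u by simp
    then show ?thesis by (rule add_right_imp_eq)
  qed
  have X1: "top_coeff (Poly_Mapping.single X1 1) = lin (expo (Poly_Mapping.single X1 1))"
    by (rule trade[OF _ Zr, of _ k1]) (simp add: expo_inject ycoord_def zcoord_def lookup_add lookup_single)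
  have X1n: "top_coeff (Poly_Mapping.single X1 n) = lin (expo (Poly_Mapping.single X1 n))" for n
  proof (induction n)
    case (Suc n)
    have "Poly_Mapping.single X1 (Suc n) = Poly_Mapping.single X1 n + (Poly_Mapping.single X1 1 :: 'm gen \<Rightarrow>\<^sub>0 nat)"
      by (simp flip: single_add)
    then show ?case using Suc X1 by (simp add: top_coeff_add expo_add lin_add)
  qed (simp add: top_coeff_0 lin_expo_0)
  have X2: "top_coeff (Poly_Mapping.single X2 1) = lin (expo (Poly_Mapping.single X2 1))"
    by (rule trade[OF _ X1n[of s], of _ k2]) (simp add: expo_inject ycoord_def zcoord_def lookup_add lookup_single algebra_simps)
  have gen: "top_coeff (Poly_Mapping.single v 1) = lin (expo (Poly_Mapping.single v 1))" for v
    using ZY[of v] X1 X2 by (cases v) auto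
  show ?thesis
  proof (induction m rule: monomial_induct)
    case (step m v)
    then show ?case using gen[of v] by (simp add: top_coeff_add expo_add lin_add)
  qed (simp add: top_coeff_0 lin_expo_0)
qed

text \<open>
  As long as \<open>lin\<close> does not vanish at the current point, \<open>d\<close> moves the leading exponent by exactly \<open>e\<close>.
  Local nilpotency allows this only finitely often, so the line from \<open>expo m\<close> in direction \<open>e\<close> meets
  the zero set of \<open>lin\<close>, and all points up to there are exponents of monomials.
\<close>

lemma line_terminates:
  "\<exists>n. lin (expo m) + of_nat n * lin e = 0 \<and>
     (\<forall>t\<le>n. \<exists>m'. (\<forall>k. ycoord k m' = ycoord k m + int t * YC k e) \<and> zcoord m' = zcoord m + int t * ZC e)"
proof -
  define good where "good t \<longleftrightarrow> (d ^^ t) (mv m) \<noteq> 0 \<and>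
     (\<exists>m'. lead_expo ((d ^^ t) (mv m)) = expo m' \<and> (\<forall>k. ycoord k m' = ycoord k m + int t * YC k e) \<and> zcoord m' = zcoord m + int t * ZC e
        \<and> lin (expo m') = lin (expo m) + of_nat t * lin e)" for t
  have good0: "good 0" by (auto simp: good_def mv_nonzero lead_expo_mv)
  have goodS: "good (Suc t)" if t: "good t" "lin (expo m) + of_nat t * lin e \<noteq> 0" for t
  proof -
    obtain m' where m': "lead_expo ((d ^^ t) (mv m)) = expo m'" "\<And>k. ycoord k m' = ycoord k m + int t * YC k e"
      "zcoord m' = zcoord m + int t * ZC e" "lin (expo m') = lin (expo m) + of_nat t * lin e"
      using t(1) by (auto simp: good_def)
    have "top_coeff m' \<noteq> 0" using t(2) m'(4) by (simp add: top_coeff_eq_lin)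
    from leading_step[OF S_funpow[OF S_mv] _ m'(1) this] t(1)
    have "d ((d ^^ t) (mv m)) \<noteq> 0" "lead_expo (d ((d ^^ t) (mv m))) = expo m' + e" "\<exists>m''. expo m'' = expo m' + e"
      by (auto simp: good_def)
    then obtain m'' where m'': "d ((d ^^ t) (mv m)) \<noteq> 0" "lead_expo (d ((d ^^ t) (mv m))) = expo m''" "expo m'' = expo m' + e"
      by metis
    have "ycoord k m'' = ycoord k m' + YC k e" for k using arg_cong[OF m''(3), of "YC k"] by simp
    moreover have "zcoord m'' = zcoord m' + ZC e" using arg_cong[OF m''(3), of ZC] by simp
    moreover have "lin (expo m'') = lin (expo m') + lin e" by (simp add: m''(3) lin_add)
    ultimately show ?thesis using m' m'' unfolding good_def by (auto simp: algebra_simps intro!: exI[of _ m''])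
  qed
  have ex: "\<exists>t. lin (expo m) + of_nat t * lin e = 0"
  proof (rule ccontr)
    assume "\<nexists>t. lin (expo m) + of_nat t * lin e = 0"
    then have "good t" for t by (induction t) (auto intro: good0 goodS)
    then show False using d_nilpotent[OF S_mv[of m]] by (auto simp: good_def)
  qed
  define n where "n = (LEAST t. lin (expo m) + of_nat t * lin e = 0)"
  have n: "lin (expo m) + of_nat n * lin e = 0"
    unfolding n_def using ex by (rule LeastI_ex)
  have "good t" if "t \<le> n" for t
    using that
  proof (induction t)
    case (Suc t)
    then have "lin (expo m) + of_nat t * lin e \<noteq> 0" using not_less_Least[of t "\<lambda>t. lin (expo m) + of_nat t * lin e = 0"] unfolding n_def by auto
    then show ?case using Suc by (intro goodS) auto
  qed (rule good0)
  then show ?thesis using n unfolding good_def by blast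
qed

text \<open>
  Normalised to \<open>lin e = - 1\<close>, the form \<open>lin\<close> takes natural numbers as values, and by
  \<open>no_facet_opposite_Y\<close> it vanishes on the \<open>Y i\<close>. So it is the degree in \<open>Z\<close>, and \<open>e\<close> has degree \<open>- 1\<close> in
  \<open>Z\<close>. After \<open>r\<close> steps from \<open>X1\<close> the degree in \<open>Z\<close> is zero; the exponent \<open>- k1 j + r * YC j e\<close> of \<open>Y j\<close> in
  this point of \<open>P\<close> is then nonnegative, hence \<open>e\<close> raises the exponent of \<open>Y j\<close>.
\<close>

lemma Z_lowers_weight:
  assumes v0: "top_coeff (Poly_Mapping.single v0 1) \<noteq> 0"
    and cases: "(s \<ge> 2 \<and> (\<forall>k. k2 k \<ge> 2)) \<or> (r \<ge> 2 \<and> (\<forall>k. k1 k \<ge> 2))"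
  shows "top_coeff (Poly_Mapping.single Z 1) \<noteq> 0" "Poly_Mapping.lookup e 0 \<le> -1" "1 + Poly_Mapping.lookup e 0 \<le> -1"
proof -
  have "\<forall>m. \<exists>n. lin (expo m) + of_nat n * lin e = 0 \<and>
     (\<forall>t\<le>n. \<exists>m'. (\<forall>k. ycoord k m' = ycoord k m + int t * YC k e) \<and> zcoord m' = zcoord m + int t * ZC e)"
    using line_terminates by blast
  from choice[OF this] obtain N where N: "\<And>m. lin (expo m) + of_nat (N m) * lin e = 0"
     "\<And>m t. t \<le> N m \<Longrightarrow> \<exists>m'. (\<forall>k. ycoord k m' = ycoord k m + int t * YC k e) \<and> zcoord m' = zcoord m + int t * ZC e"
    by blast
  have e0: "lin e \<noteq> 0"
    using N(1)[of "Poly_Mapping.single v0 1"] v0 by (auto simp: top_coeff_eq_lin)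
  define L where "L k = int (N (Poly_Mapping.single (Y k) 1))" for k
  define Lz where "Lz = int (N (Poly_Mapping.single Z 1))"
  have tc: "top_coeff m = - (of_int (int (N m)) * lin e)" for m
    using N(1)[of m] by (simp add: top_coeff_eq_lin eq_neg_iff_add_eq_0)
  have lin_ell: "lin u = - (of_int ((\<Sum>k\<in>UNIV. YC k u * L k) + ZC u * Lz) * lin e)" for u
  proof -
    have "lin u = (\<Sum>k\<in>UNIV. of_int (YC k u) * (- (of_int (L k) * lin e))) + of_int (ZC u) * (- (of_int Lz * lin e))"
      by (subst lin_def) (simp only: tc L_def Lz_def)
    then show ?thesis by (simp add: sum_negf sum_distrib_right algebra_simps)
  qed
  have ell_e: "(\<Sum>k\<in>UNIV. YC k e * L k) + ZC e * Lz = -1"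
  proof -
    have "x * (a + 1) = 0" if "x = - (a * x)" for x a :: 'k
      using that by (simp add: distrib_left mult.commute eq_neg_iff_add_eq_0 add.commute)
    from this[OF lin_ell[of e]]
    have "lin e * (of_int ((\<Sum>k\<in>UNIV. YC k e * L k) + ZC e * Lz) + 1) = 0" .
    then have "of_int ((\<Sum>k\<in>UNIV. YC k e * L k) + ZC e * Lz + 1) = (0::'k)" using e0 by simp
    then have "(\<Sum>k\<in>UNIV. YC k e * L k) + ZC e * Lz + 1 = 0" by (simp only: of_int_eq_0_iff)
    then show ?thesis by simp
  qed
  have ell_m: "(\<Sum>k\<in>UNIV. ycoord k m * L k) + zcoord m * Lz = int (N m)" for m
  proof -
    have "of_int ((\<Sum>k\<in>UNIV. ycoord k m * L k) + zcoord m * Lz) * lin e = of_int (int (N m)) * lin e"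
      using lin_ell[of "expo m"] tc[of m] by (simp only: top_coeff_eq_lin YC_expo ZC_expo neg_equal_iff_equal)
    then have "of_int ((\<Sum>k\<in>UNIV. ycoord k m * L k) + zcoord m * Lz) = (of_int (int (N m)) :: 'k)"
      using mult_right_cancel[OF e0] by blast
    then show ?thesis by (simp only: of_int_eq_iff)
  qed
  have L0: "L i = 0" for i
  proof (rule no_facet_opposite_Y[OF _ ell_e _ _ cases])
    show "L k \<ge> 0" for k by (simp add: L_def)
  next
    fix m show "0 \<le> (\<Sum>k\<in>UNIV. ycoord k m * L k) + zcoord m * Lz" by (simp add: ell_m)
  next
    fix m t assume "int t \<le> (\<Sum>k\<in>UNIV. ycoord k m * L k) + zcoord m * Lz"
    then have "t \<le> N m" by (simp add: ell_m)
    then show "\<exists>m'. (\<forall>k. ycoord k m' = ycoord k m + int t * YC k e) \<and> zcoord m' = zcoord m + int t * ZC e"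
      by (rule N(2))
  qed
  \<comment> \<open>The only solution in integers with \<open>Lz\<close> nonnegative is \<open>Lz = 1\<close> and \<open>ZC e = - 1\<close>.\<close>
  have ZL: "ZC e * Lz = -1" using ell_e by (simp add: L0)
  have "Lz \<ge> 0" by (simp add: Lz_def)
  have "Lz dvd 1" using ZL by (metis dvd_minus_iff dvd_triv_right)
  with \<open>Lz \<ge> 0\<close> have Lz: "Lz = 1" by simp
  with ZL have Ze: "ZC e = -1" by simp
  show "top_coeff (Poly_Mapping.single Z 1) \<noteq> 0"
    using e0 Lz unfolding tc by (simp add: Lz_def)
  have "N (Poly_Mapping.single X1 1) = r"
    using ell_m[of "Poly_Mapping.single X1 1"] by (simp add: L0 Lz zcoord_def lookup_single)
  then obtain m' where m': "ycoord j m' = - int (k1 j) + int r * YC j e" "zcoord m' = 0"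
    using N(2)[of r "Poly_Mapping.single X1 1"] by (auto simp: Ze zcoord_def ycoord_def lookup_single)
  have "Poly_Mapping.lookup m' X1 = 0" "Poly_Mapping.lookup m' X2 = 0"
  proof -
    have "int (Poly_Mapping.lookup m' Z) + int r * int (Poly_Mapping.lookup m' X1) + int r * int s * int (Poly_Mapping.lookup m' X2) = 0"
      using m'(2) by (simp add: zcoord_def)
    moreover have "0 \<le> int r * int (Poly_Mapping.lookup m' X1)" "0 \<le> int r * int s * int (Poly_Mapping.lookup m' X2)" by simp_all
    ultimately have "int r * int (Poly_Mapping.lookup m' X1) = 0" "int r * int s * int (Poly_Mapping.lookup m' X2) = 0" by linarith+
    then show "Poly_Mapping.lookup m' X1 = 0" "Poly_Mapping.lookup m' X2 = 0" using r_pos s_pos by simp_all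
  qed
  then have "0 \<le> ycoord j m'" by (simp add: ycoord_def)
  then have "0 < int r * YC j e" using m'(1) k1_pos[of j] by linarith
  then have "YC j e \<ge> 1" by (simp add: zero_less_mult_iff)
  then have "M * 1 \<le> M * YC j e" using M_pos by (intro mult_left_mono) auto
  moreover have "Poly_Mapping.lookup e 0 = -1 - M * YC j e" using Ze by (simp add: ZC_def)
  ultimately show "Poly_Mapping.lookup e 0 \<le> -1" "1 + Poly_Mapping.lookup e 0 \<le> -1" using M_pos by linarith+
qed

lemma d_weight_le: "b \<in> S \<Longrightarrow> b \<in> weight_le w \<Longrightarrow> Poly_Mapping.lookup e 0 \<le> 0 \<Longrightarrow> d b \<in> weight_le (w + Poly_Mapping.lookup e 0)"
proof -
  assume b: "b \<in> S" "b \<in> weight_le w" "Poly_Mapping.lookup e 0 \<le> 0"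
  show ?thesis
  proof (cases "b = 0")
    case False
    have "Poly_Mapping.lookup (lead_expo b) 0 \<le> w" using lead_expo_in[OF False] b(2) by (simp add: weight_le_def)
    moreover have "d b \<in> below (lead_expo b + e)" by (rule d_below[OF b(1) below_lead_expo])
    ultimately show ?thesis using lex_le_first[of _ "lead_expo b + e"]
      by (fastforce simp: below_def weight_le_def lookup_add)
  qed (simp add: d_0 weight_le_0)
qed

end

text \<open>
  Of the variables only \<open>Y j\<close> has negative weight, so it divides every monomial of a representation
  whose exponents do not exceed the leading exponent of \<open>b\<close>.
\<close>

lemma negative_weight_divisible:
  assumes "b \<in> S" "b \<in> weight_le (-1)"
  shows "\<exists>g\<in>S. b = img (Y j) * g"
proof (cases "b = 0")
  case True
  then show ?thesis using S_0 by auto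
next
  case False
  obtain p where p: "b = \<phi> p" "\<And>m. m \<in> Poly_Mapping.keys p \<Longrightarrow> expo m \<le> lead_expo b"
    using representation[OF assms(1) False] by blast
  have lead_expo: "Poly_Mapping.lookup (lead_expo b) 0 \<le> -1" using lead_expo_in[OF False] assms(2) by (simp add: weight_le_def)
  let ?y = "Poly_Mapping.single (Y j) (1::nat)"
  have m: "m = ?y + (m - ?y)" if "m \<in> Poly_Mapping.keys p" for m
  proof -
    have "weight m \<le> -1" using lex_le_first[OF p(2)[OF that]] lead_expo by linarith
    moreover have "0 \<le> (int r + M * int (k1 j)) * int (Poly_Mapping.lookup m X1)"
       "0 \<le> (int s * (int r + M * int (k1 j)) + M * int (k2 j)) * int (Poly_Mapping.lookup m X2)"
      using M_pos by simp_all
    ultimately have "0 < M * int (Poly_Mapping.lookup m (Y j))" unfolding weight_expand by linarith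
    then have "0 < Poly_Mapping.lookup m (Y j)" using M_pos by (simp add: zero_less_mult_iff)
    then show ?thesis by (intro poly_mapping_eqI) (auto simp: lookup_add lookup_minus lookup_single when_def)
  qed
  define q where "q = (\<Sum>m\<in>Poly_Mapping.keys p. Poly_Mapping.single (m - ?y) (Poly_Mapping.lookup p m))"
  have "Var (Y j) * q = (\<Sum>m\<in>Poly_Mapping.keys p. Poly_Mapping.single (?y + (m - ?y)) (Poly_Mapping.lookup p m))"
    by (simp add: q_def sum_distrib_left Var_def mult_single)
  also have "\<dots> = (\<Sum>m\<in>Poly_Mapping.keys p. Poly_Mapping.single m (Poly_Mapping.lookup p m))"
    by (rule sum.cong[OF refl]) (simp only: m[symmetric])
  also have "\<dots> = p" by (rule sum_of_monomials[symmetric])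
  finally have "b = img (Y j) * \<phi> q" using p(1) by (metis phi.eval_mult phi.eval_Var)
  then show ?thesis by blast
qed

text \<open>
  All iterated derivatives of \<open>Z\<close> have negative weight, in particular the last nonzero one. It lies in
  the kernel and is a multiple of \<open>Y j\<close>.
\<close>

lemma d_kills_Y:
  assumes cases: "(s \<ge> 2 \<and> (\<forall>k. k2 k \<ge> 2)) \<or> (r \<ge> 2 \<and> (\<forall>k. k1 k \<ge> 2))"
  shows "d (img (Y j)) = 0"
proof (cases "\<forall>v. d (img v) = 0")
  case False
  define G where "G = {v. d (img v) \<noteq> 0}"
  \<comment> \<open>The shift \<open>e\<close> is the largest one among the generators that \<open>d\<close> does not kill.\<close>
  define sh where "sh v = lead_expo (d (img v)) - expo (Poly_Mapping.single v 1)" for v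
  define e where "e = Max (sh ` G)"
  have "G \<noteq> {}" using False by (auto simp: G_def)
  then have "e \<in> sh ` G" unfolding e_def by (intro Max_in) auto
  then obtain v0 where v0: "v0 \<in> G" "e = sh v0" by blast
  have gen: "d (img v) \<in> below (expo (Poly_Mapping.single v 1) + e)" for v
  proof (cases "v \<in> G")
    case True
    then have "sh v \<le> e" unfolding e_def by (intro Max_ge) auto
    then have "lead_expo (d (img v)) \<le> expo (Poly_Mapping.single v 1) + e" by (simp add: sh_def algebra_simps)
    then show ?thesis using below_mono[OF below_lead_expo] by blast
  qed (simp add: G_def below_0)
  have "expo (Poly_Mapping.single v0 1) + e = lead_expo (d (img v0))" by (simp add: v0(2) sh_def)
  then have "top_coeff e (Poly_Mapping.single v0 1) \<noteq> 0"
    using lead_expo_in[of "d (img v0)"] v0(1) by (simp add: top_coeff_def[OF gen] G_def in_keys_iff)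
  note w = Z_lowers_weight[OF gen this cases]
  have dZ: "d (img Z) \<noteq> 0" using w(1) by (auto simp: top_coeff_def[OF gen])
  have up: "(d ^^ n) (d (img Z)) \<in> weight_le (-1)" for n
  proof (induction n)
    case 0
    have "img Z \<in> weight_le 1" by (simp add: img_simps weight_le_single)
    from d_weight_le[OF gen S_img this] w show ?case by (auto intro: weight_le_mono)
  next
    case (Suc n)
    from d_weight_le[OF gen S_funpow[OF d_closed[OF S_img]] Suc] w show ?case by (auto intro: weight_le_mono)
  qed
  obtain n where n: "(d ^^ n) (d (img Z)) \<noteq> 0" "(d ^^ Suc n) (d (img Z)) = 0"
    using last_nonzero[OF d_closed[OF S_img] dZ] .
  obtain g where g: "g \<in> S" "(d ^^ n) (d (img Z)) = img (Y j) * g"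
    using negative_weight_divisible[OF S_funpow[OF d_closed[OF S_img]] up] by blast
  then show ?thesis using n by (intro factorially_closed[OF S_img g(1)]) auto
qed simp

end

section \<open>A derivation with kernel generated by the \<open>Y i\<close>\<close>

context weighted_danielewski
begin

text \<open>
  The derivation \<open>Z * d/dZ\<close>.
\<close>

definition euler :: "'k laurent \<Rightarrow> 'k laurent" where
  "euler x = Poly_Mapping.mapp (\<lambda>u a. of_int (ZC u) * a) x"

lemma lookup_euler: "Poly_Mapping.lookup (euler x) u = of_int (ZC u) * Poly_Mapping.lookup x u"
  by (simp add: euler_def lookup_mapp when_def in_keys_iff)

lemma euler_add: "euler (x + y) = euler x + euler y"
  by (rule poly_mapping_eqI) (simp add: lookup_euler lookup_add distrib_left)

lemma euler_0: "euler 0 = 0"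
  by (rule poly_mapping_eqI) (simp add: lookup_euler)

lemma euler_single: "euler (Poly_Mapping.single u a) = Poly_Mapping.single u (of_int (ZC u) * a)"
  by (rule poly_mapping_eqI) (simp add: lookup_euler lookup_single when_def)

lemma euler_sum: "euler (\<Sum>i\<in>T. x i) = (\<Sum>i\<in>T. euler (x i))"
  by (induction T rule: infinite_finite_induct) (simp_all add: euler_0 euler_add)

lemma euler_mult: "euler (x * y) = euler x * y + x * euler y"
proof -
  define xs where "xs a = Poly_Mapping.single a (Poly_Mapping.lookup x a)" for a
  define ys where "ys b = Poly_Mapping.single b (Poly_Mapping.lookup y b)" for b
  have x: "x = (\<Sum>a\<in>Poly_Mapping.keys x. xs a)" and y: "y = (\<Sum>b\<in>Poly_Mapping.keys y. ys b)"
    unfolding xs_def ys_def by (rule sum_of_monomials)+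
  have single: "euler (xs a * ys b) = euler (xs a) * ys b + xs a * euler (ys b)" for a b
    by (simp add: xs_def ys_def mult_single euler_single algebra_simps flip: single_add)
  have "euler (x * y) = euler ((\<Sum>a\<in>Poly_Mapping.keys x. xs a) * (\<Sum>b\<in>Poly_Mapping.keys y. ys b))"
    by (simp only: x[symmetric] y[symmetric])
  also have "\<dots> = (\<Sum>a\<in>Poly_Mapping.keys x. euler (xs a)) * (\<Sum>b\<in>Poly_Mapping.keys y. ys b)
     + (\<Sum>a\<in>Poly_Mapping.keys x. xs a) * (\<Sum>b\<in>Poly_Mapping.keys y. euler (ys b))"
    by (simp only: sum_product euler_sum single sum.distrib)
  also have "\<dots> = euler x * y + x * euler y"
    by (simp only: euler_sum[symmetric] x[symmetric] y[symmetric])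
  finally show ?thesis .
qed

text \<open>
  Multiplying \<open>euler\<close> by \<open>Y^(k1 + k2) / Z\<close> gives \<open>Y^(k1 + k2) * d/dZ\<close>. The factor \<open>Y^k1\<close> is used up by the
  denominator of \<open>x1\<close>, and \<open>Y^k2\<close> by that of \<open>x2\<close>.
\<close>

definition D_exp :: "nat \<Rightarrow>\<^sub>0 int" where
  "D_exp = vec (\<lambda>i. int (k1 i) + int (k2 i)) (-1)"

definition D :: "'k laurent \<Rightarrow> 'k laurent" where
  "D x = \<chi> D_exp * euler x"

lemma D_add: "D (x + y) = D x + D y"
  by (simp add: D_def euler_add distrib_left)

lemma D_mult: "D (x * y) = D x * y + x * D y"
  by (simp add: D_def euler_mult algebra_simps)

lemma ZC_0: "ZC 0 = 0"
  by (simp add: ZC_def YC_def)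

lemma D_scalar: "D (Poly_Mapping.single 0 c) = 0"
  by (simp add: D_def euler_single ZC_0)

lemma D_Z_free: "D (\<chi> (vec a 0)) = 0"
  by (simp add: D_def euler_single)

lemma D_img_Y: "D (img (Y i)) = 0"
  unfolding img_simps by (rule D_Z_free)

lemma D_img_Z: "D (img Z) = \<chi> (vec (\<lambda>i. int (k1 i)) 0) * \<chi> (vec (\<lambda>i. int (k2 i)) 0)"
  by (simp add: img_simps D_def euler_single D_exp_def mult_single vec_add)

lemma y_monomial_in_range: "\<chi> (vec (\<lambda>i. int (k i)) 0) \<in> S"
proof -
  have "\<phi> (\<Prod>i\<in>UNIV. Var (Y i) ^ k i) \<in> S" by (rule rangeI)
  then show ?thesis by (simp only: phi_prod_Y)
qed

lemma chi_nonzero: "\<chi> u \<noteq> (0 :: 'k laurent)"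
proof
  assume "\<chi> u = (0 :: 'k laurent)"
  then have "Poly_Mapping.lookup (\<chi> u :: 'k laurent) u = 0" by simp
  then show False by simp
qed

text \<open>
  The elements that \<open>D\<close> sends to multiples of \<open>t\<close> form a ring, by the Leibniz rule.
\<close>

lemma D_phi_divisible:
  assumes "p \<in> polys_in V" and t: "\<And>v. v \<in> V \<Longrightarrow> \<exists>h\<in>S. D (img v) = t * h"
  shows "\<exists>h\<in>S. D (\<phi> p) = t * h"
  using assms(1)
proof (induction p rule: mpoly_induct)
  case (Const a)
  show ?case using S_0 by (intro bexI[of _ 0]) (simp_all add: D_scalar)
next
  case (Var v)
  then show ?case using t by simp
next
  case (add p q)
  then obtain g h where "g \<in> S" "h \<in> S" "D (\<phi> p) = t * g" "D (\<phi> q) = t * h" by blast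
  then show ?case by (intro bexI[of _ "g + h"]) (simp_all add: phi.eval_add D_add distrib_left S_add)
next
  case (mult p q)
  then obtain g h where "g \<in> S" "h \<in> S" "D (\<phi> p) = t * g" "D (\<phi> q) = t * h" by blast
  then show ?case
    by (intro bexI[of _ "g * \<phi> q + \<phi> p * h"])
       (auto simp: phi.eval_mult D_mult algebra_simps intro!: S_add S_mult)
qed

text \<open>
  By divisibility, \<open>D\<close> maps \<open>K[Y, Z]\<close> to multiples of \<open>Y^k1 * Y^k2\<close>. As \<open>D\<close> kills the \<open>Y i\<close>, applying it to
  \<open>f1 = Y^k1 * x1\<close> and cancelling \<open>Y^k1\<close> shows that \<open>D x1\<close> is a multiple of \<open>Y^k2\<close>. The same argument for
  \<open>f2 = Y^k2 * x2\<close> gives \<open>D x2\<close>.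
\<close>

lemma D_closed: "D (\<phi> p) \<in> S"
proof -
  let ?y1 = "\<chi> (vec (\<lambda>i. int (k1 i)) 0) :: 'k laurent" and ?y2 = "\<chi> (vec (\<lambda>i. int (k2 i)) 0) :: 'k laurent"
  have nz: "?y1 \<noteq> 0" "?y2 \<noteq> 0" by (rule chi_nonzero)+
  have "\<exists>h\<in>S. D (\<phi> f1) = (?y1 * ?y2) * h"
  proof (rule D_phi_divisible[OF f1_vars])
    fix v :: "'m gen" assume "v \<in> {Z} \<union> range Y"
    then show "\<exists>h\<in>S. D (img v) = (?y1 * ?y2) * h"
      using S_0 S_1 by (cases v) (auto simp: D_img_Y D_img_Z intro: bexI[of _ 0] bexI[of _ 1])
  qed
  then obtain h where h: "h \<in> S" "D (\<phi> f1) = (?y1 * ?y2) * h" by blast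
  have "D (\<phi> f1) = ?y1 * D (img X1)"
    unfolding phi_f1 D_mult D_Z_free by (simp add: img_simps)
  then have "?y1 * D (img X1) = ?y1 * (?y2 * h)" using h(2) by (simp only: mult.assoc)
  then have X1: "D (img X1) = ?y2 * h" using mult_left_cancel[OF nz(1)] by blast
  have "\<exists>h\<in>S. D (\<phi> f2) = ?y2 * h"
  proof (rule D_phi_divisible[OF f2_vars])
    fix v :: "'m gen" assume v: "v \<in> {Z} \<union> range Y \<union> {X1}"
    show "\<exists>h\<in>S. D (img v) = ?y2 * h"
    proof (cases v)
      case Z
      then show ?thesis using y_monomial_in_range[of k1] by (intro bexI[of _ ?y1]) (simp_all add: D_img_Z mult.commute)
    next
      case (Y i)
      then show ?thesis using S_0 by (intro bexI[of _ 0]) (simp_all add: D_img_Y)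
    next
      case X1
      then show ?thesis using h(1) \<open>D (img X1) = ?y2 * h\<close> by auto
    qed (use v in auto)
  qed
  then obtain g where g: "g \<in> S" "D (\<phi> f2) = ?y2 * g" by blast
  have "D (\<phi> f2) = ?y2 * D (img X2)"
    unfolding phi_f2 D_mult D_Z_free by (simp add: img_simps)
  then have "?y2 * D (img X2) = ?y2 * g" using g(2) by (simp only:)
  then have X2: "D (img X2) = g" using mult_left_cancel[OF nz(2)] by blast
  have "\<exists>h\<in>S. D (\<phi> p) = 1 * h"
  proof (rule D_phi_divisible[of p UNIV])
    fix v :: "'m gen"
    have "D (img v) \<in> S"
      using S_0 X1 X2 h(1) g(1) y_monomial_in_range
      by (cases v) (auto simp: D_img_Y D_img_Z intro!: S_mult)
    then show "\<exists>h\<in>S. D (img v) = 1 * h" by simp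
  qed simp
  then show ?thesis by auto
qed

lemma keys_euler: "Poly_Mapping.keys (euler x) = {u \<in> Poly_Mapping.keys x. ZC u \<noteq> 0}"
  by (auto simp: in_keys_iff lookup_euler)

lemma D_power_vanishes:
  assumes "\<And>u. u \<in> Poly_Mapping.keys x \<Longrightarrow> 0 \<le> ZC u \<and> ZC u < int n"
  shows "(D ^^ n) x = 0"
  using assms
proof (induction n arbitrary: x)
  case 0
  then have "Poly_Mapping.keys x = {}" by fastforce
  then show ?case by simp
next
  case (Suc n)
  have "(D ^^ n) (D x) = 0"
  proof (rule Suc.IH)
    fix u assume "u \<in> Poly_Mapping.keys (D x)"
    then obtain v where "v \<in> Poly_Mapping.keys (euler x)" "u = D_exp + v"
      using Poly_Mapping.keys_mult[of "\<chi> D_exp" "euler x"] unfolding D_def by auto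
    then show "0 \<le> ZC u \<and> ZC u < int n"
      using Suc.prems[of v] by (auto simp: keys_euler D_exp_def)
  qed
  then show ?case by (simp only: funpow_Suc_right o_def)
qed

lemma ZC_nonneg: "u \<in> Poly_Mapping.keys (\<phi> p) \<Longrightarrow> 0 \<le> ZC u"
proof -
  define N where "N = {x :: 'k laurent. \<forall>u\<in>Poly_Mapping.keys x. 0 \<le> ZC u}"
  have mult: "x * y \<in> N" if "x \<in> N" "y \<in> N" for x y
    using Poly_Mapping.keys_mult[of x y] that unfolding N_def by fastforce
  have closed: "\<phi> p \<in> N" if "p \<in> polys_in V" "\<And>v. v \<in> V \<Longrightarrow> img v \<in> N" for p V
    using that(1)
  proof (induction p rule: mpoly_induct)
    case (Const a)
    then show ?case by (auto simp: N_def ZC_0)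
  next
    case (Var v)
    then show ?case using that(2) by simp
  next
    case (add p q)
    then show ?case using Poly_Mapping.keys_add[of "\<phi> p" "\<phi> q"] by (auto simp: N_def phi.eval_add)
  next
    case (mult p q)
    then show ?case by (simp add: phi.eval_mult \<open>\<And>y x. x \<in> N \<Longrightarrow> y \<in> N \<Longrightarrow> x * y \<in> N\<close>)
  qed
  have ZY: "img v \<in> N" if "v \<in> {Z} \<union> range Y" for v
    using that by (auto simp: img_simps N_def)
  have vec: "\<chi> (vec a 0) \<in> N" for a by (simp add: N_def)
  have X1: "img X1 \<in> N"
    unfolding img_simps x1_eq by (rule mult[OF vec closed[OF f1_vars ZY]])
  then have ZYX1: "img v \<in> N" if "v \<in> {Z} \<union> range Y \<union> {X1}" for v
    using that ZY by auto
  have X2: "img X2 \<in> N"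
    unfolding img_simps x2_eq by (rule mult[OF vec closed[OF f2_vars ZYX1]])
  have "img v \<in> N" for v using ZYX1 X2 by (cases v) auto
  then have "\<phi> p \<in> N" using closed[of p UNIV] by simp
  then show "u \<in> Poly_Mapping.keys (\<phi> p) \<Longrightarrow> 0 \<le> ZC u" by (simp add: N_def)
qed

lemma D_nilpotent: "\<exists>N. (D ^^ N) (\<phi> p) = 0"
proof -
  define n where "n = Suc (nat (Max (insert 0 (ZC ` Poly_Mapping.keys (\<phi> p)))))"
  have "ZC u < int n" if "u \<in> Poly_Mapping.keys (\<phi> p)" for u
  proof -
    have "ZC u \<le> Max (insert 0 (ZC ` Poly_Mapping.keys (\<phi> p)))" using that by (intro Max_ge) auto
    then show ?thesis by (simp add: n_def)
  qed
  then have "(D ^^ n) (\<phi> p) = 0" using ZC_nonneg by (intro D_power_vanishes) blast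
  then show ?thesis ..
qed

text \<open>
  The leading exponent is the exponent of a monomial in the generators, and the degree in \<open>Z\<close> of that
  exponent vanishes only for monomials in the \<open>Y i\<close>. Subtracting this monomial removes one term.
\<close>

lemma Z_free_in_image:
  assumes "x \<in> S" "\<And>u. u \<in> Poly_Mapping.keys x \<Longrightarrow> ZC u = 0"
  shows "\<exists>p\<in>polys_in (range Y). x = \<phi> p"
  using assms
proof (induction "card (Poly_Mapping.keys x)" arbitrary: x rule: less_induct)
  case less
  show ?case
  proof (cases "x = 0")
    case True
    have "Const 0 \<in> polys_in (range Y)" by (rule polys_in_Const)
    then show ?thesis using True by (intro bexI[of _ "Const 0"]) (simp_all only: phi.eval_Const single_zero)
  next
    case False
    obtain m where m: "expo m = lead_expo x" using representation[OF less.prems(1) False] by metis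
    have "ZC (expo m) = 0" using less.prems(2) lead_expo_in[OF False] m by simp
    then have z: "zcoord m = 0" by simp
    have "0 \<le> int r * int (Poly_Mapping.lookup m X1)" "0 \<le> int r * int s * int (Poly_Mapping.lookup m X2)" by simp_all
    with z have "int (Poly_Mapping.lookup m Z) = 0" "int r * int (Poly_Mapping.lookup m X1) = 0"
        "int r * int s * int (Poly_Mapping.lookup m X2) = 0"
      unfolding zcoord_def by linarith+
    then have exps: "Poly_Mapping.lookup m Z = 0" "Poly_Mapping.lookup m X1 = 0" "Poly_Mapping.lookup m X2 = 0"
      using r_pos s_pos by simp_all
    have mY: "Poly_Mapping.keys m \<subseteq> range Y"
    proof
      fix v assume "v \<in> Poly_Mapping.keys m"
      then show "v \<in> range Y" using exps by (cases v) (auto simp: in_keys_iff)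
    qed
    then have mv: "mv m = \<chi> (lead_expo x)" using mv_ZY[of m] m by auto
    let ?a = "Poly_Mapping.lookup x (lead_expo x)"
    let ?q = "Poly_Mapping.single m ?a"
    have q: "\<phi> ?q = Poly_Mapping.single (lead_expo x) ?a" by (simp add: mv mult_single)
    have qY: "?q \<in> polys_in (range Y)" using mY by (simp add: polys_in_def)
    have "Poly_Mapping.lookup (x - \<phi> ?q) u = (if u = lead_expo x then 0 else Poly_Mapping.lookup x u)" for u
      unfolding q by (simp add: lookup_minus lookup_single when_def)
    then have keys: "Poly_Mapping.keys (x - \<phi> ?q) = Poly_Mapping.keys x - {lead_expo x}"
      by (auto simp: in_keys_iff split: if_splits)
    have "card (Poly_Mapping.keys (x - \<phi> ?q)) < card (Poly_Mapping.keys x)"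
      unfolding keys by (rule card_Diff1_less) (simp_all add: lead_expo_in[OF False])
    moreover have "x - \<phi> ?q \<in> S" using less.prems(1) by (rule S_diff) (rule rangeI)
    moreover have "ZC u = 0" if "u \<in> Poly_Mapping.keys (x - \<phi> ?q)" for u
      using that less.prems(2) keys by simp
    ultimately obtain p where p: "p \<in> polys_in (range Y)" "x - \<phi> ?q = \<phi> p"
      using less.hyps by blast
    have "x = \<phi> (p + ?q)" using p(2) by (simp only: phi.eval_add diff_eq_eq)
    then show ?thesis using polys_in_add[OF p(1) qY] by blast
  qed
qed

lemma kernel_D: assumes "D (\<phi> p) = 0" shows "\<exists>q\<in>polys_in (range Y). \<phi> p = \<phi> q"
proof (rule Z_free_in_image)
  have "euler (\<phi> p) = 0" using assms chi_nonzero unfolding D_def mult_eq_0_iff by blast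
  then have "Poly_Mapping.keys (euler (\<phi> p)) = {}" by simp
  then show "ZC u = 0" if "u \<in> Poly_Mapping.keys (\<phi> p)" for u using that unfolding keys_euler by blast
qed simp

section \<open>Transfer to the quotient algebra\<close>

abbreviation "B \<equiv> B_alg k1 k2 f1 f2"
abbreviation "cl \<equiv> B_class k1 k2 f1 f2"

lemma A_ring_simps:
  "carrier (A_ring :: ('m gen, 'k) mpoly ring) = UNIV"
  "monoid.mult (A_ring :: ('m gen, 'k) mpoly ring) = (*)"
  "one (A_ring :: ('m gen, 'k) mpoly ring) = 1"
  "ring.zero (A_ring :: ('m gen, 'k) mpoly ring) = 0"
  "add (A_ring :: ('m gen, 'k) mpoly ring) = (+)"
  by (simp_all add: ring_of_type_algebra_def fun_eq_iff)

lemma rel_ideal_eq_I: "rel_ideal k1 k2 f1 f2 = I"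
proof
  interpret A: cring "A_ring :: ('m gen, 'k) mpoly ring" by (rule cring_from_type_algebra)
  interpret J: ideal "rel_ideal k1 k2 f1 f2" "A_ring :: ('m gen, 'k) mpoly ring" by (rule ideal_rel_ideal)
  have gens: "{R1, R2} \<subseteq> rel_ideal k1 k2 f1 f2"
    unfolding rel_ideal_def by (rule A.genideal_self) (simp add: A_ring_simps)
  show "I \<subseteq> rel_ideal k1 k2 f1 f2"
  proof
    fix p assume "p \<in> I"
    then obtain a b where p: "p = a * R1 + b * R2" unfolding I_def by blast
    have "a * R1 \<in> rel_ideal k1 k2 f1 f2" "b * R2 \<in> rel_ideal k1 k2 f1 f2"
      using J.I_l_closed[of R1 a] J.I_l_closed[of R2 b] gens by (simp_all add: A_ring_simps)
    then show "p \<in> rel_ideal k1 k2 f1 f2"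
      using J.a_closed[of "a * R1" "b * R2"] by (simp add: A_ring_simps p)
  qed
  have "ideal I (A_ring :: ('m gen, 'k) mpoly ring)"
  proof (rule idealI)
    show "subgroup I (add_monoid (A_ring :: ('m gen, 'k) mpoly ring))"
    proof (rule A.add.subgroupI)
      fix p assume p: "p \<in> I"
      have "- p \<in> I" using I_mult[OF p, of "-1"] by simp
      moreover have "\<ominus>\<^bsub>A_ring\<^esub> p = - p"
        by (rule A.minus_equality) (simp_all add: A_ring_simps)
      ultimately show "\<ominus>\<^bsub>A_ring\<^esub> p \<in> I" by simp
    qed (use I_0 I_add in \<open>auto simp: A_ring_simps\<close>)
  qed (use I_mult A.ring_axioms in \<open>auto simp: A_ring_simps mult.commute\<close>)
  then show "rel_ideal k1 k2 f1 f2 \<subseteq> I"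
    unfolding rel_ideal_def by (rule A.genideal_minimal) (simp add: R1_in_I R2_in_I)
qed

lemma cl_eq: "cl p = {h + p | h. h \<in> I}"
  by (auto simp: B_class_def rel_ideal_eq_I a_r_coset_def r_coset_def A_ring_simps)

lemma cl_eq_iff: "cl p = cl q \<longleftrightarrow> \<phi> p = \<phi> q"
proof -
  have "\<phi> p = \<phi> q \<longleftrightarrow> p - q \<in> I" by (simp flip: kernel_phi add: phi.eval_diff)
  moreover have "cl p = cl q \<longleftrightarrow> p - q \<in> I"
  proof
    assume "cl p = cl q"
    moreover have "p \<in> cl p" unfolding cl_eq using I_0 by force
    ultimately obtain h where "p = h + q" "h \<in> I" unfolding cl_eq by blast
    then show "p - q \<in> I" by simp
  next
    assume pq: "p - q \<in> I"
    have "cl a \<subseteq> cl b" if "a - b \<in> I" for a b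
    proof
      fix x assume "x \<in> cl a"
      then obtain h where "x = h + a" "h \<in> I" unfolding cl_eq by blast
      then have "x = (h + (a - b)) + b" "h + (a - b) \<in> I" using that I_add by auto
      then show "x \<in> cl b" unfolding cl_eq by blast
    qed
    moreover have "q - p \<in> I" using I_diff[OF I_0 pq] by simp
    ultimately show "cl p = cl q" using pq by blast
  qed
  ultimately show ?thesis by simp
qed

lemma cl_hom: "B_class k1 k2 f1 f2 \<in> ring_hom A_ring (A_ring Quot rel_ideal k1 k2 f1 f2)"
proof -
  have "B_class k1 k2 f1 f2 = (+>\<^bsub>A_ring\<^esub>) (rel_ideal k1 k2 f1 f2)"
    by (rule ext) (simp add: B_class_def)
  then show ?thesis using ideal.rcos_ring_hom[OF ideal_rel_ideal[of k1 k2 f1 f2]] by simp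
qed

lemma B_carrier: "carrier B = range cl"
  by (auto simp: B_alg_simps FactRing_def A_RCOSETS_def' B_class_def A_ring_simps)

lemma B_add: "cl p \<oplus>\<^bsub>B\<^esub> cl q = cl (p + q)"
  using ring_hom_add[OF cl_hom, of p q] by (simp add: B_alg_simps A_ring_simps)

lemma B_mult: "cl p \<otimes>\<^bsub>B\<^esub> cl q = cl (p * q)"
  using ring_hom_mult[OF cl_hom, of p q] by (simp add: B_alg_simps A_ring_simps)

lemma B_one: "\<one>\<^bsub>B\<^esub> = cl 1"
  using ring_hom_one[OF cl_hom] by (simp add: B_alg_simps A_ring_simps)

lemma B_zero: "\<zero>\<^bsub>B\<^esub> = cl 0"
  by (auto simp: B_alg_simps FactRing_def rel_ideal_eq_I cl_eq)

lemma B_smult: "c \<odot>\<^bsub>B\<^esub> cl p = cl (Const c * p)"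
  using B_mult[of "Const c" p] by (simp add: B_alg_simps)

text \<open>
  Mutually inverse bijections between the carrier of \<open>B\<close> and \<open>S\<close>, through arbitrary representatives.
\<close>

definition to_image :: "('m gen, 'k) mpoly set \<Rightarrow> 'k laurent" where
  "to_image C = \<phi> (SOME p. cl p = C)"

definition of_image :: "'k laurent \<Rightarrow> ('m gen, 'k) mpoly set" where
  "of_image x = cl (SOME p. \<phi> p = x)"

lemma to_image_cl [simp]: "to_image (cl p) = \<phi> p"
proof -
  have "cl (SOME q. cl q = cl p) = cl p" by (rule someI[of _ p]) (rule refl)
  then show ?thesis unfolding to_image_def cl_eq_iff .
qed

lemma of_image_phi [simp]: "of_image (\<phi> p) = cl p"
proof -
  have "\<phi> (SOME q. \<phi> q = \<phi> p) = \<phi> p" by (rule someI[of _ p]) (rule refl)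
  then show ?thesis unfolding of_image_def cl_eq_iff .
qed

lemma derivationD:
  assumes "\<delta> \<in> derivations (K_ring :: 'k ring) B"
  shows "\<delta> (cl p) \<in> carrier B" "\<delta> (cl (p + q)) = \<delta> (cl p) \<oplus>\<^bsub>B\<^esub> \<delta> (cl q)"
    "\<delta> (cl (Const c * p)) = c \<odot>\<^bsub>B\<^esub> \<delta> (cl p)"
    "\<delta> (cl (p * q)) = (\<delta> (cl p) \<otimes>\<^bsub>B\<^esub> cl q) \<oplus>\<^bsub>B\<^esub> (cl p \<otimes>\<^bsub>B\<^esub> \<delta> (cl q))"
proof -
  have mem: "cl p \<in> carrier B" for p by (simp add: B_carrier)
  have K: "c \<in> carrier (K_ring :: 'k ring)" for c by (simp add: ring_of_type_algebra_def)
  show "\<delta> (cl p) \<in> carrier B" using assms mem by (auto simp: derivations_def)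
  show "\<delta> (cl (p + q)) = \<delta> (cl p) \<oplus>\<^bsub>B\<^esub> \<delta> (cl q)"
    using assms mem[of p] mem[of q] by (simp add: derivations_def flip: B_add)
  show "\<delta> (cl (Const c * p)) = c \<odot>\<^bsub>B\<^esub> \<delta> (cl p)"
    using assms mem[of p] K[of c] by (simp add: derivations_def flip: B_smult)
  show "\<delta> (cl (p * q)) = (\<delta> (cl p) \<otimes>\<^bsub>B\<^esub> cl q) \<oplus>\<^bsub>B\<^esub> (cl p \<otimes>\<^bsub>B\<^esub> \<delta> (cl q))"
    using assms mem[of p] mem[of q] by (simp add: derivations_def flip: B_mult)
qed

text \<open>
  The derivation is carried over to \<open>S\<close> along the isomorphism with \<open>B\<close>; the polynomials
  \<open>\<delta>' p\<close> represent its values.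
\<close>

lemma LND_kills_Y:
  assumes cases: "(s \<ge> 2 \<and> (\<forall>k. k2 k \<ge> 2)) \<or> (r \<ge> 2 \<and> (\<forall>k. k1 k \<ge> 2))"
    and \<delta>: "\<delta> \<in> LNDs (K_ring :: 'k ring) B"
  shows "\<delta> (cl (Var (Y j))) = \<zero>\<^bsub>B\<^esub>"
proof -
  have der: "\<delta> \<in> derivations (K_ring :: 'k ring) B" using \<delta> by (simp add: LNDs_def)
  note d = derivationD[OF der]
  have "\<forall>p. \<exists>q. \<delta> (cl p) = cl q" using d(1) by (auto simp: B_carrier)
  from choice[OF this] obtain \<delta>' where \<delta>': "\<And>p. \<delta> (cl p) = cl (\<delta>' p)" by blast
  define dl where "dl x = to_image (\<delta> (of_image x))" for x
  have dl: "dl (\<phi> p) = \<phi> (\<delta>' p)" for p by (simp add: dl_def \<delta>')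
  interpret L: image_LND k1 k2 f1 f2 g1 g2 r s j dl
  proof unfold_locales
    fix x y :: "'k laurent" and c :: 'k assume "x \<in> S"
    then obtain p where x: "x = \<phi> p" by blast
    show "dl x \<in> S" by (simp add: x dl)
    have "cl (\<delta>' (Const c * p)) = cl (Const c * \<delta>' p)"
      using d(3)[of c p] by (simp only: \<delta>' B_smult)
    then have "dl (\<phi> (Const c * p)) = \<phi> (Const c * \<delta>' p)" by (simp only: dl cl_eq_iff)
    then show "dl (Poly_Mapping.single 0 c * x) = Poly_Mapping.single 0 c * dl x"
      by (simp only: x dl phi.eval_mult phi.eval_Const)
    obtain N where N: "(\<delta> ^^ N) (cl p) = \<zero>\<^bsub>B\<^esub>"
      using \<delta> by (auto simp: LNDs_def B_carrier)
    have "\<exists>q. (\<delta> ^^ n) (cl p) = cl q \<and> (dl ^^ n) (\<phi> p) = \<phi> q" for n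
    proof (induction n)
      case (Suc n)
      then obtain q where "(\<delta> ^^ n) (cl p) = cl q" "(dl ^^ n) (\<phi> p) = \<phi> q" by blast
      then show ?case by (intro exI[of _ "\<delta>' q"]) (simp add: \<delta>' dl)
    qed auto
    then obtain q where q: "(\<delta> ^^ N) (cl p) = cl q" "(dl ^^ N) (\<phi> p) = \<phi> q" by blast
    then have "\<phi> q = 0" using N cl_eq_iff[of q 0] by (simp add: B_zero)
    then show "\<exists>N. (dl ^^ N) x = 0" using q x by auto
    assume "y \<in> S"
    then obtain q where y: "y = \<phi> q" by blast
    have "cl (\<delta>' (p + q)) = cl (\<delta>' p + \<delta>' q)"
      using d(2)[of p q] by (simp only: \<delta>' B_add)
    then have "dl (\<phi> (p + q)) = \<phi> (\<delta>' p + \<delta>' q)" by (simp only: dl cl_eq_iff)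
    then show "dl (x + y) = dl x + dl y" by (simp only: x y dl phi.eval_add)
    have "cl (\<delta>' (p * q)) = cl (\<delta>' p * q + p * \<delta>' q)"
      using d(4)[of p q] by (simp only: \<delta>' B_add B_mult)
    then have "dl (\<phi> (p * q)) = \<phi> (\<delta>' p * q + p * \<delta>' q)" by (simp only: dl cl_eq_iff)
    then show "dl (x * y) = dl x * y + x * dl y" by (simp only: x y dl phi.eval_add phi.eval_mult)
  qed
  have "dl (\<phi> (Var (Y j))) = 0" using L.d_kills_Y[OF cases] by (simp only: phi.eval_Var)
  then have "\<phi> (\<delta>' (Var (Y j))) = \<phi> 0" by (simp only: dl phi.eval_0)
  then show ?thesis by (simp only: \<delta>' B_zero cl_eq_iff)
qed

lemma D_class_LND:
  defines "\<delta> \<equiv> \<lambda>C. of_image (D (to_image C))"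
  shows "\<delta> \<in> LNDs (K_ring :: 'k ring) B" and "\<delta> (cl p) = \<zero>\<^bsub>B\<^esub> \<Longrightarrow> \<exists>q\<in>polys_in (range Y). cl p = cl q"
proof -
  have "\<forall>p. \<exists>q. D (\<phi> p) = \<phi> q" using D_closed by blast
  from choice[OF this] obtain D' where D': "\<And>p. D (\<phi> p) = \<phi> (D' p)" by blast
  have \<delta>: "\<delta> (cl p) = cl (D' p)" for p by (simp add: \<delta>_def D')
  have eqI: "cl (D' p) = cl q" if "D (\<phi> p) = \<phi> q" for p q using that by (simp add: cl_eq_iff D')
  have "\<delta> \<in> derivations (K_ring :: 'k ring) B"
    unfolding derivations_def
  proof (intro CollectI conjI ballI)
    show "\<delta> \<in> carrier B \<rightarrow> carrier B" by (auto simp: B_carrier \<delta>)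
  next
    fix a b assume "a \<in> carrier B" "b \<in> carrier B"
    then obtain p q where ab: "a = cl p" "b = cl q" by (auto simp: B_carrier)
    show "\<delta> (a \<oplus>\<^bsub>B\<^esub> b) = \<delta> a \<oplus>\<^bsub>B\<^esub> \<delta> b"
      unfolding ab B_add \<delta> by (rule eqI) (simp only: phi.eval_add D_add D')
    show "\<delta> (a \<otimes>\<^bsub>B\<^esub> b) = \<delta> a \<otimes>\<^bsub>B\<^esub> b \<oplus>\<^bsub>B\<^esub> a \<otimes>\<^bsub>B\<^esub> \<delta> b"
      unfolding ab B_mult \<delta> B_add by (rule eqI) (simp only: phi.eval_add phi.eval_mult D_mult D')
  next
    fix c :: 'k and a assume "a \<in> carrier B"
    then obtain p where a: "a = cl p" by (auto simp: B_carrier)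
    show "\<delta> (c \<odot>\<^bsub>B\<^esub> a) = c \<odot>\<^bsub>B\<^esub> \<delta> a"
      unfolding a B_smult \<delta> by (rule eqI) (simp add: phi.eval_mult D_mult D_scalar D')
  qed
  moreover have "\<exists>N. (\<delta> ^^ N) a = \<zero>\<^bsub>B\<^esub>" if carr: "a \<in> carrier B" for a
  proof -
    obtain p where a: "a = cl p" using carr by (auto simp: B_carrier)
    have "\<exists>q. (\<delta> ^^ n) (cl p) = cl q \<and> (D ^^ n) (\<phi> p) = \<phi> q" for n
    proof (induction n)
      case (Suc n)
      then obtain q where "(\<delta> ^^ n) (cl p) = cl q" "(D ^^ n) (\<phi> p) = \<phi> q" by blast
      then show ?case by (intro exI[of _ "D' q"]) (simp add: \<delta> D')
    qed auto
    moreover obtain N where N: "(D ^^ N) (\<phi> p) = 0" using D_nilpotent by blast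
    ultimately obtain q where "(\<delta> ^^ N) (cl p) = cl q" "\<phi> q = 0" by metis
    then show ?thesis unfolding a B_zero using cl_eq_iff[of q 0] by auto
  qed
  ultimately show "\<delta> \<in> LNDs (K_ring :: 'k ring) B" by (simp add: LNDs_def)
  show "\<exists>q\<in>polys_in (range Y). cl p = cl q" if "\<delta> (cl p) = \<zero>\<^bsub>B\<^esub>"
  proof -
    have "D (\<phi> p) = 0" using that cl_eq_iff[of "D' p" 0] by (simp add: \<delta> B_zero D')
    then show ?thesis using kernel_D cl_eq_iff by metis
  qed
qed

lemma generated_by_Y:
  "generate_subalgebra (K_ring :: 'k ring) B {cl (Var (Y i)) | i. True} = cl ` polys_in (range Y)"
  (is "?G = _")
proof
  interpret cB: cring B using algebra_B_alg unfolding algebra_def by blast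
  have mem: "cl p \<in> carrier B" for p by (simp add: B_carrier)
  have one: "cl (Const c) = c \<odot>\<^bsub>B\<^esub> \<one>\<^bsub>B\<^esub>" for c by (simp add: B_one B_smult)
  show "?G \<subseteq> cl ` polys_in (range Y)"
  proof
    fix x assume "x \<in> ?G"
    then show "x \<in> cl ` polys_in (range Y)"
      unfolding generate_subalgebra_def
    proof (induction x rule: generate_ring.induct)
      case one
      show ?case unfolding B_one by (rule imageI) simp
    next
      case (incl h)
      then show ?case
      proof
        assume "h \<in> {c \<odot>\<^bsub>B\<^esub> \<one>\<^bsub>B\<^esub> |c. c \<in> carrier (K_ring :: 'k ring)}"
        then obtain c where "h = cl (Const c)" by (auto simp: one)
        then show ?thesis by auto
      next
        assume "h \<in> {cl (Var (Y i)) |i. True}"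
        then show ?thesis by (auto intro: polys_in_Var)
      qed
    next
      case (a_inv h)
      then obtain p where p: "h = cl p" "p \<in> polys_in (range Y)" by blast
      have "\<ominus>\<^bsub>B\<^esub> cl p = cl (Const (-1) * p)"
      proof (rule cB.minus_equality)
        have "Const (-1) = (-1 :: ('m gen, 'k) mpoly)"
          by (simp add: Const_def single_uminus)
        then show "cl (Const (-1) * p) \<oplus>\<^bsub>B\<^esub> cl p = \<zero>\<^bsub>B\<^esub>" by (simp add: B_add B_zero)
      qed (rule mem)+
      then show ?case unfolding p(1) by (simp only: imageI polys_in_mult[OF polys_in_Const p(2)])
    next
      case (eng_add h1 h2)
      then show ?case by (auto simp: B_add intro: polys_in_add)
    next
      case (eng_mult h1 h2)
      then show ?case by (auto simp: B_mult intro: polys_in_mult)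
    qed
  qed
  show "cl ` polys_in (range Y) \<subseteq> ?G"
  proof
    fix x assume "x \<in> cl ` polys_in (range Y)"
    then obtain p where x: "x = cl p" and p: "p \<in> polys_in (range Y)" by blast
    show "x \<in> ?G" unfolding x using p
      unfolding generate_subalgebra_def
    proof (induction p rule: mpoly_induct)
      case (Const a)
      show ?case unfolding one by (rule generate_ring.incl) (auto simp: ring_of_type_algebra_def)
    next
      case (Var v)
      then show ?case by (auto intro!: generate_ring.incl)
    next
      case (add p q)
      then show ?case using generate_ring.eng_add[of "cl p" B _ "cl q"] by (simp only: B_add)
    next
      case (mult p q)
      then show ?case using generate_ring.eng_mult[of "cl p" B _ "cl q"] by (simp only: B_mult)
    qed
  qed
qed

end

theorem theorem7p9:
  fixes k1 k2 :: "'m::finite \<Rightarrow> nat"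
    and f1 f2 :: "('m gen, 'k::{alg_closed_field, field_char_0}) mpoly"
    and r s :: nat
  assumes "\<And>j. k1 j > 0" and "\<And>j. k2 j > 0"
    and "f1 \<in> polys_in ({Z} \<union> range Y)"
    and "monic_in Z f1" and "r = degree_in Z f1" and "r > 0"
    and "f2 \<in> polys_in ({Z} \<union> range Y \<union> {X1})"
    and "monic_in X1 f2" and "s = degree_in X1 f2" and "s > 0"
    and "(s \<ge> 2 \<and> (\<forall>j. k2 j \<ge> 2)) \<or> (r \<ge> 2 \<and> (\<forall>j. k1 j \<ge> 2))"
  shows "Makar_Limanov (K_ring :: 'k ring) (B_alg k1 k2 f1 f2) =
         generate_subalgebra (K_ring :: 'k ring) (B_alg k1 k2 f1 f2)
           {B_class k1 k2 f1 f2 (Var (Y j)) | j. True}"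
proof -
  let ?B = "B_alg k1 k2 f1 f2" and ?cl = "B_class k1 k2 f1 f2" and ?K = "K_ring :: 'k ring"
  obtain g1 where g1: "f1 = Var Z ^ r + g1" "g1 \<in> polys_in ({Z} \<union> range Y)"
      "\<And>m. m \<in> Poly_Mapping.keys g1 \<Longrightarrow> Poly_Mapping.lookup m Z < r"
    using monic_in_decompose[OF assms(4,3)] assms(5) by metis
  obtain g2 where g2: "f2 = Var X1 ^ s + g2" "g2 \<in> polys_in ({Z} \<union> range Y \<union> {X1})"
      "\<And>m. m \<in> Poly_Mapping.keys g2 \<Longrightarrow> Poly_Mapping.lookup m X1 < s"
    using monic_in_decompose[OF assms(8,7)] assms(9) by metis
  have W: "weighted_danielewski k1 k2 f1 f2 g1 g2 r s"
    unfolding weighted_danielewski_def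
    by (rule double_danielewski.intro) (use assms g1 g2 in blast)+
  have kills_Y: "\<delta> (?cl (Var (Y i))) = \<zero>\<^bsub>?B\<^esub>" if "\<delta> \<in> LNDs ?K ?B" for \<delta> i
    by (rule weighted_danielewski.LND_kills_Y[OF W assms(11) that])
  \<comment> \<open>For the remaining argument any choice of the distinguished index will do.\<close>
  interpret weighted_danielewski k1 k2 f1 f2 g1 g2 r s undefined by (rule W)
  interpret cB: cring B using algebra_B_alg unfolding algebra_def by blast
  have "Makar_Limanov ?K B = cl ` polys_in (range Y)"
  proof
    show "Makar_Limanov ?K B \<subseteq> cl ` polys_in (range Y)"
    proof
      fix x assume "x \<in> Makar_Limanov ?K B"
      then have "x \<in> a_kernel B B (\<lambda>C. of_image (D (to_image C)))"
        using D_class_LND(1) unfolding Makar_Limanov_def by blast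
      then have "x \<in> carrier B" "of_image (D (to_image x)) = \<zero>\<^bsub>B\<^esub>" by (simp_all add: a_kernel_def')
      moreover from this(1) obtain p where "x = cl p" by (auto simp: B_carrier)
      ultimately show "x \<in> cl ` polys_in (range Y)" using D_class_LND(2)[of p] by blast
    qed
    show "cl ` polys_in (range Y) \<subseteq> Makar_Limanov ?K B"
      unfolding Makar_Limanov_def
    proof (intro INT_greatest image_subsetI)
      fix \<delta> and p :: "('m gen, 'k) mpoly" assume \<delta>: "\<delta> \<in> LNDs ?K B" and p: "p \<in> polys_in (range Y)"
      then have der: "\<delta> \<in> derivations ?K B" by (simp add: LNDs_def)
      note d = derivationD[OF der]
      have mem: "cl p \<in> carrier B" for p by (simp add: B_carrier)
      have d1: "\<delta> (cl 1) = \<zero>\<^bsub>B\<^esub>"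
      proof -
        have "\<delta> (cl 1) = \<delta> (cl 1) \<oplus>\<^bsub>B\<^esub> \<delta> (cl 1)"
          using d(4)[of 1 1] d(1)[of 1] by (simp flip: B_one)
        then show ?thesis using d(1)[of 1] cB.add.r_cancel_one' by blast
      qed
      have "\<delta> (cl p) = \<zero>\<^bsub>B\<^esub>" using p
      proof (induction p rule: mpoly_induct)
        case (Const a)
        have "\<delta> (cl (Const a * 1)) = cl (Const a * 0)" unfolding d(3) d1 B_zero B_smult ..
        then show ?case by (simp add: B_zero)
      next
        case (Var v)
        then show ?case using kills_Y[OF \<delta>] by auto
      next
        case (add p q)
        then show ?case unfolding d(2) by simp
      next
        case (mult p q)
        then show ?case using mem[of p] mem[of q] unfolding d(4) by simp
      qed
      then show "cl p \<in> a_kernel B B \<delta>" by (simp add: a_kernel_def' mem)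
    qed
  qed
  then show ?thesis by (simp only: generated_by_Y)
qed

end
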